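(* Let $(\phi_t)$ be a holomorphic semigroup, not a group, in $\mathbb{D}$. Let $\tau\in\overline{\mathbb{D}}$ be the Denjoy-Wolff point of $(\phi_t)$ and $\mu$ its spectral value. Let $h$ be the Königs function of $(\phi_t)$. (1) If $\tau\in\mathbb{D}$ and there exist $\theta_0\in[-\pi,\pi)$ and $\beta\in(0,2\pi]$ such that $\mathrm{Spir}[\mu,\beta,\theta_0]\subset h(\mathbb{D})$ is a maximal $\mu$-spirallike sector of $h(\mathbb{D})$, then $\Delta:=h^{-1}(\mathrm{Spir}[\mu,\beta,\theta_0])$ is a hyperbolic petal for $(\phi_t)$. Moreover, if $\sigma\in\partial\Delta$ is the unique repelling fixed point of $(\phi_t)$ contained in $\partial\Delta$, then the repelling spectral value of $(\phi_t)$ at $\sigma$ is $\lambda=-\frac{|\mu|^2\pi}{\beta\operatorname{Re}\mu}$. (2) If $\tau\in\partial\mathbb{D}$ and there exist $z_0\in\mathbb{C}$ and $\rho>0$ such that $z_0+\mathbb{S}_\rho\subset h(\mathbb{D})$ is a maximal strip of $h(\mathbb{D})$, then $\Delta:=h^{-1}(z_0+\mathbb{S}_\rho)$ is a hyperbolic petal for $(\phi_t)$. Moreover, if $\sigma\in\partial\Delta$ is the unique repelling fixed point of $(\phi_t)$ contained in $\partial\Delta$, then the repelling spectral value of $(\phi_t)$ at $\sigma$ is $\lambda=-\frac{\pi}{\rho}$.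
   Context: $\mathbb{D}$ is the open unit disc in $\mathbb{C}$. A holomorphic semigroup in $\mathbb{D}$ is a family $(\phi_t)_{t\ge0}$ of holomorphic self-maps of $\mathbb{D}$ with $\phi_0=\mathrm{id}$, $\phi_{t+s}=\phi_t\circ\phi_s$, continuous in $t$ for uniform convergence on compacta. It is a group if $\phi_t$ is an automorphism of $\mathbb{D}$ for some (equivalently all) $t>0$. If it is not a group, the Denjoy-Wolff point is the unique $\tau\in\overline{\mathbb{D}}$ with $\phi_t\to\tau$ uniformly on compacta as $t\to+\infty$. The semigroup is elliptic if $\tau\in\mathbb{D}$; then $\phi_t'(\tau)=e^{-\mu t}$ with $\operatorname{Re}\mu>0$. If $\tau\in\partial\mathbb{D}$, then $\angle\lim_{z\to\tau}\phi_t'(z)=e^{-\mu t}$ with $\mu\ge0$ ($\angle\lim$ is the non-tangential limit); it is hyperbolic if $\mu>0$, parabolic if $\mu=0$. The number $\mu$ is the spectral value. $\sigma\in\partial\mathbb{D}$ is a repelling fixed point if $\angle\lim_{z\to\sigma}\phi_t(z)=\sigma$ and $\angle\lim_{z\to\sigma}\phi_t'(z)=e^{-\lambda t}$ for all $t\ge0$, with some $\lambda<0$ (repelling spectral value at $\sigma$). Petals are the connected components of the interior of $\bigcap_{t\ge0}\phi_t(\mathbb{D})$. A petal $\Delta$ is hyperbolic if $\partial\Delta$ contains a repelling fixed point of $(\phi_t)$ (which is then unique). For $\rho>0$, $\mathbb{S}_\rho=\{\zeta\in\mathbb{C}:0<\operatorname{Re}\zeta<\rho\}$. The Königs function of $(\phi_t)$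 is the univalent map $h:\mathbb{D}\to\mathbb{C}$ of its canonical model $(\Omega,h,\psi_t)$: $h\circ\phi_t=\psi_t\circ h$, $\bigcup_{t\ge0}\psi_t^{-1}(h(\mathbb{D}))=\Omega$, where $\Omega=\mathbb{C}$, $\psi_t(z)=e^{-\mu t}z$ in the elliptic case; $\Omega=\mathbb{S}_{\pi/\mu}$, $\psi_t(z)=z+it$ in the hyperbolic case; $\Omega\in\{\{\operatorname{Re}\zeta>0\},\{\operatorname{Re}\zeta<0\},\mathbb{C}\}$, $\psi_t(z)=z+it$ in the parabolic case (such a model exists and is unique up to isomorphism of models). For $\operatorname{Re}\mu>0$, $\alpha\in(0,\pi]$, $\theta_0\in[-\pi,\pi)$, the $\mu$-spirallike sector of amplitude $2\alpha$ and center $e^{i\theta_0}$ is $\mathrm{Spir}[\mu,2\alpha,\theta_0]=\{e^{t\mu+i\theta}:t\in\mathbb{R},\ \theta\in(\theta_0-\alpha,\theta_0+\alpha)\}$. A $\mu$-spirallike sector contained in $h(\mathbb{D})$ is maximal if it is not properly contained in another $\mu$-spirallike sector contained in $h(\mathbb{D})$. A strip $z_0+\mathbb{S}_\rho\subset h(\mathbb{D})$ is maximal if it is not properly contained in another strip $z_1+\mathbb{S}_r\subset h(\mathbb{D})$, $r>0$, $z_1\in\mathbb{C}$. *)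

theory Defs
  imports "HOL-Complex_Analysis.Complex_Analysis"
begin

abbreviation unit_disc :: "complex set" where
  "unit_disc \<equiv> ball 0 1"

abbreviation unit_circle :: "complex set" where
  "unit_circle \<equiv> sphere 0 1"

text \<open>Non-tangential limits at a point of the unit circle are limits within every Stolz region.\<close>

definition stolz_region :: "complex \<Rightarrow> real \<Rightarrow> complex set" where
  "stolz_region \<sigma> M = {z \<in> unit_disc. cmod (\<sigma> - z) < M * (1 - cmod z)}"

definition has_angular_limit :: "(complex \<Rightarrow> complex) \<Rightarrow> complex \<Rightarrow> complex \<Rightarrow> bool" where
  "has_angular_limit f \<sigma> L \<longleftrightarrow> (\<forall>M>1. (f \<longlongrightarrow> L) (at \<sigma> within stolz_region \<sigma> M))"

text \<open>
  Self-maps of the disc are total functions on the complex plane of which only the values on the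
  disc matter; likewise only times \<open>t \<ge> 0\<close> matter for a semigroup.
\<close>

definition holomorphic_semigroup :: "(real \<Rightarrow> complex \<Rightarrow> complex) \<Rightarrow> bool" where
  "holomorphic_semigroup \<phi> \<longleftrightarrow>
     (\<forall>t\<ge>0. \<phi> t holomorphic_on unit_disc \<and> \<phi> t ` unit_disc \<subseteq> unit_disc) \<and>
     (\<forall>z\<in>unit_disc. \<phi> 0 z = z) \<and>
     (\<forall>t\<ge>0. \<forall>s\<ge>0. \<forall>z\<in>unit_disc. \<phi> (t + s) z = \<phi> t (\<phi> s z)) \<and>
     (\<forall>s\<ge>0. \<forall>K. compact K \<and> K \<subseteq> unit_disc \<longrightarrow> uniform_limit K \<phi> (\<phi> s) (at s within {0..}))"

definition disc_automorphism :: "(complex \<Rightarrow> complex) \<Rightarrow> bool" where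
  "disc_automorphism f \<longleftrightarrow> f holomorphic_on unit_disc \<and> bij_betw f unit_disc unit_disc"

definition semigroup_is_group :: "(real \<Rightarrow> complex \<Rightarrow> complex) \<Rightarrow> bool" where
  "semigroup_is_group \<phi> \<longleftrightarrow> (\<exists>t>0. disc_automorphism (\<phi> t))"

definition denjoy_wolff_point :: "(real \<Rightarrow> complex \<Rightarrow> complex) \<Rightarrow> complex \<Rightarrow> bool" where
  "denjoy_wolff_point \<phi> \<tau> \<longleftrightarrow>
     \<tau> \<in> cball 0 1 \<and>
     (\<forall>K. compact K \<and> K \<subseteq> unit_disc \<longrightarrow> uniform_limit K \<phi> (\<lambda>_. \<tau>) at_top)"

text \<open>
  The spectral value is a complex number, which is real and nonnegative when the Denjoy--Wolff
  point \<open>\<tau>\<close> lies on the unit circle.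
\<close>

definition spectral_value :: "(real \<Rightarrow> complex \<Rightarrow> complex) \<Rightarrow> complex \<Rightarrow> complex \<Rightarrow> bool" where
  "spectral_value \<phi> \<tau> \<mu> \<longleftrightarrow>
     (if \<tau> \<in> unit_disc
      then Re \<mu> > 0 \<and> (\<forall>t\<ge>0. deriv (\<phi> t) \<tau> = exp (- \<mu> * of_real t))
      else \<mu> \<in> \<real> \<and> Re \<mu> \<ge> 0 \<and>
           (\<forall>t\<ge>0. has_angular_limit (deriv (\<phi> t)) \<tau> (exp (- \<mu> * of_real t))))"

definition repelling_spectral_value :: "(real \<Rightarrow> complex \<Rightarrow> complex) \<Rightarrow> complex \<Rightarrow> real \<Rightarrow> bool" where
  "repelling_spectral_value \<phi> \<sigma> l \<longleftrightarrow>
     l < 0 \<and> (\<forall>t\<ge>0. has_angular_limit (deriv (\<phi> t)) \<sigma> (of_real (exp (- l * t))))"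

definition repelling_fixed_point :: "(real \<Rightarrow> complex \<Rightarrow> complex) \<Rightarrow> complex \<Rightarrow> bool" where
  "repelling_fixed_point \<phi> \<sigma> \<longleftrightarrow>
     \<sigma> \<in> unit_circle \<and>
     (\<forall>t\<ge>0. has_angular_limit (\<phi> t) \<sigma> \<sigma>) \<and>
     (\<exists>l. repelling_spectral_value \<phi> \<sigma> l)"

definition petal :: "(real \<Rightarrow> complex \<Rightarrow> complex) \<Rightarrow> complex set \<Rightarrow> bool" where
  "petal \<phi> \<Delta> \<longleftrightarrow> \<Delta> \<in> components (interior (\<Inter>t\<in>{0..}. \<phi> t ` unit_disc))"

definition hyperbolic_petal :: "(real \<Rightarrow> complex \<Rightarrow> complex) \<Rightarrow> complex set \<Rightarrow> bool" where
  "hyperbolic_petal \<phi> \<Delta> \<longleftrightarrow> petal \<phi> \<Delta> \<and> (\<exists>\<sigma>\<in>frontier \<Delta>. repelling_fixed_point \<phi> \<sigma>)"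

definition strip :: "real \<Rightarrow> complex set" where
  "strip \<rho> = {\<zeta>. 0 < Re \<zeta> \<and> Re \<zeta> < \<rho>}"

definition semigroup_model ::
  "(real \<Rightarrow> complex \<Rightarrow> complex) \<Rightarrow> complex set \<Rightarrow> (complex \<Rightarrow> complex) \<Rightarrow> (real \<Rightarrow> complex \<Rightarrow> complex) \<Rightarrow> bool"
  where
  "semigroup_model \<phi> \<Omega> h \<psi> \<longleftrightarrow>
     h holomorphic_on unit_disc \<and> inj_on h unit_disc \<and> h ` unit_disc \<subseteq> \<Omega> \<and>
     (\<forall>t\<ge>0. \<forall>z\<in>unit_disc. h (\<phi> t z) = \<psi> t (h z)) \<and>
     (\<Union>t\<in>{0..}. {w \<in> \<Omega>. \<psi> t w \<in> h ` unit_disc}) = \<Omega>"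

text \<open>
  The parameters \<open>\<tau>\<close> and \<open>\<mu>\<close> are the Denjoy--Wolff point and the spectral value of \<open>\<phi>\<close>; the three
  branches are the elliptic, the hyperbolic and the parabolic case.  A Koenigs function is only
  unique up to isomorphism of models, hence a predicate.
\<close>

definition koenigs_function ::
  "(real \<Rightarrow> complex \<Rightarrow> complex) \<Rightarrow> complex \<Rightarrow> complex \<Rightarrow> (complex \<Rightarrow> complex) \<Rightarrow> bool" where
  "koenigs_function \<phi> \<tau> \<mu> h \<longleftrightarrow>
     (if \<tau> \<in> unit_disc
      then semigroup_model \<phi> UNIV h (\<lambda>t z. exp (- \<mu> * of_real t) * z)
      else if \<mu> \<noteq> 0
      then semigroup_model \<phi> (strip (pi / Re \<mu>)) h (\<lambda>t z. z + \<i> * of_real t)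
      else \<exists>\<Omega>\<in>{{\<zeta>. Re \<zeta> > 0}, {\<zeta>. Re \<zeta> < 0}, UNIV}.
             semigroup_model \<phi> \<Omega> h (\<lambda>t z. z + \<i> * of_real t))"

text \<open>The second argument of \<open>spir\<close> is the full amplitude, that is, \<open>2\<alpha>\<close>.\<close>

definition spir :: "complex \<Rightarrow> real \<Rightarrow> real \<Rightarrow> complex set" where
  "spir \<mu> \<beta> \<theta>\<^sub>0 =
     {exp (of_real t * \<mu> + \<i> * of_real \<theta>) | t \<theta>. \<theta> \<in> {\<theta>\<^sub>0 - \<beta> / 2 <..< \<theta>\<^sub>0 + \<beta> / 2}}"

definition spirallike_sector :: "complex \<Rightarrow> complex set \<Rightarrow> bool" where
  "spirallike_sector \<mu> S \<longleftrightarrow> (\<exists>\<alpha>\<in>{0<..pi}. \<exists>\<theta>\<^sub>0\<in>{-pi..<pi}. S = spir \<mu> (2 * \<alpha>) \<theta>\<^sub>0)"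

definition maximal_spirallike_sector :: "complex \<Rightarrow> complex set \<Rightarrow> complex set \<Rightarrow> bool" where
  "maximal_spirallike_sector \<mu> A S \<longleftrightarrow>
     spirallike_sector \<mu> S \<and> S \<subseteq> A \<and> \<not> (\<exists>T. spirallike_sector \<mu> T \<and> S \<subset> T \<and> T \<subseteq> A)"

definition translated_strip :: "complex set \<Rightarrow> bool" where
  "translated_strip S \<longleftrightarrow> (\<exists>z\<^sub>1. \<exists>r>0. S = (+) z\<^sub>1 ` strip r)"

definition maximal_strip :: "complex set \<Rightarrow> complex set \<Rightarrow> bool" where
  "maximal_strip A S \<longleftrightarrow>
     translated_strip S \<and> S \<subseteq> A \<and> \<not> (\<exists>T. translated_strip T \<and> S \<subset> T \<and> T \<subseteq> A)"

end

(*
  In Koenigs coordinates the semigroup is the translation by i t, the petal is the preimage of a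
  vertical strip of width rho (logarithmic coordinates in the elliptic case), and it is conjugate to
  the hyperbolic translations of the disc with multiplier exp (pi t / rho).

  Existence. Renormalize phi_n by disc automorphisms T_n that move 0 to the n-th point of the backward
  orbit on the axis of the petal. The limits of phi_n o T_n map into every phi_s(D), hence into the
  petal, so by the Schwarz lemma the conformal map of the petal, seen from the backward orbit, tends to
  a rotation. Consequently cosh of the distance to 0 along the orbit satisfies asymptotically the three
  term recursion of a geodesic; the orbit converges geometrically to a boundary point sigma within a
  Stolz region, the rotation is identified, and T_n^-1 o phi_t o T_n tends to the hyperbolic translation
  with repelling fixed point sigma. As Stolz regions stay within bounded distance of the orbit, this
  gives the angular limits of phi_t and its derivative.

  Uniqueness. At a repelling fixed point in the frontier of the petal, the Koenigs coordinate of a radial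
  sequence stays away from the boundary and descends with asymptotically unit speed. By maximality it
  cannot cross the half-lines missing from the image next to the strip. Either it ends inside the strip,
  and then the point is sigma, or a half-line separates it from the strip, and the argument function of the
  slit plane contradicts Lindelof's theorem.
*)
theory Submission
  imports Defs
begin

section \<open>Hyperbolic translations of the disc\<close>

text \<open>No regularity of the petal at its boundary is available, so \<sigma> cannot be obtained
  as a boundary value of the conformal map; it has to be produced from the interior. Montel's
  theorem gives limits only along subsequences, and the limiting rotation could depend on the
  subsequence. The three-term recursion escapes this: whatever the rotation is, the two neighbours
  of an orbit point are seen from it in nearly opposite directions, so the coefficient has a genuine
  limit, 2 cosh (2 c). Its dominant root exp (2 c) is the growth rate of cosh of the distance, and
  only one rotation is compatible with that rate.

  Both cases share one chart in which time is vertical translation. In the elliptic case the chart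
  has a period \<omega>: strips are known only modulo \<omega>, the Denjoy-Wolff point is missing,
  and in the uniqueness proof the strip has to be separated together with all its translates, which
  takes two slits instead of one.

  The rate is c = pi / (2 \<rho>), because the translation with parameter tanh (c t) has multiplier
  exp (2 c t) at its repelling fixed point.\<close>

definition mob :: "complex \<Rightarrow> complex \<Rightarrow> complex" where
  "mob a z = (z + a) / (1 + cnj a * z)"

lemma mob_denom_nonzero:
  assumes "cmod a \<le> 1" "cmod z < 1"
  shows "1 + cnj a * z \<noteq> 0"
proof
  assume "1 + cnj a * z = 0"
  then have "cnj a * z = -1" by (simp add: add_eq_0_iff)
  then have "cmod a * cmod z = 1" by (metis norm_mult complex_mod_cnj norm_minus_cancel norm_one)
  moreover have "cmod a * cmod z \<le> 1 * cmod z" by (rule mult_right_mono) (use assms in auto)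
  ultimately show False using assms by linarith
qed

lemma mob_norm_diff:
  "(cmod (1 + cnj a * z))\<^sup>2 - (cmod (z + a))\<^sup>2 = (1 - (cmod a)\<^sup>2) * (1 - (cmod z)\<^sup>2)"
  by (simp add: cmod_power2) (simp add: algebra_simps power2_eq_square)

text \<open>With \<open>mob_norm_diff\<close> this gives numerator and denominator of
  \<open>cosh_dist (mob a z)\<close> in closed form.\<close>

lemma mob_norm_add:
  "(cmod (1 + cnj a * z))\<^sup>2 + (cmod (z + a))\<^sup>2 =
     (1 + (cmod a)\<^sup>2) * (1 + (cmod z)\<^sup>2) + 4 * Re (cnj a * z)"
  by (simp add: cmod_power2) (simp add: algebra_simps power2_eq_square)

lemma one_minus_norm_mob:
  assumes "cmod a < 1" "cmod z < 1"
  shows "1 - (cmod (mob a z))\<^sup>2 = (1 - (cmod a)\<^sup>2) * (1 - (cmod z)\<^sup>2) / (cmod (1 + cnj a * z))\<^sup>2"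
proof -
  have "1 + cnj a * z \<noteq> 0" using mob_denom_nonzero assms by auto
  then show ?thesis
    by (simp add: mob_def norm_divide power_divide mob_norm_diff[symmetric] diff_divide_distrib)
qed

lemma norm_sq_less_one: "cmod z < 1 \<Longrightarrow> (cmod z)\<^sup>2 < 1"
  by (simp add: abs_square_less_1)

lemma norm_mob_less_one:
  assumes "cmod a < 1" "cmod z < 1"
  shows "cmod (mob a z) < 1"
proof -
  have "1 + cnj a * z \<noteq> 0" using mob_denom_nonzero assms by auto
  then have "0 < 1 - (cmod (mob a z))\<^sup>2"
    unfolding one_minus_norm_mob[OF assms]
    using assms by (intro divide_pos_pos mult_pos_pos) (auto simp: norm_sq_less_one)
  then have "(cmod (mob a z))\<^sup>2 < 1" by simp
  then show ?thesis by (simp add: abs_square_less_1)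
qed

text \<open>A hyperbolic disc of fixed radius around \<open>a\<close> has Euclidean size at most a
  constant times 1 - |a|^2. Points at bounded hyperbolic distance from a sequence that tends to the
  circle therefore have the same Euclidean limit.\<close>

lemma mob_dist_le:
  assumes "cmod a < 1" "cmod u \<le> r" "r < 1"
  shows "cmod (mob a u - a) \<le> (1 - (cmod a)\<^sup>2) / (1 - r)"
proof -
  have u1: "cmod u < 1" using assms by simp
  have nz: "1 + cnj a * u \<noteq> 0" using mob_denom_nonzero[of a u] assms u1 by simp
  have pos: "1 - (cmod a)\<^sup>2 > 0" using norm_sq_less_one[OF assms(1)] by simp
  have "mob a u - a = u * of_real (1 - (cmod a)\<^sup>2) / (1 + cnj a * u)"
    unfolding mob_def using nz complex_norm_square[of a] by (simp add: field_simps)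
  then have "cmod (mob a u - a) = cmod (u * of_real (1 - (cmod a)\<^sup>2) / (1 + cnj a * u))" by (rule arg_cong)
  then have eq: "cmod (mob a u - a) = cmod u * (1 - (cmod a)\<^sup>2) / cmod (1 + cnj a * u)"
    unfolding norm_divide norm_mult norm_of_real using pos by simp
  have "cmod (cnj a * u) \<le> 1 * r" unfolding norm_mult using assms by (intro mult_mono) auto
  then have "1 - r \<le> cmod (1 + cnj a * u)"
    using norm_triangle_ineq2[of 1 "- (cnj a * u)"] by simp
  then have "cmod u * (1 - (cmod a)\<^sup>2) / cmod (1 + cnj a * u) \<le> 1 * (1 - (cmod a)\<^sup>2) / (1 - r)"
    using u1 pos assms by (intro frac_le mult_right_mono) auto
  then show ?thesis unfolding eq by simp
qed

lemma mob_minus_mob: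
  assumes "cmod a < 1" "cmod z < 1"
  shows "mob (- a) (mob a z) = z"
proof -
  have nz: "1 + cnj a * z \<noteq> 0" using mob_denom_nonzero assms by auto
  have nz': "1 - a * cnj a \<noteq> 0"
  proof
    assume "1 - a * cnj a = 0"
    then have "complex_of_real ((cmod a)\<^sup>2) = 1" unfolding complex_norm_square by simp
    then have "(cmod a)\<^sup>2 = 1" using of_real_eq_1_iff by blast
    with norm_sq_less_one[OF assms(1)] show False by simp
  qed
  have "mob (- a) (mob a z) = ((z + a) / (1 + cnj a * z) - a) / (1 - cnj a * ((z + a) / (1 + cnj a * z)))"
    by (simp add: mob_def)
  also have "(z + a) / (1 + cnj a * z) - a = z * (1 - a * cnj a) / (1 + cnj a * z)"
    using nz by (simp add: field_simps)
  also have "1 - cnj a * ((z + a) / (1 + cnj a * z)) = (1 - a * cnj a) / (1 + cnj a * z)"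
    using nz by (simp add: field_simps)
  finally show ?thesis using nz nz' by simp
qed

lemma mob_mob_minus:
  assumes "cmod a < 1" "cmod z < 1"
  shows "mob a (mob (- a) z) = z"
  using mob_minus_mob[of "- a" z] assms by simp

lemma mob_0 [simp]: "mob a 0 = a" and mob_minus_self [simp]: "mob (- a) a = 0"
  by (simp_all add: mob_def)

lemma holomorphic_mob: "cmod a \<le> 1 \<Longrightarrow> mob a holomorphic_on unit_disc"
  unfolding mob_def by (intro holomorphic_intros) (auto simp: mob_denom_nonzero)

lemma deriv_mob:
  assumes "cmod a \<le> 1" "cmod z < 1"
  shows "deriv (mob a) z = of_real (1 - (cmod a)\<^sup>2) / (1 + cnj a * z)\<^sup>2"
proof -
  have nz: "1 + cnj a * z \<noteq> 0" using mob_denom_nonzero assms by auto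
  have "(mob a has_field_derivative (1 - a * cnj a) / (1 + cnj a * z)\<^sup>2) (at z)"
    unfolding mob_def using nz
    by (auto intro!: derivative_eq_intros simp: power2_eq_square algebra_simps)
  then show ?thesis using complex_norm_square[of a] by (simp add: DERIV_imp_deriv)
qed

lemma nonzero_divide_divide_cancel:
  fixes c :: "'a::field"
  assumes "c \<noteq> 0" shows "a / c / (b / c) = a / b"
  using assms by simp

lemma mob_real_compose:
  assumes "\<bar>x\<bar> < 1" "\<bar>y\<bar> < 1" "cmod v < 1"
  shows "mob (of_real x) (mob (of_real y) v) = mob (of_real ((x + y) / (1 + x * y))) v"
proof -
  have xy: "1 + x * y > 0"
  proof -
    have "\<bar>x * y\<bar> < 1" unfolding abs_mult using assms mult_strict_mono'[of "\<bar>x\<bar>" 1 "\<bar>y\<bar>" 1] by auto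
    then show ?thesis by linarith
  qed
  have n1: "1 + of_real y * v \<noteq> 0" using mob_denom_nonzero[of "of_real y" v] assms by auto
  have "cmod (mob (of_real y) v) < 1" using norm_mob_less_one assms by auto
  then have "1 + cnj (of_real x) * mob (of_real y) v \<noteq> 0"
    using mob_denom_nonzero[of "of_real x" "mob (of_real y) v"] assms by simp
  then have n2: "(1 + of_real y * v) + of_real x * (v + of_real y) \<noteq> 0"
    using n1 by (auto simp: mob_def field_simps)
  have n3: "complex_of_real (1 + x * y) \<noteq> 0" using xy by (metis less_irrefl of_real_eq_0_iff)
  have "mob (of_real x) (mob (of_real y) v)
      = ((v + of_real y) / (1 + of_real y * v) + of_real x) / (1 + of_real x * ((v + of_real y) / (1 + of_real y * v)))"
    by (simp add: mob_def)
  also have "(v + of_real y) / (1 + of_real y * v) + of_real x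
      = (v + of_real y + of_real x * (1 + of_real y * v)) / (1 + of_real y * v)"
    using n1 by (simp add: field_simps)
  also have "1 + of_real x * ((v + of_real y) / (1 + of_real y * v))
      = ((1 + of_real y * v) + of_real x * (v + of_real y)) / (1 + of_real y * v)"
    using n1 by (simp add: field_simps)
  also have "v + of_real y + of_real x * (1 + of_real y * v) = v * of_real (1 + x * y) + of_real (x + y)"
    by (simp add: algebra_simps)
  also have "(1 + of_real y * v) + of_real x * (v + of_real y) = of_real (1 + x * y) + of_real (x + y) * v"
    by (simp add: algebra_simps)
  also have "(v * of_real (1 + x * y) + of_real (x + y)) / (1 + of_real y * v) /
      ((of_real (1 + x * y) + of_real (x + y) * v) / (1 + of_real y * v))
      = (v * of_real (1 + x * y) + of_real (x + y)) / (of_real (1 + x * y) + of_real (x + y) * v)"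
    using n1 by (rule nonzero_divide_divide_cancel)
  also have "\<dots> = mob (of_real ((x + y) / (1 + x * y))) v"
  proof -
    have "v + of_real ((x + y) / (1 + x * y)) = (v * of_real (1 + x * y) + of_real (x + y)) / of_real (1 + x * y)"
      using n3 by (simp add: field_simps)
    moreover have "1 + cnj (of_real ((x + y) / (1 + x * y))) * v
        = (of_real (1 + x * y) + of_real (x + y) * v) / of_real (1 + x * y)"
      using n3 by (simp add: field_simps)
    ultimately show ?thesis unfolding mob_def by (simp only: nonzero_divide_divide_cancel[OF n3])
  qed
  finally show ?thesis .
qed

text \<open>The addition theorem of tanh makes these automorphisms a one-parameter group; negative
  parameters will run the flow backwards inside the petal.\<close>

lemma mob_tanh_compose:
  assumes "cmod v < 1"
  shows "mob (of_real (tanh x)) (mob (of_real (tanh y)) v) = mob (of_real (tanh (x + y))) v"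
proof -
  have "\<bar>tanh x\<bar> < 1" "\<bar>tanh y\<bar> < 1" for x y :: real by (auto simp: abs_less_iff tanh_real_lt_1 tanh_real_gt_neg1 minus_less_iff)
  then show ?thesis using mob_real_compose assms tanh_add[of x y] by (simp add: cosh_real_nonzero)
qed

text \<open>The hyperbolic cosine of the distance to 0 in the metric of curvature -1, where this
  distance is 2 artanh |z|.\<close>

definition cosh_dist :: "complex \<Rightarrow> real" where
  "cosh_dist z = (1 + (cmod z)\<^sup>2) / (1 - (cmod z)\<^sup>2)"

text \<open>The hyperbolic law of cosines: \<open>mob a z\<close> is as far from 0 as
  \<open>z\<close> is from \<open>- a\<close>, and the last term is the product of the two
  hyperbolic sines with the cosine of the angle between \<open>a\<close> and
  \<open>z\<close>.\<close>

lemma cosh_dist_mob: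
  assumes "cmod a < 1" "cmod z < 1"
  shows "cosh_dist (mob a z) =
    cosh_dist a * cosh_dist z + 4 * Re (cnj a * z) / ((1 - (cmod a)\<^sup>2) * (1 - (cmod z)\<^sup>2))"
proof -
  have nz: "(cmod (1 + cnj a * z))\<^sup>2 \<noteq> 0" using mob_denom_nonzero assms by auto
  have nn: "(cmod (mob a z))\<^sup>2 = (cmod (z + a))\<^sup>2 / (cmod (1 + cnj a * z))\<^sup>2"
    by (simp add: mob_def norm_divide power_divide)
  have e1: "1 + (cmod (mob a z))\<^sup>2 = ((1 + (cmod a)\<^sup>2) * (1 + (cmod z)\<^sup>2) + 4 * Re (cnj a * z)) / (cmod (1 + cnj a * z))\<^sup>2"
    unfolding nn mob_norm_add[symmetric] using nz by (simp add: field_simps)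
  show ?thesis unfolding cosh_dist_def[of "mob a z"] e1 one_minus_norm_mob[OF assms]
    unfolding nonzero_divide_divide_cancel[OF nz] by (simp only: cosh_dist_def times_divide_times_eq add_divide_distrib[of "_ * _"])
qed

lemma cosh_dist_ge_1: "cmod z < 1 \<Longrightarrow> cosh_dist z \<ge> 1"
  using norm_sq_less_one[of z] by (simp add: cosh_dist_def)

lemma one_minus_norm_sq_eq: "cmod z < 1 \<Longrightarrow> 1 - (cmod z)\<^sup>2 = 2 / (cosh_dist z + 1)"
  using norm_sq_less_one[of z] by (simp add: cosh_dist_def field_simps)

section \<open>Sequences: contractions, three-term recursions, subsequences\<close>

lemma contraction_tendsto_zero:
  fixes x \<eta> :: "nat \<Rightarrow> real"
  assumes "\<forall>\<^sub>F n in sequentially. x (Suc n) \<le> q * x n + \<eta> n"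
    and "\<And>n. x n \<ge> 0" "0 \<le> q" "q < 1" "\<eta> \<longlonglongrightarrow> 0"
  shows "x \<longlonglongrightarrow> 0"
proof (rule LIMSEQ_I)
  fix r :: real assume "r > 0"
  define \<epsilon> where "\<epsilon> = r / 2"
  have "\<epsilon> > 0" using \<open>r > 0\<close> by (simp add: \<epsilon>_def)
  \<comment> \<open>This \<epsilon> is the fixed point of the map x to q x + (1 - q) \<epsilon>, so
    the excess of \<open>x n\<close> over it shrinks by the factor \<open>q\<close> in every
    step.\<close>
  have "\<forall>\<^sub>F n in sequentially. \<eta> n < (1 - q) * \<epsilon>"
    using assms \<open>\<epsilon> > 0\<close> by (intro order_tendstoD) auto
  with assms(1) have "\<forall>\<^sub>F n in sequentially. x (Suc n) \<le> q * x n + (1 - q) * \<epsilon>"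
    by eventually_elim linarith
  then obtain N where N: "\<And>n. n \<ge> N \<Longrightarrow> x (Suc n) \<le> q * x n + (1 - q) * \<epsilon>"
    by (auto simp: eventually_sequentially)
  have le: "x (N + m) \<le> \<epsilon> + q ^ m * x N" for m
  proof (induction m)
    case (Suc m)
    have "x (N + Suc m) \<le> q * x (N + m) + (1 - q) * \<epsilon>" using N[of "N + m"] by simp
    also have "\<dots> \<le> q * (\<epsilon> + q ^ m * x N) + (1 - q) * \<epsilon>"
      using Suc assms by (intro add_right_mono mult_left_mono) auto
    also have "\<dots> = \<epsilon> + q ^ Suc m * x N" by (simp add: algebra_simps)
    finally show ?case .
  qed (use \<open>\<epsilon> > 0\<close> in simp)
  have "(\<lambda>m. q ^ m * x N) \<longlonglongrightarrow> 0"
    using assms by (intro tendsto_mult_left_zero LIMSEQ_realpow_zero) auto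
  then have "\<forall>\<^sub>F m in sequentially. q ^ m * x N < \<epsilon>" using \<open>\<epsilon> > 0\<close> by (intro order_tendstoD)
  then obtain M where M: "\<And>m. m \<ge> M \<Longrightarrow> q ^ m * x N < \<epsilon>" by (auto simp: eventually_sequentially)
  have "norm (x n - 0) < r" if "n \<ge> N + M" for n
  proof -
    have "x n \<le> \<epsilon> + q ^ (n - N) * x N" using le[of "n - N"] that by simp
    moreover have "q ^ (n - N) * x N < \<epsilon>" using M[of "n - N"] that by linarith
    ultimately have "x n < r" by (simp add: \<epsilon>_def)
    then show ?thesis using assms(2)[of n] by simp
  qed
  then show "\<exists>no. \<forall>n\<ge>no. norm (x n - 0) < r" by blast
qed

text \<open>The quotients \<open>R\<close> of such a sequence satisfy \<open>R (n + 1) = K n - 1 / R n\<close> with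
  \<open>K n \<rightarrow> A + 1 / A\<close>; the repelling fixed point \<open>1 / A\<close> is excluded by the lower bound on \<open>Y\<close>.\<close>

lemma ratio_tendsto_dominant_root:
  fixes Y :: "nat \<Rightarrow> real"
  assumes K: "(\<lambda>n. (Y (Suc (Suc n)) + Y n) / Y (Suc n)) \<longlonglongrightarrow> A + 1 / A"
    and A: "A > 1" and Y: "\<And>n. Y n \<ge> 1"
  shows "(\<lambda>n. Y (Suc n) / Y n) \<longlonglongrightarrow> A"
proof -
  have Ypos: "Y n > 0" for n using Y[of n] by linarith
  define \<kappa> where "\<kappa> = (A + 1 / A - 2) / 2"
  have "A + 1 / A - 2 = (A - 1)\<^sup>2 / A" using A by (simp add: field_simps power2_eq_square)
  then have "\<kappa> > 0" using A by (simp add: \<kappa>_def)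
  have "A + 1 / A > 2 + \<kappa>" using \<open>\<kappa> > 0\<close> by (simp add: \<kappa>_def field_simps)
  then have "\<forall>\<^sub>F n in sequentially. (Y (Suc (Suc n)) + Y n) / Y (Suc n) > 2 + \<kappa>"
    using K by (intro order_tendstoD)
  then obtain N where N: "\<And>n. n \<ge> N \<Longrightarrow> (Y (Suc (Suc n)) + Y n) / Y (Suc n) > 2 + \<kappa>"
    by (auto simp: eventually_sequentially)
  \<comment> \<open>A coefficient above 2 makes \<open>Y\<close> convex: since \<open>Y\<close> is
    at least 1, the second differences are at least \<kappa>. The increments grow linearly and
    become nonnegative.\<close>
  have step: "Y (Suc (Suc n)) - Y (Suc n) \<ge> Y (Suc n) - Y n + \<kappa>" if "n \<ge> N" for n
  proof -
    have "Y (Suc (Suc n)) + Y n > (2 + \<kappa>) * Y (Suc n)"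
      using N[OF that] Ypos[of "Suc n"] by (simp add: field_simps)
    moreover have "\<kappa> * Y (Suc n) \<ge> \<kappa> * 1" using Y \<open>\<kappa> > 0\<close> by (intro mult_left_mono) auto
    ultimately show ?thesis by (simp add: algebra_simps)
  qed
  have grow: "Y (Suc (N + m)) - Y (N + m) \<ge> Y (Suc N) - Y N + m * \<kappa>" for m
  proof (induction m)
    case (Suc m)
    then show ?case using step[of "N + m"] by (simp add: algebra_simps)
  qed simp
  obtain M :: nat where M: "M * \<kappa> > Y N - Y (Suc N)"
    using reals_Archimedean3[OF \<open>\<kappa> > 0\<close>] by blast
  have inc: "Y (Suc n) \<ge> Y n" if "n \<ge> N + M" for n
  proof -
    have "Y (Suc n) - Y n \<ge> Y (Suc N) - Y N + (n - N) * \<kappa>"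
      using grow[of "n - N"] that by simp
    moreover have "(n - N) * \<kappa> \<ge> M * \<kappa>" using that \<open>\<kappa> > 0\<close> by (intro mult_right_mono) auto
    ultimately show ?thesis using M by linarith
  qed
  define R where "R = (\<lambda>n. Y (Suc n) / Y n)"
  define \<eta> where "\<eta> = (\<lambda>n. \<bar>(Y (Suc (Suc n)) + Y n) / Y (Suc n) - (A + 1 / A)\<bar>)"
  have "\<eta> \<longlonglongrightarrow> 0" unfolding \<eta>_def by (intro tendsto_rabs_zero LIM_zero K)
  have "(\<lambda>n. \<bar>R n - A\<bar>) \<longlonglongrightarrow> 0"
  proof (rule contraction_tendsto_zero[where q = "1 / A" and \<eta> = \<eta>])
    show "\<forall>\<^sub>F n in sequentially. \<bar>R (Suc n) - A\<bar> \<le> 1 / A * \<bar>R n - A\<bar> + \<eta> n"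
    proof (rule eventually_sequentiallyI)
      fix n assume n: "n \<ge> N + M"
      \<comment> \<open>On R >= 1 the map R to K - 1 / R contracts towards \<open>A\<close> with
        factor 1 / A; the deviation of K from its limit is the error \<eta>.\<close>
      have R1: "R n \<ge> 1" using inc[OF n] Ypos[of n] by (simp add: R_def)
      have "R (Suc n) - A = ((Y (Suc (Suc n)) + Y n) / Y (Suc n) - (A + 1 / A)) + (1 / A - 1 / R n)"
        by (simp add: R_def add_divide_distrib)
      moreover have "1 / A - 1 / R n = (R n - A) / (A * R n)" using A R1 by (simp add: field_simps)
      moreover have "\<bar>(R n - A) / (A * R n)\<bar> \<le> 1 / A * \<bar>R n - A\<bar>"
      proof -
        have "\<bar>(R n - A) / (A * R n)\<bar> = \<bar>R n - A\<bar> / A / R n" using A R1 by (simp add: abs_mult)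
        also have "\<dots> \<le> \<bar>R n - A\<bar> / A / 1" using A R1 by (intro divide_left_mono) auto
        finally show ?thesis by simp
      qed
      ultimately show "\<bar>R (Suc n) - A\<bar> \<le> 1 / A * \<bar>R n - A\<bar> + \<eta> n"
        unfolding \<eta>_def by linarith
    qed
  qed (use A \<open>\<eta> \<longlonglongrightarrow> 0\<close> in auto)
  then have "(\<lambda>n. R n - A) \<longlonglongrightarrow> 0" by (rule tendsto_rabs_zero_cancel)
  then have "R \<longlonglongrightarrow> A" by (rule LIM_zero_cancel)
  then show ?thesis by (simp only: R_def)
qed

text \<open>Compactness arguments give limits along subsequences only; they prove convergence as
  soon as the value obtained does not depend on the subsequence.\<close>

lemma tendsto_subseqI:
  fixes f :: "nat \<Rightarrow> 'a::metric_space"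
  assumes "\<And>r. strict_mono r \<Longrightarrow> \<exists>s. strict_mono (s :: nat \<Rightarrow> nat) \<and> (\<lambda>n. f (r (s n))) \<longlonglongrightarrow> L"
  shows "f \<longlonglongrightarrow> L"
proof (rule ccontr)
  assume "\<not> f \<longlonglongrightarrow> L"
  then obtain e where "e > 0" and e: "\<forall>N. \<exists>n\<ge>N. \<not> dist (f n) L < e"
    by (auto simp: lim_sequentially)
  then have "infinite {n. \<not> dist (f n) L < e}"
    by (auto simp: infinite_nat_iff_unbounded_le)
  then obtain r :: "nat \<Rightarrow> nat" where r: "strict_mono r" "\<And>n. \<not> dist (f (r n)) L < e"
    using infinite_enumerate[of "{n. \<not> dist (f n) L < e}"] by auto
  obtain s where "(\<lambda>n. f (r (s n))) \<longlonglongrightarrow> L" using assms r(1) by blast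
  then have "\<forall>\<^sub>F n in sequentially. dist (f (r (s n))) L < e" using \<open>e > 0\<close> by (rule tendstoD)
  then show False using r(2) by auto
qed

section \<open>Locally uniform limits at moving points, and geometric convergence\<close>

lemma tendsto_uniform_limit_moving:
  assumes "uniform_limit K f l F" "continuous_on K l" "(x \<longlongrightarrow> x0) F" "\<forall>\<^sub>F n in F. x n \<in> K" "x0 \<in> K"
  shows "((\<lambda>n. f n (x n)) \<longlongrightarrow> (l x0 :: 'b::metric_space)) F"
proof (rule tendstoI)
  fix e :: real assume "e > 0"
  have "((\<lambda>n. l (x n)) \<longlongrightarrow> l x0) F"
    using assms by (intro continuous_on_tendsto_compose[OF assms(2)])
  then have "\<forall>\<^sub>F n in F. dist (l (x n)) (l x0) < e / 2"
    using \<open>e > 0\<close> by (intro tendstoD) auto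
  moreover have "\<forall>\<^sub>F n in F. \<forall>y\<in>K. dist (f n y) (l y) < e / 2"
    using uniform_limitD[OF assms(1), of "e / 2"] \<open>e > 0\<close> by simp
  ultimately show "\<forall>\<^sub>F n in F. dist (f n (x n)) (l x0) < e"
    using assms(4)
  proof eventually_elim
    case (elim n)
    then have "dist (f n (x n)) (l (x n)) < e / 2" by blast
    with elim(1) show ?case using dist_triangle[of "f n (x n)" "l x0" "l (x n)"] by linarith
  qed
qed

lemma uniform_limit_on_disc_pointwise:
  assumes "\<And>K. compact K \<Longrightarrow> K \<subseteq> unit_disc \<Longrightarrow> uniform_limit K f l F" "cmod v < 1"
  shows "((\<lambda>n. f n v) \<longlongrightarrow> l v) F"
  using assms(1)[of "{v}"] assms(2) by (intro tendsto_uniform_limitI[where S = "{v}"]) auto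

lemma uniform_limit_on_disc_moving:
  fixes x :: "nat \<Rightarrow> complex"
  assumes "\<And>K. compact K \<Longrightarrow> K \<subseteq> unit_disc \<Longrightarrow> uniform_limit K f l sequentially"
    and "continuous_on unit_disc l" "x \<longlonglongrightarrow> x0" "cmod x0 < 1"
  shows "(\<lambda>n. f n (x n)) \<longlonglongrightarrow> (l x0 :: complex)"
proof -
  define \<rho> where "\<rho> = (cmod x0 + 1) / 2"
  have \<rho>: "cmod x0 < \<rho>" "\<rho> < 1" using assms(4) by (auto simp: \<rho>_def)
  have sub: "cball 0 \<rho> \<subseteq> unit_disc" using \<rho> by auto
  have "\<forall>\<^sub>F n in sequentially. cmod (x n) < \<rho>"
    using tendsto_norm[OF assms(3)] \<rho> by (intro order_tendstoD)
  then have ev: "\<forall>\<^sub>F n in sequentially. x n \<in> cball 0 \<rho>" by eventually_elim auto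
  have "x0 \<in> cball 0 \<rho>" using \<rho> by simp
  then show ?thesis
    by (rule tendsto_uniform_limit_moving[OF assms(1)[OF compact_cball sub]
          continuous_on_subset[OF assms(2) sub] assms(3) ev])
qed

text \<open>Besides the limit, the rate D / Y n matters: with \<open>Y\<close> the cosh of the
  distance to 0, it says that the orbit approaches its limit within a Stolz region.\<close>

lemma geometric_increments_convergent:
  fixes x :: "nat \<Rightarrow> 'a::{complete_space}"
  assumes Y: "\<And>n. Y n > 0" and grow: "\<And>n. n \<ge> N \<Longrightarrow> Y (Suc n) \<ge> B * Y n" and B: "B > 1"
    and inc: "\<And>n. n \<ge> N \<Longrightarrow> dist (x n) (x (Suc n)) \<le> C / Y n" and "C \<ge> 0"
    and Ylim: "(\<lambda>n. 1 / Y n) \<longlonglongrightarrow> (0::real)"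
  obtains l D where "x \<longlonglongrightarrow> l" "\<And>n. n \<ge> N \<Longrightarrow> dist (x n) l \<le> D / Y n"
proof -
  \<comment> \<open>The sum of the geometric series with ratio 1 / B; this choice makes each
    increment at most the telescoping difference D / Y n - D / Y (n + 1).\<close>
  define D where "D = C * B / (B - 1)"
  have "D \<ge> 0" using B \<open>C \<ge> 0\<close> by (simp add: D_def)
  have step: "dist (x n) (x (Suc n)) \<le> D / Y n - D / Y (Suc n)" if "n \<ge> N" for n
  proof -
    have "D / Y (Suc n) \<le> D / (B * Y n)"
      using grow[OF that] Y[of n] B \<open>D \<ge> 0\<close> by (intro divide_left_mono mult_pos_pos Y) auto
    then have "D / Y n - D / Y (Suc n) \<ge> D / Y n - D / (B * Y n)" by linarith
    also have "D / Y n - D / (B * Y n) = C / Y n"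
    proof -
      have "D / Y n - D / (B * Y n) = D * (B - 1) / (B * Y n)" using B Y[of n] by (simp add: field_simps)
      also have "D * (B - 1) = C * B" using B by (simp add: D_def)
      finally show ?thesis using B by simp
    qed
    finally show ?thesis using inc[OF that] by linarith
  qed
  have tele: "dist (x n) (x (n + m)) \<le> D / Y n - D / Y (n + m)" if "n \<ge> N" for n m
  proof (induction m)
    case (Suc m)
    have "dist (x n) (x (n + Suc m)) \<le> dist (x n) (x (n + m)) + dist (x (n + m)) (x (Suc (n + m)))"
      by (metis add_Suc_right dist_triangle)
    then show ?case using Suc step[of "n + m"] that by simp
  qed simp
  have bd: "dist (x n) (x m) \<le> D / Y n" if "n \<ge> N" "m \<ge> n" for n m
    using tele[of n "m - n"] that divide_nonneg_pos[OF \<open>D \<ge> 0\<close> Y[of m]] by simp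
  have Dlim: "(\<lambda>n. D / Y n) \<longlonglongrightarrow> 0"
    using tendsto_mult_right_zero[OF Ylim, of D] by simp
  have "Cauchy x"
  proof (rule metric_CauchyI)
    fix e :: real assume "e > 0"
    then have "\<forall>\<^sub>F n in sequentially. D / Y n < e / 2" by (intro order_tendstoD(2)[OF Dlim]) auto
    then obtain M0 where M0: "\<And>n. n \<ge> M0 \<Longrightarrow> D / Y n < e / 2" by (auto simp: eventually_sequentially)
    define M where "M = max M0 N"
    have DM: "D / Y M < e / 2" using M0[of M] by (simp add: M_def)
    have "dist (x m) (x n) < e" if "m \<ge> M" "n \<ge> M" for m n
    proof -
      have "dist (x M) (x m) < e / 2" "dist (x M) (x n) < e / 2"
        using le_less_trans[OF bd[of M m] DM] le_less_trans[OF bd[of M n] DM] that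
        by (simp_all add: M_def)
      then show ?thesis using dist_triangle3[of "x m" "x n" "x M"] by linarith
    qed
    then show "\<exists>M. \<forall>m\<ge>M. \<forall>n\<ge>M. dist (x m) (x n) < e" by blast
  qed
  then obtain l where l: "x \<longlonglongrightarrow> l" using Cauchy_convergent convergent_def by blast
  have "dist (x n) l \<le> D / Y n" if "n \<ge> N" for n
  proof (rule LIMSEQ_le_const2)
    show "(\<lambda>m. dist (x n) (x m)) \<longlonglongrightarrow> dist (x n) l" by (intro tendsto_intros l)
    show "\<exists>M. \<forall>m\<ge>M. dist (x n) (x m) \<le> D / Y n" using bd[OF that] by blast
  qed
  with l that show thesis by blast
qed

lemma tanh_real_abs_less_1: "\<bar>tanh (x::real)\<bar> < 1"
  using tanh_real_lt_1[of x] tanh_real_gt_neg1[of x] by (simp add: abs_less_iff)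

lemma tanh_exp_double: "tanh (x::real) = (exp (2 * x) - 1) / (exp (2 * x) + 1)"
proof -
  define E where "E = exp (2 * x)"
  have "E > 0" by (simp add: E_def)
  have "tanh x = (1 - 1 / E) / (1 + 1 / E)"
    unfolding tanh_real_altdef by (simp add: E_def exp_minus inverse_eq_divide)
  also have "\<dots> = (E - 1) / (E + 1)" using \<open>E > 0\<close> by (simp add: divide_simps)
  finally show ?thesis by (simp add: E_def)
qed

section \<open>Semigroups, and petals with a linearizing map\<close>

lemma semigroup_holomorphic:
  "holomorphic_semigroup \<phi> \<Longrightarrow> t \<ge> 0 \<Longrightarrow> \<phi> t holomorphic_on unit_disc"
  and semigroup_norm_less_one:
  "holomorphic_semigroup \<phi> \<Longrightarrow> t \<ge> 0 \<Longrightarrow> cmod z < 1 \<Longrightarrow> cmod (\<phi> t z) < 1"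
  and semigroup_add:
  "holomorphic_semigroup \<phi> \<Longrightarrow> t \<ge> 0 \<Longrightarrow> s \<ge> 0 \<Longrightarrow> cmod z < 1 \<Longrightarrow> \<phi> (t + s) z = \<phi> t (\<phi> s z)"
  and semigroup_0:
  "holomorphic_semigroup \<phi> \<Longrightarrow> cmod z < 1 \<Longrightarrow> \<phi> 0 z = z"
  by (auto simp: holomorphic_semigroup_def image_subset_iff)

lemma petal_subset_disc:
  assumes "holomorphic_semigroup \<phi>" "petal \<phi> \<Delta>"
  shows "\<Delta> \<subseteq> unit_disc"
proof -
  have "\<Delta> \<subseteq> interior (\<Inter>t\<in>{0..}. \<phi> t ` unit_disc)"
    using assms(2) in_components_subset by (auto simp: petal_def)
  also have "\<dots> \<subseteq> (\<Inter>t\<in>{0..}. \<phi> t ` unit_disc)" by (rule interior_subset)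
  also have "\<dots> \<subseteq> \<phi> 0 ` unit_disc" by auto
  also have "\<dots> \<subseteq> unit_disc" using semigroup_0[OF assms(1)] by auto
  finally show ?thesis .
qed

text \<open>A petal together with a conformal map from the disc (in place of a strip) which conjugates
  the semigroup to hyperbolic translations along the real diameter.\<close>

locale linearized_petal =
  fixes \<phi> :: "real \<Rightarrow> complex \<Rightarrow> complex" and \<Delta> :: "complex set" and g :: "complex \<Rightarrow> complex" and c :: real
  assumes semigroup: "holomorphic_semigroup \<phi>"
    and petal: "petal \<phi> \<Delta>"
    and hol_g: "g holomorphic_on unit_disc"
    and inj_g: "inj_on g unit_disc"
    and image_g: "g ` unit_disc = \<Delta>"
    and c_pos: "c > 0"
    and conjugate: "\<And>t v. t \<ge> 0 \<Longrightarrow> cmod v < 1 \<Longrightarrow> \<phi> t (g v) = g (mob (of_real (tanh (c * t))) v)"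
begin

definition M :: "real \<Rightarrow> complex \<Rightarrow> complex" where
  "M t = mob (of_real (tanh (c * t)))"

definition orb :: "nat \<Rightarrow> complex" where
  "orb n = g (M (- real n) 0)"

text \<open>The conformal map of the petal with both base points moved to 0: its source is shifted
  along the axis, its target by the automorphism taking \<open>orb n\<close> to 0. It fixes 0, so
  the Schwarz lemma applies to it.\<close>

definition G :: "nat \<Rightarrow> complex \<Rightarrow> complex" where
  "G n v = mob (- orb n) (g (M (- real n) v))"

text \<open>The same automorphism is used before and after \<phi>, so this is a conjugate of the
  semigroup and need not fix 0. By \<open>Phi_G\<close> it corresponds under \<open>G n\<close> to
  the hyperbolic translation.\<close>

definition Phi :: "real \<Rightarrow> nat \<Rightarrow> complex \<Rightarrow> complex" where
  "Phi t n w = mob (- orb n) (\<phi> t (mob (orb n) w))"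

lemma g_disc: "cmod v < 1 \<Longrightarrow> cmod (g v) < 1"
  using petal_subset_disc[OF semigroup petal] image_g by force

lemma semigroup_g: "t \<ge> 0 \<Longrightarrow> cmod v < 1 \<Longrightarrow> \<phi> t (g v) = g (M t v)"
  unfolding M_def by (rule conjugate)

lemma M_disc: "cmod v < 1 \<Longrightarrow> cmod (M t v) < 1"
  unfolding M_def by (rule norm_mob_less_one) (simp_all add: tanh_real_abs_less_1)

lemma M_M: "cmod v < 1 \<Longrightarrow> M s (M t v) = M (s + t) v"
  using mob_tanh_compose[of v "c * s" "c * t"] by (simp add: M_def distrib_left)

lemma M_0: "M 0 v = v"
  by (simp add: M_def mob_def)

lemma M_holomorphic: "M t holomorphic_on unit_disc"
  unfolding M_def by (rule holomorphic_mob) (simp add: tanh_real_abs_less_1 less_imp_le)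

lemma orb_disc: "cmod (orb n) < 1"
  unfolding orb_def by (intro g_disc M_disc) simp

lemma orb_disc_le: "cmod (orb n) \<le> 1"
  using orb_disc less_imp_le by blast

lemma G_disc: "cmod v < 1 \<Longrightarrow> cmod (G n v) < 1"
  unfolding G_def by (intro norm_mob_less_one g_disc M_disc) (simp_all add: orb_disc)

lemma G_0: "G n 0 = 0"
  unfolding G_def orb_def[symmetric] by simp

lemma G_holomorphic: "G n holomorphic_on unit_disc"
proof -
  have "(mob (- orb n) \<circ> (g \<circ> M (- real n))) holomorphic_on unit_disc"
    by (intro holomorphic_on_compose_gen[of _ _ _ unit_disc] M_holomorphic hol_g holomorphic_mob)
      (auto simp: M_disc g_disc orb_disc_le)
  then show ?thesis by (simp add: G_def[abs_def] o_def)
qed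

lemma G_le: "cmod v < 1 \<Longrightarrow> cmod (G n v) \<le> cmod v"
  using Schwarz_Lemma(1)[OF G_holomorphic G_0 G_disc] by blast

lemma mob_orb_G: "cmod v < 1 \<Longrightarrow> mob (orb n) (G n v) = g (M (- real n) v)"
  unfolding G_def by (intro mob_mob_minus orb_disc g_disc M_disc)

lemma Phi_disc: "t \<ge> 0 \<Longrightarrow> cmod w < 1 \<Longrightarrow> cmod (Phi t n w) < 1"
  unfolding Phi_def by (intro norm_mob_less_one semigroup_norm_less_one[OF semigroup]) (simp_all add: orb_disc)

lemma Phi_holomorphic: "t \<ge> 0 \<Longrightarrow> Phi t n holomorphic_on unit_disc"
proof -
  assume t: "t \<ge> 0"
  have "(mob (- orb n) \<circ> (\<phi> t \<circ> mob (orb n))) holomorphic_on unit_disc"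
    by (intro holomorphic_on_compose_gen[of _ _ _ unit_disc] semigroup_holomorphic[OF semigroup t] holomorphic_mob)
      (auto simp: orb_disc orb_disc_le norm_mob_less_one semigroup_norm_less_one[OF semigroup t])
  then show ?thesis by (simp add: Phi_def[abs_def] o_def)
qed

lemma Phi_G:
  assumes "t \<ge> 0" "cmod v < 1"
  shows "Phi t n (G n v) = G n (M t v)"
  using assms by (simp add: Phi_def mob_orb_G semigroup_g M_disc M_M) (simp add: G_def M_disc M_M)

text \<open>Time n undoes the n backward steps. The right-hand side does not depend on n, which is
  why the identity survives the passage to the limit.\<close>

lemma semigroup_mob_orb_G:
  assumes "cmod v < 1"
  shows "\<phi> (real n) (mob (orb n) (G n v)) = g v"
  using assms by (simp add: mob_orb_G semigroup_g M_disc M_M M_0)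

text \<open>Seen from an orbit point, its successor and its predecessor are images under
  \<open>G\<close> of two points that do not depend on n; limits of \<open>G\<close> thus control
  the shape of the orbit.\<close>

lemma mob_orb_M_minus_1: "mob (orb n) (G n (M (- 1) 0)) = orb (Suc n)"
  by (subst mob_orb_G) (simp_all add: M_disc M_M orb_def algebra_simps)

lemma mob_orb_M_1: "mob (orb (Suc n)) (G (Suc n) (M 1 0)) = orb n"
  by (subst mob_orb_G) (simp_all add: M_disc M_M orb_def algebra_simps)

end

section \<open>Renormalization along a backward orbit\<close>

lemma uniform_limit_comp_filterlim:
  "uniform_limit K f l F \<Longrightarrow> filterlim r F G \<Longrightarrow> uniform_limit K (\<lambda>j. f (r j)) l G"
  by (rule filterlim_compose)

lemma disc_self_maps_subsequence:
  fixes f :: "nat \<Rightarrow> complex \<Rightarrow> complex"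
  assumes "\<And>n. f n holomorphic_on unit_disc" "\<And>n z. cmod z < 1 \<Longrightarrow> cmod (f n z) < 1"
  obtains l r where "l holomorphic_on unit_disc" "strict_mono (r :: nat \<Rightarrow> nat)"
    "\<And>K. compact K \<Longrightarrow> K \<subseteq> unit_disc \<Longrightarrow> uniform_limit K (\<lambda>n. f (r n)) l sequentially"
proof -
  obtain l r where lr: "l holomorphic_on unit_disc" "strict_mono (r :: nat \<Rightarrow> nat)"
    "\<And>K. \<lbrakk>compact K; K \<subseteq> unit_disc\<rbrakk> \<Longrightarrow> uniform_limit K (f \<circ> r) l sequentially"
  proof (rule Montel[of unit_disc "range f" f])
    show "\<exists>B. \<forall>h\<in>range f. \<forall>z\<in>K. cmod (h z) \<le> B" if "compact K" "K \<subseteq> unit_disc" for K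
      using that less_imp_le[OF assms(2)] by (intro exI[of _ 1]) (auto simp: subset_iff)
  qed (use assms in auto)
  then show thesis using that by (simp add: o_def)
qed

context linearized_petal
begin

lemma Delta_maximal:
  assumes "open U" "connected U" "U \<inter> \<Delta> \<noteq> {}" "\<And>t. t \<ge> 0 \<Longrightarrow> U \<subseteq> \<phi> t ` unit_disc"
  shows "U \<subseteq> \<Delta>"
proof (rule components_maximal)
  show "\<Delta> \<in> components (interior (\<Inter>t\<in>{0..}. \<phi> t ` unit_disc))" using petal by (simp add: petal_def)
  show "U \<subseteq> interior (\<Inter>t\<in>{0..}. \<phi> t ` unit_disc)"
    using assms by (intro interior_maximal) auto
qed (use assms in auto)

lemma semigroup_image_antimono:
  assumes "0 \<le> s" "s \<le> t"
  shows "\<phi> t ` unit_disc \<subseteq> \<phi> s ` unit_disc"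
proof
  fix y assume "y \<in> \<phi> t ` unit_disc"
  then obtain z where z: "cmod z < 1" "y = \<phi> t z" by auto
  then have "y = \<phi> s (\<phi> (t - s) z)" using semigroup_add[OF semigroup, of s "t - s" z] assms by simp
  moreover have "cmod (\<phi> (t - s) z) < 1" using semigroup_norm_less_one[OF semigroup] z assms by simp
  ultimately show "y \<in> \<phi> s ` unit_disc" by auto
qed

text \<open>Limits of the renormalized maps \<open>\<phi> n \<circ> mob (orb n)\<close> map the disc into the petal by
  Hurwitz's theorem; since they invert the limits of \<open>G n\<close>, the Schwarz lemma applies in both directions.\<close>

lemma G_subsequence:
  assumes n: "filterlim n at_top sequentially"
  obtains r e where "strict_mono (r :: nat \<Rightarrow> nat)" "cmod e = 1"
    "\<And>K. compact K \<Longrightarrow> K \<subseteq> unit_disc \<Longrightarrow> uniform_limit K (\<lambda>j. G (n (r j))) (\<lambda>v. e * v) sequentially"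
proof -
  obtain H r1 where H: "H holomorphic_on unit_disc" "strict_mono (r1 :: nat \<Rightarrow> nat)"
    "\<And>K. compact K \<Longrightarrow> K \<subseteq> unit_disc \<Longrightarrow> uniform_limit K (\<lambda>j. G (n (r1 j))) H sequentially"
    using disc_self_maps_subsequence[of "\<lambda>j. G (n j)"] G_holomorphic G_disc by metis
  define Q where "Q = (\<lambda>j z. \<phi> (real (n (r1 j))) (mob (orb (n (r1 j))) z))"
  have Qhol: "Q j holomorphic_on unit_disc" for j
  proof -
    have "(\<phi> (real (n (r1 j))) \<circ> mob (orb (n (r1 j)))) holomorphic_on unit_disc"
      by (intro holomorphic_on_compose_gen[of _ _ _ unit_disc] semigroup_holomorphic[OF semigroup] holomorphic_mob)
        (auto simp: orb_disc orb_disc_le norm_mob_less_one)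
    then show ?thesis by (simp add: Q_def o_def)
  qed
  have Qdisc: "cmod (Q j z) < 1" if "cmod z < 1" for j z
    unfolding Q_def using that by (intro semigroup_norm_less_one[OF semigroup] norm_mob_less_one orb_disc) auto
  obtain q r2 where q: "q holomorphic_on unit_disc" "strict_mono (r2 :: nat \<Rightarrow> nat)"
    "\<And>K. compact K \<Longrightarrow> K \<subseteq> unit_disc \<Longrightarrow> uniform_limit K (\<lambda>j. Q (r2 j)) q sequentially"
    using disc_self_maps_subsequence[of Q] Qhol Qdisc by metis
  define r where "r = r1 \<circ> r2"
  have r: "strict_mono r" unfolding r_def using H(2) q(2) by (rule strict_mono_o)
  have r2: "filterlim r2 sequentially sequentially" using q(2) by (rule filterlim_subseq)
  have ulG: "uniform_limit K (\<lambda>j. G (n (r j))) H sequentially" if "compact K" "K \<subseteq> unit_disc" for K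
    using uniform_limit_comp_filterlim[OF H(3)[OF that] r2] by (simp add: r_def)
  have nr: "filterlim (\<lambda>j. n (r j)) at_top sequentially"
    by (rule filterlim_compose[OF n filterlim_subseq[OF r]])
  have Hle: "cmod (H v) \<le> cmod v" if "cmod v < 1" for v
  proof (rule LIMSEQ_le_const2)
    show "(\<lambda>j. cmod (G (n (r j)) v)) \<longlonglongrightarrow> cmod (H v)"
      by (intro tendsto_norm uniform_limit_on_disc_pointwise[OF ulG that])
    show "\<exists>N. \<forall>j\<ge>N. cmod (G (n (r j)) v) \<le> cmod v" using G_le that by blast
  qed
  have Hdisc: "cmod (H v) < 1" if "cmod v < 1" for v using Hle[OF that] that by simp
  have H0: "H 0 = 0" using Hle[of 0] by simp
  \<comment> \<open>The limit of \<open>semigroup_mob_orb_G\<close>: \<open>q\<close> inverts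
    \<open>H\<close> up to the fixed injective map \<open>g\<close>. In particular neither map is
    constant.\<close>
  have qH: "q (H v) = g v" if "cmod v < 1" for v
  proof -
    have "(\<lambda>j. Q (r2 j) (G (n (r j)) v)) \<longlonglongrightarrow> q (H v)"
      using Hdisc that
      by (intro uniform_limit_on_disc_moving[OF q(3) holomorphic_on_imp_continuous_on[OF q(1)]
            uniform_limit_on_disc_pointwise[OF ulG]]) auto
    moreover have "Q (r2 j) (G (n (r j)) v) = g v" for j
      using semigroup_mob_orb_G[OF that] by (simp add: Q_def r_def)
    ultimately have "(\<lambda>j. g v) \<longlonglongrightarrow> q (H v)" by simp
    then show ?thesis using LIMSEQ_unique tendsto_const by blast
  qed
  have nonconst: "\<not> q constant_on unit_disc"
  proof
    assume "q constant_on unit_disc"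
    then obtain y where y: "\<And>z. cmod z < 1 \<Longrightarrow> q z = y" by (auto simp: constant_on_def)
    have "g 0 = g (1 / 2)" using qH[of 0] qH[of "1/2"] y[OF Hdisc[of 0]] y[OF Hdisc[of "1/2"]] by simp
    then have "(0::complex) = 1 / 2" by (rule inj_onD[OF inj_g]) simp_all
    then show False by simp
  qed
  \<comment> \<open>The images of \<phi> decrease in time, so from some index on the approximating
    maps take all their values in the image of time \<open>s\<close>. By Hurwitz the nonconstant
    limit cannot take a value omitted by all of them.\<close>
  have q_image: "q ` unit_disc \<subseteq> \<phi> s ` unit_disc" if s: "s \<ge> 0" for s
  proof (rule ccontr)
    assume "\<not> q ` unit_disc \<subseteq> \<phi> s ` unit_disc"
    then obtain z0 where z0: "cmod z0 < 1" "q z0 \<notin> \<phi> s ` unit_disc"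
      unfolding image_subset_iff by (metis mem_ball_0)
    have "\<forall>\<^sub>F j in sequentially. n (r j) \<ge> nat \<lceil>s\<rceil>"
      using nr unfolding filterlim_at_top by blast
    then obtain J where J: "\<And>j. j \<ge> J \<Longrightarrow> n (r j) \<ge> nat \<lceil>s\<rceil>" by (auto simp: eventually_sequentially)
    define F where "F = (\<lambda>j z. Q (r2 (j + J)) z - q z0)"
    have "(\<lambda>z. q z - q z0) z0 \<noteq> 0"
    proof (rule Hurwitz_no_zeros[where S = unit_disc and \<F> = F and g = "\<lambda>z. q z - q z0"])
      show "F j holomorphic_on unit_disc" for j unfolding F_def by (intro holomorphic_intros Qhol)
      show "(\<lambda>z. q z - q z0) holomorphic_on unit_disc" by (intro holomorphic_intros q)
      show "uniform_limit K F (\<lambda>z. q z - q z0) sequentially" if "compact K" "K \<subseteq> unit_disc" for K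
        unfolding F_def
        by (intro uniform_limit_intros uniform_limit_comp_filterlim[OF q(3)[OF that]]
            filterlim_add_const_nat_at_top)
      show "\<not> (\<lambda>z. q z - q z0) constant_on unit_disc"
        using nonconst by (auto simp: constant_on_def diff_eq_eq)
      show "F j z \<noteq> 0" if "z \<in> unit_disc" for j z
      proof -
        have "s \<le> real (n (r (j + J)))" using J[of "j + J"] by linarith
        moreover have "Q (r2 (j + J)) z \<in> \<phi> (real (n (r (j + J)))) ` unit_disc"
          unfolding Q_def r_def using that by (auto simp: orb_disc norm_mob_less_one)
        ultimately have "Q (r2 (j + J)) z \<in> \<phi> s ` unit_disc"
          using semigroup_image_antimono[OF s] by blast
        then show ?thesis using z0(2) by (auto simp: F_def)
      qed
    qed (use z0 in auto)
    then show False by simp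
  qed
  have "q ` unit_disc \<subseteq> \<Delta>"
  proof (rule Delta_maximal)
    show "open (q ` unit_disc)" by (rule open_mapping_thm[OF q(1)]) (use nonconst in auto)
    show "connected (q ` unit_disc)"
      by (intro connected_continuous_image holomorphic_on_imp_continuous_on q) simp
    have "q 0 = g 0" using qH[of 0] H0 by simp
    then show "q ` unit_disc \<inter> \<Delta> \<noteq> {}" using image_g by (auto intro!: image_eqI[of _ _ 0])
  qed (use q_image in auto)
  obtain gi where gi: "gi holomorphic_on \<Delta>" "\<And>z. z \<in> unit_disc \<Longrightarrow> gi (g z) = z"
    using holomorphic_has_inverse[OF hol_g open_ball inj_g] image_g by metis
  have gi_disc: "cmod (gi y) < 1" if "y \<in> \<Delta>" for y using that gi(2) unfolding image_g[symmetric] by auto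
  \<comment> \<open>This is possible only because \<open>q\<close> maps into the petal. Then |v| =
    |p (H v)| <= |H v| <= |v|, and equality in the Schwarz lemma makes \<open>H\<close> a
    rotation.\<close>
  define p where "p = gi \<circ> q"
  have phol: "p holomorphic_on unit_disc" unfolding p_def
    by (rule holomorphic_on_compose_gen[OF q(1) gi(1) \<open>q ` unit_disc \<subseteq> \<Delta>\<close>])
  have pdisc: "cmod (p z) < 1" if "cmod z < 1" for z
    using gi_disc[of "q z"] \<open>q ` unit_disc \<subseteq> \<Delta>\<close> that by (auto simp: p_def image_subset_iff)
  have pH: "p (H v) = v" if "cmod v < 1" for v using qH[OF that] gi(2) that by (simp add: p_def)
  have p0: "p 0 = 0" using pH[of 0] H0 by simp
  have ple: "cmod (p z) \<le> cmod z" if "cmod z < 1" for z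
    using Schwarz_Lemma(1)[OF phol p0 pdisc that] .
  have Heq: "cmod (H v) = cmod v" if "cmod v < 1" for v
    using ple[OF Hdisc[OF that]] pH[OF that] Hle[OF that] by simp
  have "\<exists>z. cmod z < 1 \<and> z \<noteq> 0 \<and> cmod (H z) = cmod z"
    by (rule exI[of _ "1 / 2"]) (simp add: Heq)
  then obtain e where e: "\<And>z. cmod z < 1 \<Longrightarrow> H z = e * z" "cmod e = 1"
    using Schwarz_Lemma(3)[OF H(1) H0 Hdisc, of 0] by auto
  have "uniform_limit K (\<lambda>j. G (n (r j))) (\<lambda>v. e * v) sequentially" if "compact K" "K \<subseteq> unit_disc" for K
  proof -
    have "uniform_limit K (\<lambda>j. G (n (r j))) H sequentially \<longleftrightarrow> uniform_limit K (\<lambda>j. G (n (r j))) (\<lambda>v. e * v) sequentially"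
      by (rule uniform_limit_cong') (use e that in auto)
    with ulG[OF that] show ?thesis by simp
  qed
  with r e(2) show thesis by (rule that)
qed

end

text \<open>With A = |a|^2 this divides the law of cosines by \<open>cosh_dist a\<close>. The factor
  1 - A, which tends to 0 along the orbit, cancels; only the harmless 1 + A remains.\<close>

lemma quotient_expansion:
  fixes A S T :: real
  assumes "1 - A \<noteq> 0" "1 + A \<noteq> 0"
  shows "((1 + A) / (1 - A) * S + T / (1 - A)) / ((1 + A) / (1 - A)) = S + T / (1 + A)"
proof -
  have "(1 + A) / (1 - A) * S + T / (1 - A) = ((1 + A) * S + T) / (1 - A)"
    by (simp only: add_divide_distrib[of "_ * _"] times_divide_eq_left)
  then have "((1 + A) / (1 - A) * S + T / (1 - A)) / ((1 + A) / (1 - A)) = ((1 + A) * S + T) / (1 + A)"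
    by (simp only: nonzero_divide_divide_cancel[OF assms(1)])
  also have "\<dots> = S + T / (1 + A)" using assms(2) by (simp only: add_divide_distrib[of "_ * _"]) simp
  finally show ?thesis .
qed

section \<open>Convergence of the backward orbit\<close>

context linearized_petal
begin

abbreviation th :: real where "th \<equiv> tanh c"

lemma th: "0 < th" "th < 1"
  using c_pos tanh_real_lt_1 by auto

lemma M_1_0: "M 1 0 = of_real th" and M_minus_1_0: "M (- 1) 0 = - of_real th"
  by (simp_all add: M_def)

text \<open>These are cosh (2 c) and sinh (2 c), the functions of the step length 2 c of the orbit
  on the axis.\<close>

lemma tanh_identities:
  "(1 + th\<^sup>2) / (1 - th\<^sup>2) = (exp (2 * c) + 1 / exp (2 * c)) / 2"
  "2 * th / (1 - th\<^sup>2) = (exp (2 * c) - 1 / exp (2 * c)) / 2"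
proof -
  define E where "E = exp (2 * c)"
  have E: "E > 0" "E + 1 > 0" by (simp_all add: E_def add_pos_pos)
  have t: "th = (E - 1) / (E + 1)" by (simp add: tanh_exp_double E_def)
  have nz: "(E + 1)\<^sup>2 \<noteq> 0" using E by simp
  have "1 - th\<^sup>2 = ((E + 1)\<^sup>2 - (E - 1)\<^sup>2) / (E + 1)\<^sup>2"
    unfolding t power_divide by (simp only: diff_divide_distrib[of "(E + 1)\<^sup>2"] divide_self[OF nz])
  then have a: "1 - th\<^sup>2 = 4 * E / (E + 1)\<^sup>2" by (simp add: power2_eq_square algebra_simps)
  have "1 + th\<^sup>2 = ((E + 1)\<^sup>2 + (E - 1)\<^sup>2) / (E + 1)\<^sup>2"
    unfolding t power_divide add_divide_distrib using nz by simp
  then have b: "1 + th\<^sup>2 = 2 * (E\<^sup>2 + 1) / (E + 1)\<^sup>2" by (simp add: power2_eq_square algebra_simps)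
  show "(1 + th\<^sup>2) / (1 - th\<^sup>2) = (exp (2 * c) + 1 / exp (2 * c)) / 2"
    unfolding a b E_def[symmetric] nonzero_divide_divide_cancel[OF nz]
    using E by (simp add: field_simps power2_eq_square)
  have "2 * th = 2 * (E - 1) * (E + 1) / (E + 1)\<^sup>2"
    unfolding t using E by (simp add: power2_eq_square)
  then show "2 * th / (1 - th\<^sup>2) = (exp (2 * c) - 1 / exp (2 * c)) / 2"
    unfolding a E_def[symmetric] by (simp only: nonzero_divide_divide_cancel[OF nz])
      (use E in \<open>simp add: field_simps power2_eq_square\<close>)
qed

lemma cosh_dist_orb_ge_1: "cosh_dist (orb n) \<ge> 1"
  by (rule cosh_dist_ge_1[OF orb_disc])

text \<open>The law of cosines is applied to both neighbours of one orbit point. Along a subsequence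
  \<open>G\<close> tends to a rotation \<open>e\<close>, which puts the neighbours at the opposite
  points e th and - e th. The angular terms cancel for every \<open>e\<close>, and the limit is 2
  cosh (2 c).\<close>

lemma cosh_dist_recursion:
  "(\<lambda>n. (cosh_dist (orb (Suc (Suc n))) + cosh_dist (orb n)) / cosh_dist (orb (Suc n)))
     \<longlonglongrightarrow> exp (2 * c) + 1 / exp (2 * c)" (is "?f \<longlonglongrightarrow> ?K")
proof (rule tendsto_subseqI)
  fix r :: "nat \<Rightarrow> nat" assume r: "strict_mono r"
  have "filterlim (\<lambda>n. Suc (r n)) at_top sequentially"
    by (rule filterlim_compose[OF filterlim_Suc filterlim_subseq[OF r]])
  then obtain s e where s: "strict_mono s" and e: "cmod e = 1"
    and lim: "\<And>K. compact K \<Longrightarrow> K \<subseteq> unit_disc \<Longrightarrow>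
      uniform_limit K (\<lambda>j. G (Suc (r (s j)))) (\<lambda>v. e * v) sequentially"
    using G_subsequence by blast
  define u where "u = (\<lambda>j. G (Suc (r (s j))) (of_real th))"
  define w where "w = (\<lambda>j. G (Suc (r (s j))) (- of_real th))"
  have ulim: "u \<longlonglongrightarrow> e * of_real th" and wlim: "w \<longlonglongrightarrow> - (e * of_real th)"
    using uniform_limit_on_disc_pointwise[OF lim, of "of_real th"]
      uniform_limit_on_disc_pointwise[OF lim, of "- of_real th"] th by (simp_all add: u_def w_def)
  define a where "a = (\<lambda>j. orb (Suc (r (s j))))"
  have a: "cmod (a j) < 1" and u: "cmod (u j) < 1" and w: "cmod (w j) < 1" for j
    using th by (simp_all add: a_def u_def w_def orb_disc G_disc)
  \<comment> \<open>The sum of the two vectors whose inner product with the direction of the orbit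
    point gives the angular terms. It tends to 0, so no knowledge of that direction is
    needed.\<close>
  define X where "X = (\<lambda>j. u j / of_real (1 - (cmod (u j))\<^sup>2) + w j / of_real (1 - (cmod (w j))\<^sup>2))"
  have eq: "?f (r (s j)) = cosh_dist (u j) + cosh_dist (w j) + 4 * Re (cnj (a j) * X j) / (1 + (cmod (a j))\<^sup>2)" for j
  proof -
    have 1: "orb (r (s j)) = mob (a j) (u j)" "orb (Suc (Suc (r (s j)))) = mob (a j) (w j)"
      using mob_orb_M_1[of "r (s j)"] mob_orb_M_minus_1[of "Suc (r (s j))"]
      by (simp_all add: a_def u_def w_def M_1_0 M_minus_1_0)
    have pos: "1 - (cmod (a j))\<^sup>2 > 0" "1 - (cmod (u j))\<^sup>2 > 0" "1 - (cmod (w j))\<^sup>2 > 0" "1 + (cmod (a j))\<^sup>2 > 0"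
      using norm_sq_less_one a u w by (auto simp: add_pos_nonneg)
    have sum: "cosh_dist (mob (a j) (w j)) + cosh_dist (mob (a j) (u j)) =
        cosh_dist (a j) * (cosh_dist (u j) + cosh_dist (w j)) + 4 * Re (cnj (a j) * X j) / (1 - (cmod (a j))\<^sup>2)"
    proof -
      have "Re (cnj (a j) * X j) = Re (cnj (a j) * u j) / (1 - (cmod (u j))\<^sup>2) + Re (cnj (a j) * w j) / (1 - (cmod (w j))\<^sup>2)"
        by (simp add: X_def distrib_left Re_divide_of_real add_divide_distrib[symmetric] del: of_real_diff of_real_power of_real_1)
      then show ?thesis
        unfolding cosh_dist_mob[OF a u] cosh_dist_mob[OF a w]
        by (simp add: algebra_simps add_divide_distrib)
    qed
    have ca: "cosh_dist (a j) = (1 + (cmod (a j))\<^sup>2) / (1 - (cmod (a j))\<^sup>2)" by (simp add: cosh_dist_def)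
    have 2: "orb (Suc (r (s j))) = a j" by (simp add: a_def)
    show ?thesis unfolding 1 2 sum ca using pos by (intro quotient_expansion) auto
  qed
  have n2: "(cmod (e * of_real th))\<^sup>2 = th\<^sup>2" "(cmod (- (e * of_real th)))\<^sup>2 = th\<^sup>2"
    using e by (simp_all add: norm_mult)
  have th2: "1 - th\<^sup>2 > 0" using th by (simp add: abs_square_less_1)
  have cu: "(\<lambda>j. cosh_dist (u j)) \<longlonglongrightarrow> (1 + th\<^sup>2) / (1 - th\<^sup>2)"
    unfolding cosh_dist_def n2(1)[symmetric] using th2 n2 by (intro tendsto_intros ulim) auto
  have cw: "(\<lambda>j. cosh_dist (w j)) \<longlonglongrightarrow> (1 + th\<^sup>2) / (1 - th\<^sup>2)"
    unfolding cosh_dist_def n2(2)[symmetric] using th2 n2 by (intro tendsto_intros wlim) auto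
  have "X \<longlonglongrightarrow> e * of_real th / of_real (1 - (cmod (e * of_real th))\<^sup>2)
      + - (e * of_real th) / of_real (1 - (cmod (- (e * of_real th)))\<^sup>2)"
    unfolding X_def using th2 n2
    by (intro tendsto_intros ulim wlim) (auto simp del: of_real_diff of_real_power of_real_1 simp: of_real_eq_0_iff)
  then have Xlim: "X \<longlonglongrightarrow> 0" by (simp add: minus_divide_left[symmetric])
  have "(\<lambda>j. 4 * Re (cnj (a j) * X j) / (1 + (cmod (a j))\<^sup>2)) \<longlonglongrightarrow> 0"
  proof (rule Lim_null_comparison)
    show "\<forall>\<^sub>F j in sequentially. norm (4 * Re (cnj (a j) * X j) / (1 + (cmod (a j))\<^sup>2)) \<le> 4 * cmod (X j)"
    proof (rule always_eventually, rule allI)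
      fix j
      have "\<bar>Re (cnj (a j) * X j)\<bar> \<le> cmod (a j) * cmod (X j)"
        using abs_Re_le_cmod[of "cnj (a j) * X j"] by (simp add: norm_mult)
      also have "\<dots> \<le> 1 * cmod (X j)" using a[of j] by (intro mult_right_mono) auto
      finally have 1: "\<bar>4 * Re (cnj (a j) * X j)\<bar> \<le> 4 * cmod (X j)" by simp
      have "\<bar>4 * Re (cnj (a j) * X j) / (1 + (cmod (a j))\<^sup>2)\<bar> = \<bar>4 * Re (cnj (a j) * X j)\<bar> / (1 + (cmod (a j))\<^sup>2)"
        by (simp add: abs_divide)
      also have "\<dots> \<le> \<bar>4 * Re (cnj (a j) * X j)\<bar> / 1"
        by (intro divide_left_mono) (auto simp: add_pos_nonneg)
      finally show "norm (4 * Re (cnj (a j) * X j) / (1 + (cmod (a j))\<^sup>2)) \<le> 4 * cmod (X j)"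
        using 1 by simp
    qed
    show "(\<lambda>j. 4 * cmod (X j)) \<longlonglongrightarrow> 0"
      using tendsto_mult_right_zero[OF tendsto_norm_zero[OF Xlim], of 4] by simp
  qed
  then have "(\<lambda>j. ?f (r (s j))) \<longlonglongrightarrow> (1 + th\<^sup>2) / (1 - th\<^sup>2) + (1 + th\<^sup>2) / (1 - th\<^sup>2) + 0"
    unfolding eq by (intro tendsto_add cu cw)
  then have "(\<lambda>j. ?f (r (s j))) \<longlonglongrightarrow> ?K" unfolding tanh_identities by simp
  with s show "\<exists>s. strict_mono s \<and> (\<lambda>j. ?f (r (s j))) \<longlonglongrightarrow> ?K" by blast
qed

lemma cosh_dist_ratio: "(\<lambda>n. cosh_dist (orb (Suc n)) / cosh_dist (orb n)) \<longlonglongrightarrow> exp (2 * c)"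
  using c_pos by (intro ratio_tendsto_dominant_root cosh_dist_recursion cosh_dist_orb_ge_1) simp

text \<open>The factor is the midpoint of 1 and the limiting ratio exp (2 c).\<close>

lemma orb_growth:
  obtains N where "\<And>n. n \<ge> N \<Longrightarrow> cosh_dist (orb (Suc n)) \<ge> (1 + exp (2 * c)) / 2 * cosh_dist (orb n)"
proof -
  have "(1 + exp (2 * c)) / 2 < exp (2 * c)" using c_pos by simp
  then have "\<forall>\<^sub>F n in sequentially. cosh_dist (orb (Suc n)) / cosh_dist (orb n) > (1 + exp (2 * c)) / 2"
    by (intro order_tendstoD(1)[OF cosh_dist_ratio])
  then obtain N where N: "\<And>n. n \<ge> N \<Longrightarrow> cosh_dist (orb (Suc n)) / cosh_dist (orb n) > (1 + exp (2 * c)) / 2"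
    by (auto simp: eventually_sequentially)
  have "cosh_dist (orb (Suc n)) \<ge> (1 + exp (2 * c)) / 2 * cosh_dist (orb n)" if "n \<ge> N" for n
  proof -
    have "cosh_dist (orb n) > 0" using cosh_dist_orb_ge_1[of n] by linarith
    with N[OF that] show ?thesis by (simp only: pos_less_divide_eq less_imp_le)
  qed
  then show thesis by (rule that)
qed

lemma inverse_cosh_dist_orb: "(\<lambda>n. 1 / cosh_dist (orb n)) \<longlonglongrightarrow> 0"
proof -
  define B where "B = (1 + exp (2 * c)) / 2"
  have B: "B > 1" using c_pos by (simp add: B_def)
  obtain N where N: "\<And>n. n \<ge> N \<Longrightarrow> cosh_dist (orb (Suc n)) \<ge> B * cosh_dist (orb n)"
    using orb_growth unfolding B_def by blast
  have pos: "cosh_dist (orb n) > 0" for n using cosh_dist_orb_ge_1[of n] by linarith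
  show ?thesis
  proof (rule contraction_tendsto_zero[where q = "1 / B" and \<eta> = "\<lambda>_. 0"])
    show "\<forall>\<^sub>F n in sequentially. 1 / cosh_dist (orb (Suc n)) \<le> 1 / B * (1 / cosh_dist (orb n)) + 0"
    proof (rule eventually_sequentiallyI)
      fix n assume "n \<ge> N"
      have "1 / cosh_dist (orb (Suc n)) \<le> 1 / (B * cosh_dist (orb n))"
        using N[OF \<open>n \<ge> N\<close>] pos[of n] pos[of "Suc n"] B by (intro divide_left_mono mult_pos_pos) auto
      then show "1 / cosh_dist (orb (Suc n)) \<le> 1 / B * (1 / cosh_dist (orb n)) + 0" by simp
    qed
  qed (use pos B in \<open>auto simp: less_imp_le\<close>)
qed

text \<open>By the Schwarz lemma the next point, seen from \<open>orb n\<close>, has modulus at most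
  \<open>th\<close>; \<open>mob_dist_le\<close> turns this into a Euclidean bound.\<close>

lemma orb_step: "dist (orb n) (orb (Suc n)) \<le> 2 / (1 - th) / cosh_dist (orb n)"
proof -
  define a where "a = orb n"
  have a: "cmod a < 1" by (simp add: a_def orb_disc)
  have w: "cmod (G n (- of_real th)) \<le> th" using G_le[of "- of_real th" n] th by simp
  have "orb (Suc n) = mob a (G n (- of_real th))"
    using mob_orb_M_minus_1[of n] by (simp add: a_def M_minus_1_0)
  then have "dist (orb n) (orb (Suc n)) \<le> (1 - (cmod a)\<^sup>2) / (1 - th)"
    using mob_dist_le[OF a w] th by (simp add: a_def dist_norm norm_minus_commute)
  also have "1 - (cmod a)\<^sup>2 \<le> 2 / cosh_dist a"
    unfolding one_minus_norm_sq_eq[OF a] using cosh_dist_ge_1[OF a] by (intro divide_left_mono) auto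
  finally show ?thesis using th by (simp add: a_def divide_right_mono mult.commute)
qed

definition rep_pt :: complex where "rep_pt = lim orb"

lemma orb_tendsto: "orb \<longlonglongrightarrow> rep_pt"
  and orb_dist: "\<exists>N D. \<forall>n\<ge>N. dist (orb n) rep_pt \<le> D / cosh_dist (orb n)"
proof -
  obtain N where N: "\<And>n. n \<ge> N \<Longrightarrow> cosh_dist (orb (Suc n)) \<ge> (1 + exp (2 * c)) / 2 * cosh_dist (orb n)"
    using orb_growth by blast
  have pos: "cosh_dist (orb n) > 0" for n using cosh_dist_orb_ge_1[of n] by linarith
  have B: "(1 + exp (2 * c)) / 2 > 1" using c_pos by simp
  have C: "2 / (1 - th) \<ge> 0" using th by simp
  obtain l D where l: "orb \<longlonglongrightarrow> l" and D: "\<And>n. n \<ge> N \<Longrightarrow> dist (orb n) l \<le> D / cosh_dist (orb n)"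
    using geometric_increments_convergent[OF pos N B orb_step C inverse_cosh_dist_orb] by blast
  then have "l = rep_pt" by (simp add: rep_pt_def limI)
  with l D show "orb \<longlonglongrightarrow> rep_pt" "\<exists>N D. \<forall>n\<ge>N. dist (orb n) rep_pt \<le> D / cosh_dist (orb n)" by auto
qed

lemma norm_rep_pt: "cmod rep_pt = 1"
proof -
  have "(\<lambda>n. 1 / cosh_dist (orb n) * 2 / (1 + 1 / cosh_dist (orb n))) \<longlonglongrightarrow> 0 * 2 / (1 + 0)"
    by (intro tendsto_intros inverse_cosh_dist_orb) simp
  moreover have "1 / cosh_dist (orb n) * 2 / (1 + 1 / cosh_dist (orb n)) = 1 - (cmod (orb n))\<^sup>2" for n
  proof -
    have "cosh_dist (orb n) \<ge> 1" by (rule cosh_dist_orb_ge_1)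
    then show ?thesis unfolding one_minus_norm_sq_eq[OF orb_disc] by (simp add: field_simps)
  qed
  ultimately have "(\<lambda>n. 1 - (cmod (orb n))\<^sup>2) \<longlonglongrightarrow> 0" by simp
  moreover have "(\<lambda>n. 1 - (cmod (orb n))\<^sup>2) \<longlonglongrightarrow> 1 - (cmod rep_pt)\<^sup>2"
    by (intro tendsto_intros orb_tendsto)
  ultimately have "1 - (cmod rep_pt)\<^sup>2 = 0" using LIMSEQ_unique by blast
  then show ?thesis by (simp add: abs_square_eq_1)
qed

text \<open>One application of the law of cosines shows that the ratio of consecutive terms tends to
  cosh (2 c) - x sinh (2 c) with x = Re (cnj rep_pt e). The ratio is already known to tend to exp (2
  c), so x = -1, and as both numbers are unimodular this determines \<open>e\<close>, for every
  subsequence.\<close>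

lemma G_subsequence_rep_pt:
  assumes n: "filterlim n at_top sequentially"
  obtains r where "strict_mono (r :: nat \<Rightarrow> nat)"
    "\<And>K. compact K \<Longrightarrow> K \<subseteq> unit_disc \<Longrightarrow> uniform_limit K (\<lambda>j. G (n (r j))) (\<lambda>v. - rep_pt * v) sequentially"
proof -
  obtain r e where r: "strict_mono r" and e: "cmod e = 1"
    and lim: "\<And>K. compact K \<Longrightarrow> K \<subseteq> unit_disc \<Longrightarrow> uniform_limit K (\<lambda>j. G (n (r j))) (\<lambda>v. e * v) sequentially"
    using G_subsequence[OF n] by blast
  have nr: "filterlim (\<lambda>j. n (r j)) at_top sequentially"
    by (rule filterlim_compose[OF n filterlim_subseq[OF r]])
  define w where "w = (\<lambda>j. G (n (r j)) (- of_real th))"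
  have wlim: "w \<longlonglongrightarrow> - (e * of_real th)"
    using uniform_limit_on_disc_pointwise[OF lim, of "- of_real th"] th by (simp add: w_def)
  define a where "a = (\<lambda>j. orb (n (r j)))"
  have alim: "a \<longlonglongrightarrow> rep_pt" unfolding a_def by (rule filterlim_compose[OF orb_tendsto nr])
  have a: "cmod (a j) < 1" and w: "cmod (w j) < 1" for j
    using th by (simp_all add: a_def w_def orb_disc G_disc)
  have eq: "cosh_dist (orb (Suc (n (r j)))) / cosh_dist (orb (n (r j)))
     = cosh_dist (w j) + 4 * Re (cnj (a j) * w j) / ((1 + (cmod (a j))\<^sup>2) * (1 - (cmod (w j))\<^sup>2))" for j
  proof -
    have 1: "orb (Suc (n (r j))) = mob (a j) (w j)"
      using mob_orb_M_minus_1[of "n (r j)"] by (simp add: a_def w_def M_minus_1_0)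
    have pos: "1 - (cmod (a j))\<^sup>2 > 0" "1 - (cmod (w j))\<^sup>2 > 0" "1 + (cmod (a j))\<^sup>2 > 0"
      using norm_sq_less_one a w by (auto simp: add_pos_nonneg)
    have ca: "cosh_dist (a j) = (1 + (cmod (a j))\<^sup>2) / (1 - (cmod (a j))\<^sup>2)" by (simp add: cosh_dist_def)
    have 2: "orb (n (r j)) = a j" by (simp add: a_def)
    have 3: "cosh_dist (mob (a j) (w j)) = (1 + (cmod (a j))\<^sup>2) / (1 - (cmod (a j))\<^sup>2) * cosh_dist (w j) +
        4 * Re (cnj (a j) * w j) / (1 - (cmod (w j))\<^sup>2) / (1 - (cmod (a j))\<^sup>2)"
      unfolding cosh_dist_mob[OF a w] ca by simp
    have "(4 * Re (cnj (a j) * w j)) / ((1 + (cmod (a j))\<^sup>2) * (1 - (cmod (w j))\<^sup>2))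
        = 4 * Re (cnj (a j) * w j) / (1 - (cmod (w j))\<^sup>2) / (1 + (cmod (a j))\<^sup>2)" by simp
    moreover have "cosh_dist (orb (Suc (n (r j)))) / cosh_dist (orb (n (r j))) =
        cosh_dist (w j) + 4 * Re (cnj (a j) * w j) / (1 - (cmod (w j))\<^sup>2) / (1 + (cmod (a j))\<^sup>2)"
      unfolding 1 2 3 unfolding ca using pos by (intro quotient_expansion) auto
    ultimately show ?thesis by (simp only:)
  qed
  have n2: "(cmod (- (e * of_real th)))\<^sup>2 = th\<^sup>2"
    using e by (simp add: norm_mult)
  have th2: "1 - th\<^sup>2 > 0" using th by (simp add: abs_square_less_1)
  have cw: "(\<lambda>j. cosh_dist (w j)) \<longlonglongrightarrow> (1 + th\<^sup>2) / (1 - th\<^sup>2)"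
    unfolding cosh_dist_def n2[symmetric] using th2 n2 by (intro tendsto_intros wlim) auto
  have "(\<lambda>j. 4 * Re (cnj (a j) * w j) / ((1 + (cmod (a j))\<^sup>2) * (1 - (cmod (w j))\<^sup>2)))
     \<longlonglongrightarrow> 4 * Re (cnj rep_pt * - (e * of_real th)) / ((1 + (cmod rep_pt)\<^sup>2) * (1 - (cmod (- (e * of_real th)))\<^sup>2))"
    using th2 n2 norm_rep_pt by (intro tendsto_intros wlim alim) auto
  then have "(\<lambda>j. 4 * Re (cnj (a j) * w j) / ((1 + (cmod (a j))\<^sup>2) * (1 - (cmod (w j))\<^sup>2)))
     \<longlonglongrightarrow> - Re (cnj rep_pt * e) * (2 * th / (1 - th\<^sup>2))"
  proof -
    have "4 * Re (cnj rep_pt * - (e * of_real th)) / ((1 + (cmod rep_pt)\<^sup>2) * (1 - (cmod (- (e * of_real th)))\<^sup>2))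
        = - Re (cnj rep_pt * e) * (2 * th / (1 - th\<^sup>2))"
    proof -
      have "Re (cnj rep_pt * - (e * of_real th)) = - Re (cnj rep_pt * e) * th" by (simp add: algebra_simps)
      then have "4 * Re (cnj rep_pt * - (e * of_real th)) = 2 * (- Re (cnj rep_pt * e) * (2 * th))" by simp
      moreover have "(1 + (1::real)\<^sup>2) * (1 - th\<^sup>2) = 2 * (1 - th\<^sup>2)" by simp
      ultimately show ?thesis unfolding n2 norm_rep_pt by (simp only: mult_divide_mult_cancel_left_if) simp
    qed
    then show ?thesis using \<open>_ \<longlonglongrightarrow> 4 * Re (cnj rep_pt * - (e * of_real th)) / _\<close> by (simp only:)
  qed
  then have "(\<lambda>j. cosh_dist (orb (Suc (n (r j)))) / cosh_dist (orb (n (r j))))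
     \<longlonglongrightarrow> (1 + th\<^sup>2) / (1 - th\<^sup>2) + - Re (cnj rep_pt * e) * (2 * th / (1 - th\<^sup>2))"
    unfolding eq by (intro tendsto_add cw)
  moreover have "(\<lambda>j. cosh_dist (orb (Suc (n (r j)))) / cosh_dist (orb (n (r j)))) \<longlonglongrightarrow> exp (2 * c)"
    by (rule filterlim_compose[OF cosh_dist_ratio nr])
  ultimately have "(1 + th\<^sup>2) / (1 - th\<^sup>2) + - Re (cnj rep_pt * e) * (2 * th / (1 - th\<^sup>2)) = exp (2 * c)"
    by (rule LIMSEQ_unique)
  then have "- Re (cnj rep_pt * e) * (exp (2 * c) - 1 / exp (2 * c)) = exp (2 * c) - 1 / exp (2 * c)"
  proof -
    define D where "D = exp (2 * c) - 1 / exp (2 * c)"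
    define x where "x = Re (cnj rep_pt * e)"
    have "(2 * exp (2 * c) - D) / 2 + - x * (D / 2) = exp (2 * c)"
      using \<open>_ = exp (2 * c)\<close> unfolding tanh_identities D_def x_def by simp
    then have "- x * D = D" by (simp add: field_simps)
    then show ?thesis by (simp only: D_def x_def)
  qed
  moreover have "exp (2 * c) - 1 / exp (2 * c) \<noteq> 0"
  proof -
    have "exp (2 * c) > 1" using c_pos by simp
    moreover from this have "1 / exp (2 * c) < 1" by (simp only: divide_less_eq_1_pos)
    ultimately show ?thesis by linarith
  qed
  ultimately have Re: "Re (cnj rep_pt * e) = - 1" by auto
  have "cmod (cnj rep_pt * e) = 1" by (simp add: norm_mult norm_rep_pt e)
  then have "Im (cnj rep_pt * e) = 0" using Re by (simp add: cmod_def)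
  with Re have "cnj rep_pt * e = - 1" by (simp add: complex_eq_iff)
  then have "rep_pt * (cnj rep_pt * e) = - rep_pt" by (simp only: mult_minus_right mult_1_right)
  then have "rep_pt * cnj rep_pt * e = - rep_pt" by (simp only: mult.assoc)
  then have "e = - rep_pt" unfolding complex_norm_square[symmetric] norm_rep_pt by simp
  with r lim show thesis using that by simp
qed

end

section \<open>Angular limits at the limit of the backward orbit\<close>

lemma deriv_uniform_limit_moving:
  fixes f :: "nat \<Rightarrow> complex \<Rightarrow> complex"
  assumes hol: "\<And>n. f n holomorphic_on unit_disc" and l: "l holomorphic_on unit_disc"
    and ul: "\<And>K. compact K \<Longrightarrow> K \<subseteq> unit_disc \<Longrightarrow> uniform_limit K f l sequentially"
    and x: "x \<longlonglongrightarrow> x0" "cmod x0 < 1"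
  shows "(\<lambda>n. deriv (f n) (x n)) \<longlonglongrightarrow> deriv l x0"
proof -
  \<comment> \<open>One third leaves room for both motions: \<open>x n\<close> stays within
    \<epsilon> of the disc of radius |x0|, and the Cauchy circle around \<open>x n\<close> has
    radius \<epsilon>.\<close>
  define \<epsilon> where "\<epsilon> = (1 - cmod x0) / 3"
  have \<epsilon>: "\<epsilon> > 0" "cmod x0 + \<epsilon> + \<epsilon> < 1" using x(2) by (auto simp: \<epsilon>_def field_simps)
  define K where "K = cball (0::complex) (cmod x0 + \<epsilon> + \<epsilon>)"
  have K: "compact K" "K \<subseteq> unit_disc" using \<epsilon> by (auto simp: K_def)
  have xK: "\<forall>\<^sub>F n in sequentially. cmod (x n) < cmod x0 + \<epsilon>"
    using tendsto_norm[OF x(1)] \<epsilon> by (intro order_tendstoD(2)) auto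
  have "(\<lambda>n. deriv (f n) (x n) - deriv l (x n)) \<longlonglongrightarrow> 0"
  proof (rule tendstoI)
    fix e :: real assume "e > 0"
    then have "\<forall>\<^sub>F n in sequentially. \<forall>z\<in>K. dist (f n z) (l z) < e / 2 * \<epsilon>"
      using uniform_limitD[OF ul[OF K], of "e / 2 * \<epsilon>"] \<epsilon> by simp
    with xK show "\<forall>\<^sub>F n in sequentially. dist (deriv (f n) (x n) - deriv l (x n)) 0 < e"
    proof eventually_elim
      case (elim n)
      have cb: "cball (x n) \<epsilon> \<subseteq> K"
      proof
        fix z assume "z \<in> cball (x n) \<epsilon>"
        then have "cmod (z - x n) \<le> \<epsilon>" by (simp add: dist_norm norm_minus_commute)
        then show "z \<in> K" using elim(1) norm_triangle_sub[of z "x n"] by (simp add: K_def)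
      qed
      have sub: "cball (x n) \<epsilon> \<subseteq> unit_disc" using cb K by blast
      have xd: "x n \<in> unit_disc" using sub \<epsilon> by (meson centre_in_cball less_imp_le subsetD)
      have hd: "(\<lambda>z. f n z - l z) holomorphic_on unit_disc" by (intro holomorphic_intros hol l)
      have "cmod ((deriv ^^ 1) (\<lambda>z. f n z - l z) (x n)) \<le> fact 1 * (e / 2 * \<epsilon>) / \<epsilon> ^ 1"
      proof (rule Cauchy_inequality)
        show "(\<lambda>z. f n z - l z) holomorphic_on ball (x n) \<epsilon>"
          using holomorphic_on_subset[OF hd] sub ball_subset_cball by (meson order_trans)
        show "continuous_on (cball (x n) \<epsilon>) (\<lambda>z. f n z - l z)"
          using holomorphic_on_imp_continuous_on[OF hd] sub by (rule continuous_on_subset)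
        show "cmod (f n z - l z) \<le> e / 2 * \<epsilon>" if "cmod (x n - z) = \<epsilon>" for z
        proof -
          have "z \<in> K" using cb that by (auto simp: dist_norm)
          then show ?thesis using elim(2) by (simp add: dist_norm less_imp_le)
        qed
      qed (use \<epsilon> in auto)
      moreover have "deriv (\<lambda>z. f n z - l z) (x n) = deriv (f n) (x n) - deriv l (x n)"
        by (rule deriv_diff) (use hol l xd holomorphic_on_imp_differentiable_at[OF _ open_ball] in blast)+
      ultimately have "cmod (deriv (f n) (x n) - deriv l (x n)) \<le> e / 2" using \<epsilon> by simp
      then show ?case using \<open>e > 0\<close> by (simp add: dist_norm)
    qed
  qed
  moreover have "(\<lambda>n. deriv l (x n)) \<longlonglongrightarrow> deriv l x0"
  proof (rule continuous_on_tendsto_compose[OF holomorphic_on_imp_continuous_on[OF holomorphic_deriv[OF l open_ball]] x(1)])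
    show "x0 \<in> unit_disc" using x by simp
    show "\<forall>\<^sub>F n in sequentially. x n \<in> unit_disc"
      using xK by eventually_elim (use \<epsilon> in simp)
  qed
  ultimately show ?thesis using tendsto_add by fastforce
qed

lemma has_angular_limitI:
  assumes "\<And>K z. K > 1 \<Longrightarrow> (\<And>j. z j \<in> stolz_region \<sigma> K) \<Longrightarrow> z \<longlonglongrightarrow> \<sigma> \<Longrightarrow>
    \<exists>s. strict_mono (s :: nat \<Rightarrow> nat) \<and> (\<lambda>j. f (z (s j))) \<longlonglongrightarrow> L"
  shows "has_angular_limit f \<sigma> L"
  unfolding has_angular_limit_def tendsto_at_iff_sequentially
proof (intro allI impI)
  fix K :: real and X :: "nat \<Rightarrow> complex"
  assume K: "K > 1" and X: "\<forall>i. X i \<in> stolz_region \<sigma> K - {\<sigma>}" "X \<longlonglongrightarrow> \<sigma>"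
  show "(f \<circ> X) \<longlonglongrightarrow> L"
  proof (rule tendsto_subseqI)
    fix r :: "nat \<Rightarrow> nat" assume r: "strict_mono r"
    show "\<exists>s. strict_mono s \<and> (\<lambda>n. (f \<circ> X) (r (s n))) \<longlonglongrightarrow> L"
      using assms[of K "\<lambda>j. X (r j)"] K X(1) LIMSEQ_subseq_LIMSEQ[OF X(2) r] by (simp add: o_def)
  qed
qed

context linearized_petal
begin

text \<open>The orbit point is chosen at the same height over the circle as \<open>z j\<close>, up
  to a constant. Both are then within a multiple of that height of the limit point, one by the rate
  of convergence and the other by the Stolz condition, and this bounds their hyperbolic
  distance.\<close>

lemma stolz_orbit_bound:
  assumes z: "\<And>j. z j \<in> stolz_region rep_pt K" "z \<longlonglongrightarrow> rep_pt"
  obtains n r where "filterlim n at_top sequentially" "r < 1"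
    "\<forall>\<^sub>F j in sequentially. cmod (mob (- orb (n j)) (z j)) \<le> r"
proof -
  obtain N0 D where D0: "\<And>n. n \<ge> N0 \<Longrightarrow> dist (orb n) rep_pt \<le> D / cosh_dist (orb n)"
    using orb_dist by blast
  have pos: "cosh_dist (orb n) > 0" for n using cosh_dist_orb_ge_1[of n] by linarith
  define B where "B = exp (2 * c) + 1"
  have "B > 0" by (simp add: B_def add_pos_pos)
  have "\<forall>\<^sub>F n in sequentially. cosh_dist (orb (Suc n)) / cosh_dist (orb n) < B"
    by (intro order_tendstoD(2)[OF cosh_dist_ratio]) (simp add: B_def)
  then obtain N1 where N1: "\<And>n. n \<ge> N1 \<Longrightarrow> cosh_dist (orb (Suc n)) / cosh_dist (orb n) < B"
    by (auto simp: eventually_sequentially)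
  define N where "N = max N0 N1"
  have D: "dist (orb n) rep_pt \<le> D / cosh_dist (orb n)" if "n \<ge> N" for n using D0 that by (simp add: N_def)
  have ratio: "cosh_dist (orb (Suc n)) < B * cosh_dist (orb n)" if "n \<ge> N" for n
    using N1[of n] that pos[of n] by (simp add: N_def pos_divide_less_eq)
  have zd: "cmod (z j) < 1" and zK: "cmod (rep_pt - z j) < K * (1 - cmod (z j))" for j
    using z(1)[of j] by (auto simp: stolz_region_def)
  define R where "R = (\<lambda>j. 1 / (1 - cmod (z j)))"
  have Rlim: "filterlim R at_top sequentially"
    unfolding R_def inverse_eq_divide[symmetric]
  proof (rule filterlim_inverse_at_top)
    show "(\<lambda>j. 1 - cmod (z j)) \<longlonglongrightarrow> 0"
      using tendsto_diff[OF tendsto_const tendsto_norm[OF z(2)], of 1] norm_rep_pt by simp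
    show "\<forall>\<^sub>F j in sequentially. 0 < 1 - cmod (z j)" using zd by simp
  qed
  have ex: "\<exists>m\<ge>N. cosh_dist (orb (Suc m)) > x" for x
  proof -
    have "\<forall>\<^sub>F m in sequentially. 1 / cosh_dist (orb m) < 1 / (\<bar>x\<bar> + 1)"
      by (intro order_tendstoD(2)[OF inverse_cosh_dist_orb]) auto
    then obtain m0 where m0: "\<And>m. m \<ge> m0 \<Longrightarrow> 1 / cosh_dist (orb m) < 1 / (\<bar>x\<bar> + 1)"
      by (auto simp: eventually_sequentially)
    have "1 / cosh_dist (orb (Suc (max m0 N))) < 1 / (\<bar>x\<bar> + 1)" by (intro m0) auto
    then have "\<bar>x\<bar> + 1 < cosh_dist (orb (Suc (max m0 N)))"
      using pos[of "Suc (max m0 N)"] by (simp add: field_simps)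
    then show ?thesis by (intro exI[of _ "max m0 N"]) auto
  qed
  \<comment> \<open>The last index from \<open>N\<close> on before cosh of the distance exceeds 1 /
    (1 - |z j|). Since consecutive terms differ at most by the factor \<open>B\<close>, both
    quantities are comparable at this index.\<close>
  define n where "n = (\<lambda>j. LEAST m. m \<ge> N \<and> cosh_dist (orb (Suc m)) > R j)"
  have n: "n j \<ge> N" "cosh_dist (orb (Suc (n j))) > R j" for j
    using LeastI_ex[OF ex[of "R j"]] by (auto simp: n_def)
  have n_le: "cosh_dist (orb (n j)) \<le> R j" if "cosh_dist (orb N) \<le> R j" for j
  proof (cases "n j = N")
    case False
    then have "n j - 1 < (LEAST m. m \<ge> N \<and> cosh_dist (orb (Suc m)) > R j)"
      and gt: "n j - 1 \<ge> N" "Suc (n j - 1) = n j" using n(1)[of j] by (auto simp: n_def)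
    then show ?thesis using not_less_Least by fastforce
  qed (use that in simp)
  have nlim: "filterlim n at_top sequentially"
    unfolding filterlim_at_top
  proof (rule allI)
    fix m0 :: nat
    have "\<forall>\<^sub>F j in sequentially. \<forall>m\<in>{..m0}. cosh_dist (orb (Suc m)) \<le> R j"
      using Rlim by (intro eventually_ball_finite) (auto simp: filterlim_at_top)
    then show "\<forall>\<^sub>F j in sequentially. m0 \<le> n j"
    proof eventually_elim
      case (elim j)
      then show ?case using n(2)[of j] by (metis atMost_iff leI less_imp_le not_less)
    qed
  qed
  \<comment> \<open>With d = 1 - |z j|, the denominator of \<open>mob (- orb (n j)) (z j)\<close> is
    at most L d: 2 comes from 1 - |a|^2, D and K from the distances to the limit point, B from
    comparing the heights. As 1 - |a|^2 and 1 - |z j|^2 are at least d, this leaves 1 / L^2.\<close>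
  define L where "L = (2 + D) * B + K"
  define r where "r = sqrt (1 - 1 / L\<^sup>2)"
  have "D \<ge> 0"
  proof -
    have "0 \<le> D / cosh_dist (orb N)" using D[of N] zero_le_dist[of "orb N" rep_pt] by linarith
    then show ?thesis using pos[of N] by (simp add: zero_le_divide_iff)
  qed
  have "K > 0" using zK[of 0] zd[of 0] by (smt (verit) norm_ge_zero zero_less_mult_pos2)
  have "L > 0" using \<open>D \<ge> 0\<close> \<open>K > 0\<close> \<open>B > 0\<close> by (simp add: L_def add_nonneg_pos)
  have "r < 1" using \<open>L > 0\<close> by (simp add: r_def)
  have "\<forall>\<^sub>F j in sequentially. cosh_dist (orb N) \<le> R j" using Rlim by (auto simp: filterlim_at_top)
  then have "\<forall>\<^sub>F j in sequentially. cmod (mob (- orb (n j)) (z j)) \<le> r"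
  proof eventually_elim
    case (elim j)
    define a where "a = orb (n j)"
    define Y where "Y = cosh_dist a"
    define d where "d = 1 - cmod (z j)"
    have a: "cmod a < 1" by (simp add: a_def orb_disc)
    have Y: "Y \<ge> 1" using cosh_dist_ge_1[OF a] by (simp add: Y_def)
    have d: "d > 0" using zd by (simp add: d_def)
    have Yd: "d \<le> 1 / Y"
      using n_le[OF elim] d Y by (simp add: R_def d_def[symmetric] Y_def[symmetric] a_def[symmetric] field_simps)
    have "1 / d < B * Y"
      using n(2)[of j] ratio[OF n(1)[of j]] by (simp add: R_def d_def a_def Y_def)
    then have Yd': "1 / Y \<le> B * d" using d Y by (simp add: field_simps)
    have na: "1 - (cmod a)\<^sup>2 = 2 / (Y + 1)" using one_minus_norm_sq_eq[OF a] by (simp add: Y_def)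
    have na1: "1 - (cmod a)\<^sup>2 \<le> 2 / Y" unfolding na using Y by (intro divide_left_mono) auto
    have na2: "1 - (cmod a)\<^sup>2 \<ge> 1 / Y" unfolding na using Y by (simp add: field_simps)
    have az: "cmod (a - z j) \<le> D / Y + K * d"
      using D[OF n(1)[of j]] zK[of j] norm_triangle_ineq[of "a - rep_pt" "rep_pt - z j"]
      by (simp add: a_def[symmetric] Y_def[symmetric] d_def[symmetric] dist_norm)
    have "1 + cnj (- a) * z j = of_real (1 - (cmod a)\<^sup>2) + cnj a * (a - z j)"
      using complex_norm_square[of a] by (simp add: algebra_simps)
    then have "cmod (1 + cnj (- a) * z j) \<le> cmod (of_real (1 - (cmod a)\<^sup>2)) + cmod (cnj a * (a - z j))"
      by (simp only: norm_triangle_ineq)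
    also have "cmod (of_real (1 - (cmod a)\<^sup>2)) = 1 - (cmod a)\<^sup>2"
      unfolding norm_of_real using norm_sq_less_one[OF a] by simp
    also have "cmod (cnj a * (a - z j)) \<le> 1 * cmod (a - z j)"
      unfolding norm_mult using a by (intro mult_right_mono) auto
    also have "1 - (cmod a)\<^sup>2 + 1 * cmod (a - z j) \<le> (2 + D) * (1 / Y) + K * d"
      using na1 az by (simp add: algebra_simps add_divide_distrib)
    also have "\<dots> \<le> (2 + D) * (B * d) + K * d"
      using \<open>D \<ge> 0\<close> Yd' by (intro add_right_mono mult_left_mono) auto
    also have "\<dots> = L * d" by (simp add: L_def algebra_simps)
    finally have den: "cmod (1 + cnj (- a) * z j) \<le> L * d" by simp
    have nz: "cmod (1 + cnj (- a) * z j) > 0" using mob_denom_nonzero[of "- a" "z j"] a zd by auto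
    have "1 - (cmod (mob (- a) (z j)))\<^sup>2 = (1 - (cmod a)\<^sup>2) * (1 - (cmod (z j))\<^sup>2) / (cmod (1 + cnj (- a) * z j))\<^sup>2"
      using one_minus_norm_mob[of "- a" "z j"] a zd by simp
    also have "\<dots> \<ge> (d * d) / (L * d)\<^sup>2"
    proof (rule frac_le)
      have "1 - (cmod (z j))\<^sup>2 = d * (1 + cmod (z j))" by (simp add: d_def algebra_simps power2_eq_square)
      also have "\<dots> \<ge> d * 1" using d by (intro mult_left_mono) auto
      finally have "1 - (cmod (z j))\<^sup>2 \<ge> d" by simp
      then show "d * d \<le> (1 - (cmod a)\<^sup>2) * (1 - (cmod (z j))\<^sup>2)"
        using na2 Yd d by (intro mult_mono) auto
      show "(cmod (1 + cnj (- a) * z j))\<^sup>2 \<le> (L * d)\<^sup>2" using den by (intro power_mono) auto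
      show "0 \<le> (1 - (cmod a)\<^sup>2) * (1 - (cmod (z j))\<^sup>2)"
        using norm_sq_less_one[OF a] norm_sq_less_one[OF zd[of j]] by (intro mult_nonneg_nonneg) auto
    qed (use nz in auto)
    also have "(d * d) / (L * d)\<^sup>2 = 1 / L\<^sup>2" using d by (simp add: power2_eq_square)
    finally have "(cmod (mob (- a) (z j)))\<^sup>2 \<le> 1 - 1 / L\<^sup>2" by simp
    then have "cmod (mob (- a) (z j)) \<le> r" unfolding r_def by (rule real_le_rsqrt)
    then show ?case by (simp add: a_def)
  qed
  with nlim \<open>r < 1\<close> show thesis by (rule that)
qed

text \<open>Montel provides a limit, and the relation \<open>Phi_G\<close> determines it:
  \<open>G\<close> tends to the rotation by - rep_pt, which is onto the disc, so the limit is the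
  rotated hyperbolic translation.\<close>

lemma Phi_subsequence:
  assumes n: "filterlim n at_top sequentially" and t: "t \<ge> 0"
  obtains r where "strict_mono (r :: nat \<Rightarrow> nat)"
    "\<And>K. compact K \<Longrightarrow> K \<subseteq> unit_disc \<Longrightarrow>
      uniform_limit K (\<lambda>j. Phi t (n (r j))) (\<lambda>w. - rep_pt * M t (- cnj rep_pt * w)) sequentially"
proof -
  obtain r1 where r1: "strict_mono r1"
    and G1: "\<And>K. compact K \<Longrightarrow> K \<subseteq> unit_disc \<Longrightarrow> uniform_limit K (\<lambda>j. G (n (r1 j))) (\<lambda>v. - rep_pt * v) sequentially"
    using G_subsequence_rep_pt[OF n] by blast
  obtain l r2 where l: "l holomorphic_on unit_disc" and r2: "strict_mono (r2 :: nat \<Rightarrow> nat)"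
    and ul: "\<And>K. compact K \<Longrightarrow> K \<subseteq> unit_disc \<Longrightarrow> uniform_limit K (\<lambda>j. Phi t (n (r1 (r2 j)))) l sequentially"
    using disc_self_maps_subsequence[of "\<lambda>j. Phi t (n (r1 j))"] Phi_holomorphic[OF t] Phi_disc[OF t] by metis
  define r where "r = r1 \<circ> r2"
  have r: "strict_mono r" unfolding r_def using r1 r2 by (rule strict_mono_o)
  have G2: "uniform_limit K (\<lambda>j. G (n (r1 (r2 j)))) (\<lambda>v. - rep_pt * v) sequentially" if "compact K" "K \<subseteq> unit_disc" for K
    by (rule uniform_limit_comp_filterlim[OF G1[OF that] filterlim_subseq[OF r2]])
  have eq: "l w = - rep_pt * M t (- cnj rep_pt * w)" if w: "cmod w < 1" for w
  proof -
    define v where "v = - cnj rep_pt * w"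
    have v: "cmod v < 1" using w by (simp add: v_def norm_mult norm_rep_pt)
    have sv: "- rep_pt * v = w"
    proof -
      have "- rep_pt * v = (rep_pt * cnj rep_pt) * w" by (simp add: v_def)
      then show ?thesis unfolding complex_norm_square[symmetric] norm_rep_pt by simp
    qed
    have "(\<lambda>j. Phi t (n (r1 (r2 j))) (G (n (r1 (r2 j))) v)) \<longlonglongrightarrow> l (- rep_pt * v)"
      by (rule uniform_limit_on_disc_moving[OF ul holomorphic_on_imp_continuous_on[OF l]
            uniform_limit_on_disc_pointwise[OF G2 v]]) (use sv w in auto)
    moreover have "Phi t (n (r1 (r2 j))) (G (n (r1 (r2 j))) v) = G (n (r1 (r2 j))) (M t v)" for j
      by (rule Phi_G[OF t v])
    moreover have "(\<lambda>j. G (n (r1 (r2 j))) (M t v)) \<longlonglongrightarrow> - rep_pt * M t v"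
      by (rule uniform_limit_on_disc_pointwise[OF G2 M_disc[OF v]])
    ultimately have "l (- rep_pt * v) = - rep_pt * M t v" using LIMSEQ_unique by simp
    then show ?thesis unfolding sv by (simp add: v_def)
  qed
  have "uniform_limit K (\<lambda>j. Phi t (n (r j))) (\<lambda>w. - rep_pt * M t (- cnj rep_pt * w)) sequentially"
    if "compact K" "K \<subseteq> unit_disc" for K
  proof -
    have "uniform_limit K (\<lambda>j. Phi t (n (r j))) l sequentially \<longleftrightarrow>
      uniform_limit K (\<lambda>j. Phi t (n (r j))) (\<lambda>w. - rep_pt * M t (- cnj rep_pt * w)) sequentially"
      by (rule uniform_limit_cong') (use eq that in auto)
    with ul[OF that] show ?thesis by (simp add: r_def)
  qed
  with r show thesis by (rule that)
qed

text \<open>\<phi> is recovered from \<open>Phi\<close> by conjugation with automorphisms whose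
  parameter tends to \<open>rep_pt\<close>. They push every compact set to that point, which gives
  the first limit; their derivatives tend to 0 but only enter through a quotient, which gives the
  second.\<close>

lemma angular_limits_subsequence:
  assumes z: "\<And>j. z j \<in> stolz_region rep_pt K" "z \<longlonglongrightarrow> rep_pt" and t: "t \<ge> 0"
  obtains s where "strict_mono (s :: nat \<Rightarrow> nat)" "(\<lambda>j. \<phi> t (z (s j))) \<longlonglongrightarrow> rep_pt"
    "(\<lambda>j. deriv (\<phi> t) (z (s j))) \<longlonglongrightarrow> of_real (exp (2 * c * t))"
proof -
  define \<Psi> where "\<Psi> = (\<lambda>w. - rep_pt * M t (- cnj rep_pt * w))"
  have sgsg: "rep_pt * cnj rep_pt = 1" unfolding complex_norm_square[symmetric] norm_rep_pt by simp
  have zd: "cmod (z j) < 1" for j using z(1)[of j] by (auto simp: stolz_region_def)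
  obtain n r where n: "filterlim n at_top sequentially" and r: "r < 1"
    and bd: "\<forall>\<^sub>F j in sequentially. cmod (mob (- orb (n j)) (z j)) \<le> r"
    using stolz_orbit_bound[OF z] by blast
  define w where "w = (\<lambda>j. mob (- orb (n j)) (z j))"
  have wd: "cmod (w j) < 1" for j using zd by (simp add: w_def norm_mob_less_one orb_disc)
  obtain r1 where r1: "strict_mono r1"
    and P1: "\<And>K. compact K \<Longrightarrow> K \<subseteq> unit_disc \<Longrightarrow> uniform_limit K (\<lambda>j. Phi t (n (r1 j))) \<Psi> sequentially"
    using Phi_subsequence[OF n t] unfolding \<Psi>_def by blast
  have "bounded (range (\<lambda>j. w (r1 j)))"
    unfolding bounded_iff using wd less_imp_le by (intro exI[of _ 1]) auto
  then obtain w0 r2 where r2: "strict_mono (r2 :: nat \<Rightarrow> nat)" and w0: "(\<lambda>j. w (r1 (r2 j))) \<longlonglongrightarrow> w0"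
    using bounded_imp_convergent_subsequence[of "\<lambda>j. w (r1 j)"] by (auto simp: o_def)
  define s where "s = r1 \<circ> r2"
  have s: "strict_mono s" unfolding s_def using r1 r2 by (rule strict_mono_o)
  have fs: "filterlim s sequentially sequentially" by (rule filterlim_subseq[OF s])
  have wlim: "(\<lambda>j. w (s j)) \<longlonglongrightarrow> w0" using w0 by (simp add: s_def)
  have "\<forall>\<^sub>F j in sequentially. cmod (w (s j)) \<le> r"
    using eventually_compose_filterlim[OF bd fs] by (simp add: w_def)
  then have "cmod w0 \<le> r" using tendsto_upperbound[OF tendsto_norm[OF wlim]] by simp
  then have w0d: "cmod w0 < 1" using r by simp
  have ul: "uniform_limit K (\<lambda>j. Phi t (n (s j))) \<Psi> sequentially" if "compact K" "K \<subseteq> unit_disc" for K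
    using uniform_limit_comp_filterlim[OF P1[OF that] filterlim_subseq[OF r2]] by (simp add: s_def)
  define v where "v = - cnj rep_pt * w0"
  have v: "cmod v < 1" using w0d by (simp add: v_def norm_mult norm_rep_pt)
  have Psihol: "\<Psi> holomorphic_on unit_disc"
  proof -
    have "(M t \<circ> (\<lambda>w. - cnj rep_pt * w)) holomorphic_on unit_disc"
      by (rule holomorphic_on_compose_gen[OF _ M_holomorphic]) (auto intro!: holomorphic_intros simp: norm_mult norm_rep_pt)
    then show ?thesis unfolding \<Psi>_def o_def by (intro holomorphic_intros)
  qed
  define x where "x = (\<lambda>j. Phi t (n (s j)) (w (s j)))"
  define x0 where "x0 = \<Psi> w0"
  have x0d: "cmod x0 < 1" using M_disc[OF v] by (simp add: x0_def \<Psi>_def v_def norm_mult norm_rep_pt)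
  have xd: "cmod (x j) < 1" for j unfolding x_def by (rule Phi_disc[OF t wd])
  have xlim: "x \<longlonglongrightarrow> x0" unfolding x_def x0_def
    by (rule uniform_limit_on_disc_moving[OF ul holomorphic_on_imp_continuous_on[OF Psihol] wlim w0d])
  define a where "a = (\<lambda>j. orb (n (s j)))"
  have ad: "cmod (a j) < 1" for j by (simp add: a_def orb_disc)
  have alim: "a \<longlonglongrightarrow> rep_pt" unfolding a_def
    by (rule filterlim_compose[OF orb_tendsto filterlim_compose[OF n fs]])
  have zw: "mob (a j) (w (s j)) = z (s j)" for j
    unfolding a_def w_def by (rule mob_mob_minus[OF orb_disc zd])
  have mobx: "mob (a j) (x j) = \<phi> t (z (s j))" for j
  proof -
    have "x j = mob (- a j) (\<phi> t (z (s j)))" using zw[of j] by (simp add: x_def Phi_def a_def)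
    then show ?thesis using mob_mob_minus[OF ad semigroup_norm_less_one[OF semigroup t zd]] by simp
  qed
  have nzx: "1 + cnj rep_pt * x0 \<noteq> 0" using mob_denom_nonzero[of rep_pt x0] x0d norm_rep_pt by simp
  have nzw: "1 + cnj rep_pt * w0 \<noteq> 0" using mob_denom_nonzero[of rep_pt w0] w0d norm_rep_pt by simp
  have lim1: "(\<lambda>j. \<phi> t (z (s j))) \<longlonglongrightarrow> rep_pt"
  proof -
    have "(\<lambda>j. mob (a j) (x j)) \<longlonglongrightarrow> (x0 + rep_pt) / (1 + cnj rep_pt * x0)"
      unfolding mob_def using nzx by (intro tendsto_intros xlim alim)
    moreover have "x0 + rep_pt = rep_pt * (1 + cnj rep_pt * x0)"
      using sgsg by (simp add: distrib_left mult.assoc[symmetric])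
    ultimately show ?thesis unfolding mobx using nzx by simp
  qed
  \<comment> \<open>The chain rule in \<phi> o mob a = mob a o Phi. The vanishing factor 1 - |a|^2
    of \<open>deriv_mob\<close> occurs on both sides and cancels.\<close>
  have der: "deriv (\<phi> t) (z (s j)) =
      ((1 + cnj (a j) * w (s j)) / (1 + cnj (a j) * x j))\<^sup>2 * deriv (Phi t (n (s j))) (w (s j))" for j
  proof -
    have dd: "f field_differentiable at y" if "f holomorphic_on unit_disc" "cmod y < 1" for f y
      using holomorphic_on_imp_differentiable_at[OF that(1) open_ball] that(2) by simp
    have fphi: "\<phi> t field_differentiable at (mob (a j) (w (s j)))"
      using dd[OF semigroup_holomorphic[OF semigroup t] zd] by (simp add: zw)
    have fmob: "mob (a j) field_differentiable at y" if "cmod y < 1" for y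
      using dd[OF holomorphic_mob that] ad less_imp_le by blast
    have fPhi: "Phi t (n (s j)) field_differentiable at (w (s j))"
      by (rule dd[OF Phi_holomorphic[OF t] wd])
    have "deriv (\<phi> t \<circ> mob (a j)) (w (s j)) = deriv (mob (a j) \<circ> Phi t (n (s j))) (w (s j))"
    proof (rule complex_derivative_transform_within_open)
      show "(\<phi> t \<circ> mob (a j)) y = (mob (a j) \<circ> Phi t (n (s j))) y" if "y \<in> unit_disc" for y
      proof -
        have "cmod (\<phi> t (mob (a j) y)) < 1"
          using that ad by (intro semigroup_norm_less_one[OF semigroup t] norm_mob_less_one) auto
        then show ?thesis using mob_mob_minus[OF ad] by (simp add: Phi_def a_def)
      qed
      show "(\<phi> t \<circ> mob (a j)) holomorphic_on unit_disc"
        by (rule holomorphic_on_compose_gen[OF holomorphic_mob semigroup_holomorphic[OF semigroup t]])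
          (use ad norm_mob_less_one ad[THEN less_imp_le] in auto)
      show "(mob (a j) \<circ> Phi t (n (s j))) holomorphic_on unit_disc"
        by (rule holomorphic_on_compose_gen[OF Phi_holomorphic[OF t] holomorphic_mob])
          (use ad Phi_disc[OF t] ad[THEN less_imp_le] in auto)
    qed (use wd in auto)
    then have "deriv (\<phi> t) (z (s j)) * deriv (mob (a j)) (w (s j)) = deriv (mob (a j)) (x j) * deriv (Phi t (n (s j))) (w (s j))"
      using deriv_chain[OF fmob[OF wd] fphi] deriv_chain[OF fPhi] fmob[OF xd[of j]]
      by (simp add: zw x_def)
    moreover have "1 + cnj (a j) * x j \<noteq> 0" "1 + cnj (a j) * w (s j) \<noteq> 0"
      using mob_denom_nonzero ad xd wd less_imp_le by blast+
    moreover have "complex_of_real (1 - (cmod (a j))\<^sup>2) \<noteq> 0"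
      unfolding of_real_eq_0_iff using norm_sq_less_one[OF ad[of j]] by simp
    ultimately show ?thesis
      unfolding deriv_mob[OF less_imp_le[OF ad] wd] deriv_mob[OF less_imp_le[OF ad] xd]
      by (simp add: field_simps del: of_real_diff of_real_power)
  qed
  define \<tau> where "\<tau> = tanh (c * t)"
  have \<tau>: "\<bar>\<tau>\<bar> < 1" by (simp add: \<tau>_def tanh_real_abs_less_1)
  have dPsi: "deriv \<Psi> w0 = of_real (1 - \<tau>\<^sup>2) / (1 + of_real \<tau> * v)\<^sup>2"
  proof -
    have nz: "1 + of_real \<tau> * v \<noteq> 0" using mob_denom_nonzero[of "of_real \<tau>" v] v \<tau> by simp
    have "(M t has_field_derivative of_real (1 - \<tau>\<^sup>2) / (1 + of_real \<tau> * v)\<^sup>2) (at v)"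
      unfolding M_def \<tau>_def[symmetric] mob_def using nz
      by (auto intro!: derivative_eq_intros simp: power2_eq_square algebra_simps)
    then have "(\<Psi> has_field_derivative - rep_pt * (of_real (1 - \<tau>\<^sup>2) / (1 + of_real \<tau> * v)\<^sup>2 * (- cnj rep_pt))) (at w0)"
      unfolding \<Psi>_def v_def by (intro DERIV_cmult DERIV_chain'[where g = "M t"]) (auto intro!: derivative_eq_intros)
    moreover have "- rep_pt * (of_real (1 - \<tau>\<^sup>2) / (1 + of_real \<tau> * v)\<^sup>2 * (- cnj rep_pt))
        = (rep_pt * cnj rep_pt) * (of_real (1 - \<tau>\<^sup>2) / (1 + of_real \<tau> * v)\<^sup>2)" by simp
    ultimately show ?thesis unfolding sgsg by (simp add: DERIV_imp_deriv)
  qed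
  have "(\<lambda>j. deriv (\<phi> t) (z (s j))) \<longlonglongrightarrow>
      ((1 + cnj rep_pt * w0) / (1 + cnj rep_pt * x0))\<^sup>2 * deriv \<Psi> w0"
    unfolding der using nzx
    by (intro tendsto_intros alim wlim xlim deriv_uniform_limit_moving[OF Phi_holomorphic[OF t] Psihol ul wlim w0d])
  \<comment> \<open>The position w0 in the Stolz region drops out: the value is the multiplier (1 +
    \<tau>) / (1 - \<tau>) of the translation at its repelling fixed point.\<close>
  moreover have "((1 + cnj rep_pt * w0) / (1 + cnj rep_pt * x0))\<^sup>2 * deriv \<Psi> w0 = of_real (exp (2 * c * t))"
  proof -
    have nz: "1 + of_real \<tau> * v \<noteq> 0" using mob_denom_nonzero[of "of_real \<tau>" v] v \<tau> by simp
    have e1: "1 + cnj rep_pt * w0 = 1 - v" by (simp add: v_def)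
    have "cnj rep_pt * x0 = - (rep_pt * cnj rep_pt) * M t v" by (simp add: x0_def \<Psi>_def v_def)
    then have "1 + cnj rep_pt * x0 = 1 - M t v" unfolding sgsg by simp
    also have "\<dots> = (1 - v) * (1 - of_real \<tau>) / (1 + of_real \<tau> * v)"
      unfolding M_def \<tau>_def[symmetric] mob_def using nz by (simp add: field_simps)
    finally have e2: "1 + cnj rep_pt * x0 = (1 - v) * (1 - of_real \<tau>) / (1 + of_real \<tau> * v)" .
    have v1: "1 - v \<noteq> 0" using v by auto
    have t1: "1 - complex_of_real \<tau> \<noteq> 0" using \<tau> by (metis abs_1 less_irrefl of_real_1 of_real_eq_iff right_minus_eq)
    have "(1 + cnj rep_pt * w0) / (1 + cnj rep_pt * x0) = (1 + of_real \<tau> * v) / (1 - of_real \<tau>)"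
      unfolding e1 e2 using v1 t1 nz by simp
    then have "((1 + cnj rep_pt * w0) / (1 + cnj rep_pt * x0))\<^sup>2 * deriv \<Psi> w0
        = ((1 + of_real \<tau> * v) / (1 - of_real \<tau>))\<^sup>2 * (of_real (1 - \<tau>\<^sup>2) / (1 + of_real \<tau> * v)\<^sup>2)"
      unfolding dPsi by (simp only:)
    also have "\<dots> = of_real (1 - \<tau>\<^sup>2) / (1 - of_real \<tau>)\<^sup>2"
      unfolding power_divide using nz by simp
    also have "\<dots> = of_real ((1 - \<tau>\<^sup>2) / (1 - \<tau>)\<^sup>2)" by simp
    also have "(1 - \<tau>\<^sup>2) / (1 - \<tau>)\<^sup>2 = (1 + \<tau>) / (1 - \<tau>)"
    proof -
      have "1 - \<tau>\<^sup>2 = (1 + \<tau>) * (1 - \<tau>)" by (simp add: power2_eq_square algebra_simps)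
      then show ?thesis using \<tau> by (simp add: power2_eq_square)
    qed
    also have "(1 + \<tau>) / (1 - \<tau>) = exp (2 * c * t)"
    proof -
      define E where "E = exp (2 * (c * t))"
      have "E > 0" by (simp add: E_def)
      have "\<tau> = (E - 1) / (E + 1)" by (simp add: \<tau>_def tanh_exp_double E_def)
      then have "1 + \<tau> = 2 * E / (E + 1)" "1 - \<tau> = 2 / (E + 1)" using \<open>E > 0\<close> by (simp_all add: field_simps)
      then have "(1 + \<tau>) / (1 - \<tau>) = E" using \<open>E > 0\<close> by simp
      then show ?thesis by (simp add: E_def mult.assoc)
    qed
    finally show ?thesis .
  qed
  ultimately have "(\<lambda>j. deriv (\<phi> t) (z (s j))) \<longlonglongrightarrow> of_real (exp (2 * c * t))" by simp
  with s lim1 show thesis by (rule that)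
qed

lemma repelling_rep_pt:
  "repelling_spectral_value \<phi> rep_pt (- (2 * c))" "repelling_fixed_point \<phi> rep_pt" "rep_pt \<in> frontier \<Delta>"
proof -
  show rep: "repelling_spectral_value \<phi> rep_pt (- (2 * c))"
    unfolding repelling_spectral_value_def
  proof (intro conjI allI impI)
    fix t :: real assume t: "t \<ge> 0"
    show "has_angular_limit (deriv (\<phi> t)) rep_pt (of_real (exp (- (- (2 * c)) * t)))"
    proof (rule has_angular_limitI)
      fix K z assume "\<And>j. z j \<in> stolz_region rep_pt K" "z \<longlonglongrightarrow> rep_pt"
      from angular_limits_subsequence[OF this t] show "\<exists>s. strict_mono (s :: nat \<Rightarrow> nat) \<and>
         (\<lambda>j. deriv (\<phi> t) (z (s j))) \<longlonglongrightarrow> of_real (exp (- (- (2 * c)) * t))"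
        by (metis minus_minus)
    qed
  qed (use c_pos in simp)
  have "has_angular_limit (\<phi> t) rep_pt rep_pt" if t: "t \<ge> 0" for t
  proof (rule has_angular_limitI)
    fix K z assume "\<And>j. z j \<in> stolz_region rep_pt K" "z \<longlonglongrightarrow> rep_pt"
    from angular_limits_subsequence[OF this t] show "\<exists>s. strict_mono (s :: nat \<Rightarrow> nat) \<and>
         (\<lambda>j. \<phi> t (z (s j))) \<longlonglongrightarrow> rep_pt" by metis
  qed
  with rep show "repelling_fixed_point \<phi> rep_pt"
    unfolding repelling_fixed_point_def using norm_rep_pt by auto
  have "orb n \<in> \<Delta>" for n
    unfolding orb_def image_g[symmetric] by (intro imageI) (simp add: M_disc)
  then have "rep_pt \<in> closure \<Delta>" using orb_tendsto closure_sequential by blast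
  moreover have "rep_pt \<notin> interior \<Delta>"
    using petal_subset_disc[OF semigroup petal] interior_subset norm_rep_pt by fastforce
  ultimately show "rep_pt \<in> frontier \<Delta>" by (simp add: frontier_def)
qed

end

section \<open>An exclusion principle of Lindelof type\<close>

lemma fashoda_complex:
  fixes f g :: "real \<Rightarrow> complex"
  assumes "path f" "path g"
    and f: "\<And>z. z \<in> path_image f \<Longrightarrow> x1 \<le> Re z \<and> Re z \<le> x2 \<and> y1 \<le> Im z \<and> Im z \<le> y2"
    and g: "\<And>z. z \<in> path_image g \<Longrightarrow> x1 \<le> Re z \<and> Re z \<le> x2 \<and> y1 \<le> Im z \<and> Im z \<le> y2"
    and "Re (pathstart f) = x1" "Re (pathfinish f) = x2"
    and "Im (pathstart g) = y1" "Im (pathfinish g) = y2"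
  obtains z where "z \<in> path_image f" "z \<in> path_image g"
proof -
  define e :: "complex \<Rightarrow> real^2" where "e = (\<lambda>z. \<chi> i. if i = 1 then Re z else Im z)"
  have e1: "e z $ 1 = Re z" and e2: "e z $ 2 = Im z" for z by (simp_all add: e_def)
  have inj: "e z = e w \<Longrightarrow> z = w" for z w by (metis complex_eqI e1 e2)
  have cont: "continuous_on S e" for S
    unfolding e_def
  proof (rule continuous_on_vec_lambda)
    show "continuous_on S (\<lambda>z. if i = 1 then Re z else Im z)" for i :: 2
      by (cases "i = 1") (auto intro!: continuous_intros)
  qed
  define a :: "real^2" where "a = e (Complex x1 y1)"
  define b :: "real^2" where "b = e (Complex x2 y2)"
  obtain v where "v \<in> path_image (e \<circ> f)" "v \<in> path_image (e \<circ> g)"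
  proof (rule fashoda[of "e \<circ> f" "e \<circ> g" a b])
    show "path (e \<circ> f)" "path (e \<circ> g)"
      using assms(1,2) by (auto intro: path_continuous_image cont)
    show "path_image (e \<circ> f) \<subseteq> cbox a b" "path_image (e \<circ> g) \<subseteq> cbox a b"
      using f g by (auto simp: path_image_compose mem_box_cart forall_2 a_def b_def e1 e2)
  qed (use assms in \<open>auto simp: pathstart_compose pathfinish_compose a_def b_def e1 e2\<close>)
  then obtain z w where "z \<in> path_image f" "w \<in> path_image g" "e z = e w"
    by (auto simp: path_image_compose)
  with inj that show thesis by metis
qed

definition clamp_real :: "real \<Rightarrow> real \<Rightarrow> real \<Rightarrow> real" where
  "clamp_real l u x = max l (min u x)"

lemma clamp_real:
  "l \<le> u \<Longrightarrow> l \<le> clamp_real l u x" "l \<le> u \<Longrightarrow> clamp_real l u x \<le> u"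
  "l < clamp_real l u x \<Longrightarrow> clamp_real l u x < u \<Longrightarrow> clamp_real l u x = x"
  by (auto simp: clamp_real_def)

lemma continuous_on_clamp_real: "continuous_on S (clamp_real l u)"
  unfolding clamp_real_def by (intro continuous_intros)

text \<open>The curves may leave the rectangle; they are clamped to it.\<close>

lemma crossing_paths_meet:
  fixes p q :: "real \<Rightarrow> complex"
  assumes "path p" "path q" and X: "x1 < x2" and H: "y1 < y2"
    and p: "\<And>z. z \<in> path_image p \<Longrightarrow> y1 < Im z \<and> Im z < y2"
    and q: "\<And>z. z \<in> path_image q \<Longrightarrow> x1 < Re z \<and> Re z < x2"
    and "Re (pathstart p) \<le> x1" "x2 \<le> Re (pathfinish p)"
    and "Im (pathstart q) \<le> y1" "y2 \<le> Im (pathfinish q)"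
  shows "path_image p \<inter> path_image q \<noteq> {}"
proof -
  define cp where "cp = (\<lambda>z. Complex (clamp_real x1 x2 (Re z)) (Im z))"
  define cq where "cq = (\<lambda>z. Complex (Re z) (clamp_real y1 y2 (Im z)))"
  have contp: "continuous_on S cp" for S
    unfolding cp_def by (intro continuous_intros continuous_on_compose2[OF continuous_on_clamp_real]) auto
  have contq: "continuous_on S cq" for S
    unfolding cq_def by (intro continuous_intros continuous_on_compose2[OF continuous_on_clamp_real]) auto
  obtain z where z: "z \<in> path_image (cp \<circ> p)" "z \<in> path_image (cq \<circ> q)"
  proof (rule fashoda_complex[of "cp \<circ> p" "cq \<circ> q" x1 x2 y1 y2])
    show "path (cp \<circ> p)" "path (cq \<circ> q)"
      using assms(1,2) by (auto intro: path_continuous_image contp contq)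
    show "x1 \<le> Re z \<and> Re z \<le> x2 \<and> y1 \<le> Im z \<and> Im z \<le> y2" if "z \<in> path_image (cp \<circ> p)" for z
    proof -
      obtain u where u: "u \<in> path_image p" "z = cp u" using \<open>z \<in> path_image (cp \<circ> p)\<close> by (auto simp: path_image_compose)
      then show ?thesis using p[OF u(1)] clamp_real[of x1 x2 "Re u"] X by (simp add: cp_def)
    qed
    show "x1 \<le> Re z \<and> Re z \<le> x2 \<and> y1 \<le> Im z \<and> Im z \<le> y2" if "z \<in> path_image (cq \<circ> q)" for z
    proof -
      obtain u where u: "u \<in> path_image q" "z = cq u" using \<open>z \<in> path_image (cq \<circ> q)\<close> by (auto simp: path_image_compose)
      then show ?thesis using q[OF u(1)] clamp_real[of y1 y2 "Im u"] H by (simp add: cq_def)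
    qed
    show "Re (pathstart (cp \<circ> p)) = x1" "Re (pathfinish (cp \<circ> p)) = x2"
      "Im (pathstart (cq \<circ> q)) = y1" "Im (pathfinish (cq \<circ> q)) = y2"
      using assms by (auto simp: pathstart_compose pathfinish_compose cp_def cq_def clamp_real_def)
  qed
  obtain u v where u: "u \<in> path_image p" "z = cp u" and v: "v \<in> path_image q" "z = cq v"
    using z by (auto simp: path_image_compose)
  \<comment> \<open>Clamping leaves the imaginary parts on \<open>p\<close> and the real parts on
    \<open>q\<close> alone, and both are strictly inside. So the common point lies strictly inside
    the rectangle and neither curve was moved there.\<close>
  have "y1 < Im z" "Im z < y2" using p[OF u(1)] u(2) by (auto simp: cp_def)
  then have "clamp_real y1 y2 (Im v) = Im v" using clamp_real(3) v(2) by (simp add: cq_def)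
  then have "z = v" using v(2) by (simp add: cq_def)
  have "x1 < Re z" "Re z < x2" using q[OF v(1)] v(2) by (auto simp: cq_def)
  then have "clamp_real x1 x2 (Re u) = Re u" using clamp_real(3) u(2) by (simp add: cp_def)
  then have "z = u" using u(2) by (simp add: cp_def)
  then show ?thesis using \<open>z = v\<close> u(1) v(1) by auto
qed

lemma frontier_connected_component_disjoint:
  fixes S :: "'a::real_normed_vector set"
  assumes "open S" "z \<in> frontier (connected_component_set S x)"
  shows "z \<notin> S"
proof
  assume "z \<in> S"
  have op: "open (connected_component_set S y)" for y using assms(1) by (rule open_connected_component)
  have "z \<in> connected_component_set S z" using \<open>z \<in> S\<close> by simp
  moreover have "z \<in> closure (connected_component_set S x)" using assms(2) by (simp add: frontier_def)
  ultimately have "connected_component_set S z \<inter> connected_component_set S x \<noteq> {}"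
    using op closure_iff_nhds_not_empty by blast
  then have "connected_component_set S z = connected_component_set S x"
    by (meson connected_component_overlap)
  then have "z \<in> connected_component_set S x" using \<open>z \<in> connected_component_set S z\<close> by simp
  then show False using assms(2) op[of x] by (simp add: frontier_def interior_open)
qed

text \<open>The harmonic function cosh (x / 2) cos (y / 2) bounds the influence of the vertical
  sides of the rectangle: there it is at least cosh (X / 2) sqrt 2 / 2 uniformly in y, while at the
  centre it is 1.\<close>

lemma Re_cosh_half:
  fixes y :: real
  assumes "\<bar>y\<bar> < pi / 2"
  shows "Re (cosh (Complex x y / 2)) = cosh (x / 2) * cos (y / 2)"
    and "cos (y / 2) > sqrt 2 / 2"
proof -
  have "Complex x y / 2 = of_real (x / 2) + \<i> * of_real (y / 2)"
    by (simp add: complex_eq_iff)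
  then have "cosh (Complex x y / 2) = (exp (of_real (x / 2) + \<i> * of_real (y / 2)) + exp (- (of_real (x / 2) + \<i> * of_real (y / 2)))) / 2"
    by (simp only: cosh_field_def)
  then show "Re (cosh (Complex x y / 2)) = cosh (x / 2) * cos (y / 2)"
    by (simp add: Re_exp cosh_field_def field_simps)
  have "cos (\<bar>y / 2\<bar>) > cos (pi / 4)"
    using assms by (intro cos_monotone_0_pi) auto
  then show "cos (y / 2) > sqrt 2 / 2" unfolding cos_abs_real cos_45 .
qed

text \<open>Lindelof's reflection trick: \<open>F z * cnj (F (cnj z))\<close> is small both on the curve and on its
  mirror image, and these enclose the centre of the rectangle up to its vertical sides, whose
  harmonic measure is controlled by \<open>cosh\<close>.\<close>

lemma reflection_two_constants:
  fixes F :: "complex \<Rightarrow> complex" and x0 X X' L :: real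
  defines "U \<equiv> {z. \<bar>Re z - x0\<bar> < X' \<and> \<bar>Im z\<bar> < pi / 2}"
  assumes F: "F holomorphic_on U" "\<And>z. z \<in> U \<Longrightarrow> cmod (F z) \<le> 1"
    and X: "0 < X" "X < X'" and L: "0 \<le> L"
    and p: "path p" "Re (pathstart p) \<le> x0 - X" "x0 + X \<le> Re (pathfinish p)"
    and pim: "\<And>z. z \<in> path_image p \<Longrightarrow> \<bar>Im z\<bar> < pi / 2"
    and small: "\<And>z. z \<in> path_image p \<Longrightarrow> \<bar>Re z - x0\<bar> \<le> X \<Longrightarrow> cmod (F z) \<le> exp (- L)"
  shows "(cmod (F (of_real x0)))\<^sup>2 \<le> exp (- L * (1 - sqrt 2 / cosh (X / 2)))"
proof -
  \<comment> \<open>Normalizes the comparison function: q Re cosh ((z - x0) / 2) is at least 1 on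
    the vertical sides, and q is its value at the centre.\<close>
  define q where "q = sqrt 2 / cosh (X / 2)"
  have "q \<ge> 0" by (simp add: q_def)
  define P where "P = path_image p"
  have "compact P" unfolding P_def using p(1) by (rule compact_path_image)
  have "P \<noteq> {}" by (simp add: P_def path_image_nonempty)
  obtain H0 where H0: "H0 < pi / 2" "\<And>z. z \<in> P \<Longrightarrow> \<bar>Im z\<bar> \<le> H0" "H0 \<ge> 0"
  proof -
    have "\<exists>z\<in>P. \<forall>y\<in>P. \<bar>Im y\<bar> \<le> \<bar>Im z\<bar>"
      using \<open>compact P\<close> \<open>P \<noteq> {}\<close> by (intro continuous_attains_sup continuous_intros)
    then obtain z where z: "z \<in> P" "\<And>y. y \<in> P \<Longrightarrow> \<bar>Im y\<bar> \<le> \<bar>Im z\<bar>" by blast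
    show thesis by (rule that[of "\<bar>Im z\<bar>"]) (use z pim[of z] in \<open>auto simp: P_def\<close>)
  qed
  \<comment> \<open>Strictly between the largest height on the curve and pi / 2, so the horizontal
    sides of \<open>R\<close> are not reached by the curve.\<close>
  define H where "H = (H0 + pi / 2) / 2"
  have H: "H0 < H" "H < pi / 2" using H0 by (auto simp: H_def)
  define E where "E = P \<union> cnj ` P"
  define R where "R = {z. \<bar>Re z - x0\<bar> < X \<and> \<bar>Im z\<bar> < H}"
  define C where "C = {z. \<bar>Re z - x0\<bar> \<le> X \<and> \<bar>Im z\<bar> \<le> H}"
  have "compact (cnj ` P)" using \<open>compact P\<close> by (intro compact_continuous_image continuous_intros)
  then have "closed E" unfolding E_def using \<open>compact P\<close> by (intro closed_Un compact_imp_closed)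
  have "open R" unfolding R_def
    by (intro open_Collect_conj open_Collect_less continuous_intros)
  then have opRE: "open (R - E)" using \<open>closed E\<close> by (rule open_Diff)
  have "closed C" unfolding C_def
    by (intro closed_Collect_conj closed_Collect_le continuous_intros)
  have "C \<subseteq> U" using X H by (auto simp: C_def U_def)
  have CE: "cmod (F z) * cmod (F (cnj z)) \<le> exp (- L)" if z: "z \<in> C" "z \<in> E" for z
  proof -
    have zU: "z \<in> U" "cnj z \<in> U" using z(1) \<open>C \<subseteq> U\<close> by (auto simp: U_def)
    from z(2) consider "z \<in> P" | "cnj z \<in> P" by (auto simp: E_def)
    then show ?thesis
    proof cases
      case 1
      then have "cmod (F z) \<le> exp (- L)" using small[of z] z(1) by (simp add: P_def C_def)
      then have "cmod (F z) * cmod (F (cnj z)) \<le> exp (- L) * 1" using F(2)[OF zU(2)] by (intro mult_mono) auto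
      then show ?thesis by simp
    next
      case 2
      then have "cmod (F (cnj z)) \<le> exp (- L)" using small[of "cnj z"] z(1) by (simp add: P_def C_def)
      then have "cmod (F z) * cmod (F (cnj z)) \<le> 1 * exp (- L)" using F(2)[OF zU(1)] by (intro mult_mono) auto
      then show ?thesis by simp
    qed
  qed
  have x0C: "of_real x0 \<in> C" using X H H0 by (simp add: C_def)
  show ?thesis
  proof (cases "of_real x0 \<in> E")
    case True
    have "(cmod (F (of_real x0)))\<^sup>2 \<le> exp (- L)" using CE[OF x0C True] by (simp add: power2_eq_square)
    also have "\<dots> \<le> exp (- L * (1 - q))" using L \<open>q \<ge> 0\<close> by (simp add: algebra_simps)
    finally show ?thesis by (simp add: q_def)
  next
    case False
    then have x0R: "of_real x0 \<in> R - E" using X H H0 by (simp add: R_def)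
    define Q where "Q = connected_component_set (R - E) (of_real x0)"
    have "open Q" unfolding Q_def using opRE by (rule open_connected_component)
    have QR: "Q \<subseteq> R - E" unfolding Q_def by (rule connected_component_subset)
    have x0Q: "of_real x0 \<in> Q" unfolding Q_def using x0R by simp
    have "R \<subseteq> C" by (auto simp: R_def C_def)
    then have clQ: "closure Q \<subseteq> C" using QR \<open>closed C\<close> by (meson Diff_subset closure_minimal order_trans)
    \<comment> \<open>Otherwise a path in \<open>Q\<close> from the centre to a point above or below
      the curve, preceded by its mirror image run backwards, would cross the rectangle vertically
      and meet \<open>p\<close>, which crosses it horizontally. Hence the frontier of
      \<open>Q\<close> avoids the horizontal sides.\<close>
    have low: "\<bar>Im z\<bar> \<le> H0" if "z \<in> Q" for z
    proof (rule ccontr)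
      assume high: "\<not> \<bar>Im z\<bar> \<le> H0"
      have "connected Q" unfolding Q_def by simp
      then have "path_connected Q" using \<open>open Q\<close> connected_open_path_connected by blast
      then obtain g where g: "path g" "path_image g \<subseteq> Q" "pathstart g = of_real x0" "pathfinish g = z"
        using x0Q \<open>z \<in> Q\<close> unfolding path_connected_def by blast
      define g' where "g' = (if Im z > 0 then g else cnj \<circ> g)"
      have g': "path g'" "path_image g' \<subseteq> R - E" "pathstart g' = of_real x0" "Im (pathfinish g') = \<bar>Im z\<bar>"
      proof -
        show "path g'" using g(1) by (auto simp: g'_def intro!: path_continuous_image continuous_intros)
        have "cnj w \<in> R - E" if "w \<in> R - E" for w
        proof -
          have "w \<notin> P" "w \<notin> cnj ` P" "w \<in> R" using that by (auto simp: E_def)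
          moreover have "cnj w \<notin> P" using \<open>w \<notin> cnj ` P\<close> by (metis complex_cnj_cnj imageI)
          moreover have "cnj w \<notin> cnj ` P" using \<open>w \<notin> P\<close> by (metis complex_cnj_cnj imageE)
          ultimately show ?thesis by (auto simp: E_def R_def)
        qed
        then show "path_image g' \<subseteq> R - E" using g(2) QR by (auto simp: g'_def path_image_compose)
        show "pathstart g' = of_real x0" using g(3) by (auto simp: g'_def pathstart_compose)
        show "Im (pathfinish g') = \<bar>Im z\<bar>" using g(4) by (auto simp: g'_def pathfinish_compose)
      qed
      define r where "r = reversepath (cnj \<circ> g') +++ g'"
      have "path (cnj \<circ> g')" using g'(1) by (intro path_continuous_image continuous_intros)
      have "path_image p \<inter> path_image r \<noteq> {}"
      proof (rule crossing_paths_meet[of p r "x0 - X" "x0 + X" "- \<bar>Im z\<bar>" "\<bar>Im z\<bar>"])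
        show "path r" unfolding r_def using g' \<open>path (cnj \<circ> g')\<close>
          by (intro path_join_imp) (auto simp: pathstart_compose)
        show "- \<bar>Im z\<bar> < Im w \<and> Im w < \<bar>Im z\<bar>" if "w \<in> path_image p" for w
          using H0(2)[of w] high that by (auto simp: P_def)
        show "x0 - X < Re w \<and> Re w < x0 + X" if "w \<in> path_image r" for w
        proof -
          have "w \<in> path_image g' \<or> w \<in> cnj ` path_image g'"
            using that path_image_join_subset[of "reversepath (cnj \<circ> g')" g'] by (auto simp: r_def path_image_compose)
          then show ?thesis using g'(2) by (auto simp: R_def abs_less_iff)
        qed
      qed (use X p high H0 g' in \<open>auto simp: r_def pathstart_compose pathfinish_compose\<close>)
      then obtain w where w: "w \<in> P" "w \<in> path_image r" by (auto simp: P_def)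
      then have "w \<in> path_image g' \<or> w \<in> cnj ` path_image g'"
        using path_image_join_subset[of "reversepath (cnj \<circ> g')" g'] by (auto simp: r_def path_image_compose)
      then show False
      proof
        assume "w \<in> cnj ` path_image g'"
        then obtain u where "u \<in> path_image g'" "w = cnj u" by blast
        moreover from this have "u \<in> cnj ` P" using w(1) by (metis complex_cnj_cnj imageI)
        ultimately show False using g'(2) by (auto simp: E_def)
      qed (use g'(2) w(1) in \<open>auto simp: E_def\<close>)
    qed
    \<comment> \<open>On the curve and its mirror image |W| <= exp L makes up for the bound exp (-
      L); on the vertical sides |W| <= 1. The maximum principle then compares at the centre, where
      |W| = exp (L (1 - q)).\<close>
    define W where "W = (\<lambda>z::complex. exp (of_real L * (1 - of_real q * cosh ((z - of_real x0) / 2))))"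
    define M where "M = (\<lambda>z. F z * cnj (F (cnj z)) * W z)"
    have Uc: "cnj ` U = U"
    proof -
      have "cnj ` U \<subseteq> U" by (auto simp: U_def)
      moreover have "z \<in> cnj ` U" if "z \<in> U" for z
        using that by (intro image_eqI[of _ _ "cnj z"]) (auto simp: U_def)
      ultimately show ?thesis by blast
    qed
    have "open U" unfolding U_def
      by (intro open_Collect_conj open_Collect_less continuous_intros)
    have "(\<lambda>z. cnj (F (cnj z))) holomorphic_on U"
      using holomorphic_on_compose_cnj_cnj[of F U] F(1) \<open>open U\<close> Uc by (simp add: o_def)
    then have holM: "M holomorphic_on U" unfolding M_def W_def cosh_field_def
      by (intro holomorphic_intros F) auto
    have normW: "cmod (W z) = exp (L * (1 - q * (cosh ((Re z - x0) / 2) * cos (Im z / 2))))"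
      if "\<bar>Im z\<bar> < pi / 2" for z
    proof -
      have "z - of_real x0 = Complex (Re z - x0) (Im z)" by (simp add: complex_eq_iff)
      then have "Re (cosh ((z - of_real x0) / 2)) = cosh ((Re z - x0) / 2) * cos (Im z / 2)"
        using Re_cosh_half(1)[OF that] by simp
      then show ?thesis by (simp add: W_def)
    qed
    have Mle: "cmod (M z) \<le> 1" if z: "z \<in> frontier Q" for z
    proof -
      have zcl: "z \<in> closure Q" using z by (simp add: frontier_def)
      then have "z \<in> C" using clQ by blast
      then have zU: "z \<in> U" "cnj z \<in> U" using \<open>C \<subseteq> U\<close> by (auto simp: U_def)
      have im: "\<bar>Im z\<bar> < pi / 2" using zU by (simp add: U_def)
      have nM: "cmod (M z) = cmod (F z) * cmod (F (cnj z)) * cmod (W z)" by (simp add: M_def norm_mult)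
      have "z \<notin> R - E" using frontier_connected_component_disjoint[OF opRE] z by (simp add: Q_def)
      then consider "z \<in> E" | "z \<notin> R" by blast
      then show ?thesis
      proof cases
        case 1
        have "0 \<le> q * (cosh ((Re z - x0) / 2) * cos (Im z / 2))"
        proof -
          have "0 \<le> sqrt 2 / 2" by simp
          then have "0 \<le> cos (Im z / 2)" using Re_cosh_half(2)[OF im] by linarith
          then show ?thesis using \<open>q \<ge> 0\<close> by (intro mult_nonneg_nonneg) simp_all
        qed
        then have "L * (1 - q * (cosh ((Re z - x0) / 2) * cos (Im z / 2))) \<le> L * 1"
          using L by (intro mult_left_mono) auto
        then have "cmod (W z) \<le> exp L" unfolding normW[OF im] by simp
        then have "cmod (M z) \<le> exp (- L) * exp L"
          unfolding nM using CE[OF \<open>z \<in> C\<close> 1] by (intro mult_mono) auto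
        then show ?thesis by (simp add: exp_minus)
      next
        case 2
        have "closure Q \<subseteq> {z. \<bar>Im z\<bar> \<le> H0}"
          using low by (intro closure_minimal closed_Collect_le continuous_intros) auto
        then have "\<bar>Im z\<bar> < H" using zcl H by auto
        then have re: "\<bar>Re z - x0\<bar> = X" using 2 \<open>z \<in> C\<close> by (auto simp: R_def C_def)
        have "cosh ((Re z - x0) / 2) = cosh (\<bar>(Re z - x0) / 2\<bar>)" by (simp only: cosh_real_abs)
        also have "\<dots> = cosh (X / 2)" using re by simp
        finally have ch: "cosh ((Re z - x0) / 2) = cosh (X / 2)" .
        have "q * (cosh ((Re z - x0) / 2) * cos (Im z / 2)) = sqrt 2 * cos (Im z / 2)"
          unfolding ch q_def by simp
        also have "\<dots> \<ge> sqrt 2 * (sqrt 2 / 2)" using Re_cosh_half(2)[OF im] by (intro mult_left_mono) auto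
        finally have "q * (cosh ((Re z - x0) / 2) * cos (Im z / 2)) \<ge> 1" by simp
        then have "L * (1 - q * (cosh ((Re z - x0) / 2) * cos (Im z / 2))) \<le> 0"
          using L by (intro mult_nonneg_nonpos) auto
        then have W1: "cmod (W z) \<le> 1" unfolding normW[OF im] by simp
        have "cmod (M z) \<le> 1 * 1 * 1"
          unfolding nM using W1 F(2)[OF zU(1)] F(2)[OF zU(2)] by (intro mult_mono) auto
        then show ?thesis by simp
      qed
    qed
    have "cmod (M (of_real x0)) \<le> 1"
    proof (rule maximum_modulus_frontier[of M Q])
      show "M holomorphic_on interior Q"
        using holM clQ \<open>C \<subseteq> U\<close> by (meson closure_subset holomorphic_on_subset interior_subset order_trans)
      show "continuous_on (closure Q) M"
        using holomorphic_on_imp_continuous_on[OF holM] clQ \<open>C \<subseteq> U\<close> by (meson continuous_on_subset order_trans)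
      have "bounded C"
      proof (rule boundedI)
        fix z assume "z \<in> C"
        then have "\<bar>Re z\<bar> \<le> \<bar>x0\<bar> + X" "\<bar>Im z\<bar> \<le> H" by (auto simp: C_def)
        then show "cmod z \<le> \<bar>x0\<bar> + X + H" using cmod_le[of z] by linarith
      qed
      then show "bounded Q" using QR \<open>R \<subseteq> C\<close> bounded_subset by blast
    qed (use Mle x0Q in auto)
    moreover have "cmod (M (of_real x0)) = (cmod (F (of_real x0)))\<^sup>2 * exp (L * (1 - q))"
      using normW[of "of_real x0"] pi_gt_zero by (simp add: M_def norm_mult power2_eq_square)
    ultimately have "(cmod (F (of_real x0)))\<^sup>2 * exp (L * (1 - q)) * exp (- (L * (1 - q))) \<le> 1 * exp (- (L * (1 - q)))"
      by (intro mult_right_mono) auto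
    then have "(cmod (F (of_real x0)))\<^sup>2 \<le> exp (- (L * (1 - q)))"
      by (simp add: mult.assoc flip: exp_add)
    then show ?thesis by (simp add: q_def)
  qed
qed

lemma Re_half_plane_cayley:
  assumes "cmod s < 1"
  shows "Re ((1 - s) / (1 + s)) > 0"
proof -
  have nz: "1 + s \<noteq> 0" using assms by (metis add_eq_0_iff norm_minus_cancel norm_one less_irrefl)
  have "(1 - s) / (1 + s) = (1 - s) * cnj (1 + s) / of_real ((cmod (1 + s))\<^sup>2)"
    by (simp add: complex_div_cnj[of "1 - s" "1 + s"])
  then have "Re ((1 - s) / (1 + s)) = Re ((1 - s) * cnj (1 + s)) / (cmod (1 + s))\<^sup>2"
    by (simp only: Re_divide_of_real)
  also have "Re ((1 - s) * cnj (1 + s)) = 1 - (cmod s)\<^sup>2"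
    by (simp add: cmod_power2) (simp add: algebra_simps power2_eq_square)
  finally show ?thesis using nz norm_sq_less_one[OF assms] by simp
qed

lemma norm_cayley_less_one:
  assumes "Re u > 0"
  shows "cmod ((1 - u) / (1 + u)) < 1" and "1 + u \<noteq> 0" and "cmod (1 + u) \<ge> 1"
proof -
  show nz: "1 + u \<noteq> 0" using assms by (auto simp: complex_eq_iff)
  have "Re (1 + u) \<le> cmod (1 + u)" by (rule complex_Re_le_cmod)
  then show "cmod (1 + u) \<ge> 1" using assms by simp
  have "(cmod (1 - u))\<^sup>2 = (cmod (1 + u))\<^sup>2 - 4 * Re u"
    by (simp add: cmod_power2) (simp add: algebra_simps power2_eq_square)
  then have "(cmod (1 - u))\<^sup>2 < (cmod (1 + u))\<^sup>2" using assms by simp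
  then have "cmod (1 - u) < cmod (1 + u)" by (rule power2_less_imp_less) simp
  then show "cmod ((1 - u) / (1 + u)) < 1" using nz by (simp add: norm_divide)
qed

text \<open>Lindelof's theorem in the form of an exclusion principle. The disc is mapped to the strip
  \<open>\<bar>Im\<bar> < pi / 2\<close> so that \<open>\<sigma>\<close> becomes the right end and the radius the real axis.\<close>

lemma lindelof_exclusion:
  fixes F :: "complex \<Rightarrow> complex" and r :: "nat \<Rightarrow> real"
  assumes \<sigma>: "cmod \<sigma> = 1" and \<delta>: "\<delta> > 0"
    and F: "F holomorphic_on (unit_disc \<inter> ball \<sigma> \<delta>)" "\<And>z. z \<in> unit_disc \<inter> ball \<sigma> \<delta> \<Longrightarrow> cmod (F z) \<le> 1"
    and \<Delta>: "\<Delta> \<subseteq> unit_disc" "path_connected \<Delta>" "\<sigma> \<in> closure \<Delta>"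
    and L: "L > 0" and small: "\<And>z. z \<in> \<Delta> \<Longrightarrow> z \<in> ball \<sigma> \<delta> \<Longrightarrow> cmod (F z) \<le> exp (- L)"
    and r: "\<And>n. 0 \<le> r n" "\<And>n. r n < 1" "r \<longlonglongrightarrow> 1" "(\<lambda>n. cmod (F (of_real (r n) * \<sigma>))) \<longlonglongrightarrow> 1"
  shows False
proof -
  have ss: "\<sigma> * cnj \<sigma> = 1" unfolding complex_norm_square[symmetric] \<sigma> by simp
  \<comment> \<open>T \<zeta> = \<sigma> tanh (\<zeta> / 2) maps the strip to the disc, and
    \<open>Z\<close> is its inverse.\<close>
  define T where "T = (\<lambda>\<zeta>. \<sigma> * ((1 - exp (- \<zeta>)) / (1 + exp (- \<zeta>))))"
  define Z where "Z = (\<lambda>z. - Ln ((1 - z * cnj \<sigma>) / (1 + z * cnj \<sigma>)))"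
  have Re_exp_pos: "Re (exp (- \<zeta>)) > 0" if "\<bar>Im \<zeta>\<bar> < pi / 2" for \<zeta>
    using that by (simp add: Re_exp cos_gt_zero_pi abs_less_iff)
  have T_disc: "cmod (T \<zeta>) < 1" if "\<bar>Im \<zeta>\<bar> < pi / 2" for \<zeta>
    unfolding T_def norm_mult \<sigma> using norm_cayley_less_one(1)[OF Re_exp_pos[OF that]] by simp
  have zs: "cmod (z * cnj \<sigma>) = cmod z" for z by (simp add: norm_mult \<sigma>)
  have u_pos: "Re ((1 - z * cnj \<sigma>) / (1 + z * cnj \<sigma>)) > 0" if "cmod z < 1" for z
    using Re_half_plane_cayley[of "z * cnj \<sigma>"] that zs by simp
  have nz1: "1 + z * cnj \<sigma> \<noteq> 0" if "cmod z < 1" for z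
    using that zs[of z] by (metis add_eq_0_iff norm_minus_cancel norm_one less_irrefl)
  have Z_strip: "\<bar>Im (Z z)\<bar> < pi / 2" if "cmod z < 1" for z
    using Re_Ln_pos_lt_imp[OF u_pos[OF that]] by (simp add: Z_def)
  have TZ: "T (Z z) = z" if "cmod z < 1" for z
  proof -
    define s where "s = z * cnj \<sigma>"
    define u where "u = (1 - s) / (1 + s)"
    have "u \<noteq> 0" using u_pos[OF that] by (auto simp: u_def s_def)
    then have e: "exp (- Z z) = u" by (simp add: Z_def u_def s_def)
    have s1: "1 + s \<noteq> 0" using nz1[OF that] by (simp add: s_def)
    have "1 - u = 2 * s / (1 + s)" "1 + u = 2 / (1 + s)" using s1 by (simp_all add: u_def field_simps)
    then have "(1 - u) / (1 + u) = s" using s1 by simp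
    then have "T (Z z) = \<sigma> * s" by (simp only: T_def e)
    also have "\<dots> = z * (\<sigma> * cnj \<sigma>)" by (simp add: s_def)
    finally show ?thesis unfolding ss by simp
  qed
  have Z_cont: "continuous_on unit_disc Z" unfolding Z_def
  proof (intro continuous_intros)
    show "(1 - z * cnj \<sigma>) / (1 + z * cnj \<sigma>) \<notin> \<real>\<^sub>\<le>\<^sub>0" if "z \<in> unit_disc" for z
      using u_pos[of z] that by (auto simp: complex_nonpos_Reals_iff simp del: Re_divide)
  qed (use nz1 in auto)
  \<comment> \<open>From |T \<zeta> - \<sigma>| <= 2 exp (- Re \<zeta>): beyond \<open>A\<close> the
    strip is mapped into the ball of radius \<delta>.\<close>
  define A where "A = ln (2 / \<delta>)"
  have T_near: "T \<zeta> \<in> ball \<sigma> \<delta>" if im: "\<bar>Im \<zeta>\<bar> < pi / 2" and re: "Re \<zeta> > A" for \<zeta>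
  proof -
    define u where "u = exp (- \<zeta>)"
    have u: "Re u > 0" using Re_exp_pos[OF im] by (simp add: u_def)
    have "T \<zeta> - \<sigma> = \<sigma> * ((1 - u) / (1 + u) - 1)" by (simp add: T_def u_def algebra_simps)
    also have "(1 - u) / (1 + u) - 1 = - (2 * u) / (1 + u)"
      using norm_cayley_less_one(2)[OF u] by (simp add: field_simps)
    finally have "cmod (T \<zeta> - \<sigma>) = 2 * cmod u / cmod (1 + u)" by (simp add: norm_mult norm_divide \<sigma>)
    also have "\<dots> \<le> 2 * cmod u / 1" using norm_cayley_less_one(3)[OF u] by (intro divide_left_mono) auto
    also have "cmod u = exp (- Re \<zeta>)" by (simp add: u_def)
    also have "exp (- Re \<zeta>) < exp (- A)" using re by simp
    also have "exp (- A) = \<delta> / 2" using \<delta> by (simp add: A_def exp_minus)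
    finally show ?thesis by (simp add: dist_norm norm_minus_commute)
  qed
  have Z_large: "\<exists>\<eta>>0. \<forall>z. cmod z < 1 \<longrightarrow> cmod (z - \<sigma>) < \<eta> \<longrightarrow> Re (Z z) \<ge> Y" for Y
  proof (intro exI conjI allI impI)
    show "min 1 (exp (- Y)) > 0" by simp
    fix z assume z: "cmod z < 1" "cmod (z - \<sigma>) < min 1 (exp (- Y))"
    define s where "s = z * cnj \<sigma>"
    have "1 - s = - (z - \<sigma>) * cnj \<sigma>" using ss by (simp add: s_def algebra_simps)
    then have n1: "cmod (1 - s) = cmod (z - \<sigma>)" by (simp add: norm_mult \<sigma> norm_minus_commute)
    have "cmod (1 + s) \<ge> cmod 2 - cmod (1 - s)" using norm_triangle_ineq2[of 2 "1 - s"] by simp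
    then have n2: "cmod (1 + s) \<ge> 1" using z n1 by simp
    have "cmod ((1 - s) / (1 + s)) \<le> cmod (1 - s) / 1"
      unfolding norm_divide using n2 by (intro divide_left_mono) auto
    also have "\<dots> \<le> exp (- Y)" using z n1 by simp
    finally have le: "cmod ((1 - s) / (1 + s)) \<le> exp (- Y)" .
    have nz: "(1 - s) / (1 + s) \<noteq> 0" using u_pos[OF z(1)] unfolding s_def by auto
    then have "ln (cmod ((1 - s) / (1 + s))) \<le> ln (exp (- Y))" using le by (intro ln_mono) auto
    then show "Re (Z z) \<ge> Y" using nz by (simp add: Z_def s_def)
  qed
  define x where "x = (\<lambda>n. Re (Z (of_real (r n) * \<sigma>)))"
  have rd: "cmod (of_real (r n) * \<sigma>) < 1" for n using r(1,2) by (simp add: norm_mult \<sigma>)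
  have xZ: "Z (of_real (r n) * \<sigma>) = of_real (x n)" for n
  proof -
    have "of_real (r n) * \<sigma> * cnj \<sigma> = of_real (r n)" using ss by (simp add: mult.assoc)
    then have "Z (of_real (r n) * \<sigma>) = - Ln ((1 - of_real (r n)) / (1 + of_real (r n)))"
      by (simp only: Z_def)
    also have "(1 - of_real (r n)) / (1 + of_real (r n)) = complex_of_real ((1 - r n) / (1 + r n))" by simp
    also have "Ln (of_real ((1 - r n) / (1 + r n))) = of_real (ln ((1 - r n) / (1 + r n)))"
      using r(1,2)[of n] by (intro Ln_of_real divide_pos_pos) auto
    finally have "Z (of_real (r n) * \<sigma>) = of_real (- ln ((1 - r n) / (1 + r n)))" by simp
    then show ?thesis by (simp add: x_def)
  qed
  have x_large: "\<forall>\<^sub>F n in sequentially. x n \<ge> Y" for Y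
  proof -
    obtain \<eta> where \<eta>: "\<eta> > 0" "\<And>z. cmod z < 1 \<Longrightarrow> cmod (z - \<sigma>) < \<eta> \<Longrightarrow> Re (Z z) \<ge> Y"
      using Z_large by blast
    have "(\<lambda>n. of_real (r n) * \<sigma>) \<longlonglongrightarrow> of_real 1 * \<sigma>" by (intro tendsto_intros r)
    then have "\<forall>\<^sub>F n in sequentially. dist (of_real (r n) * \<sigma>) \<sigma> < \<eta>" using \<eta>(1) by (intro tendstoD) auto
    then show ?thesis by eventually_elim (use \<eta>(2) rd in \<open>simp add: x_def dist_norm\<close>)
  qed
  \<comment> \<open>Chosen so that cosh (X / 2) = cosh (ln 8) > 4; at least half of the exponent
    \<open>L\<close> then survives.\<close>
  define X :: real where "X = 2 * ln 8"
  have X: "X > 0" by (simp add: X_def)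
  have "cosh (X / 2) = (8 + 1 / 8) / 2" by (simp add: X_def cosh_ln_real)
  moreover have "sqrt 2 \<le> 2" by (simp add: real_sqrt_le_iff sqrt_le_D real_le_lsqrt)
  ultimately have q: "sqrt 2 / cosh (X / 2) \<le> 1 / 2" by simp
  obtain p0 where p0: "p0 \<in> \<Delta>" using \<Delta>(3) by fastforce
  have claim: "(cmod (F (of_real (r n) * \<sigma>)))\<^sup>2 \<le> exp (- L / 2)"
    if n: "x n \<ge> A + X + 1" "x n \<ge> Re (Z p0) + X" for n
  proof -
    obtain \<eta> where \<eta>: "\<eta> > 0" "\<And>z. cmod z < 1 \<Longrightarrow> cmod (z - \<sigma>) < \<eta> \<Longrightarrow> Re (Z z) \<ge> x n + X"
      using Z_large by blast
    \<comment> \<open>A path inside \<Delta> from the fixed point p0 to a point sufficiently near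
      \<sigma> crosses the whole rectangle around \<open>x n\<close> in the strip.\<close>
    obtain z' where z': "z' \<in> \<Delta>" "dist z' \<sigma> < \<eta>" using \<Delta>(3) \<eta>(1) by (meson closure_approachable)
    obtain g where g: "path g" "path_image g \<subseteq> \<Delta>" "pathstart g = p0" "pathfinish g = z'"
      using \<Delta>(2) p0 z'(1) unfolding path_connected_def by blast
    have gd: "path_image g \<subseteq> unit_disc" using g(2) \<Delta>(1) by blast
    define U where "U = {z. \<bar>Re z - x n\<bar> < X + 1 \<and> \<bar>Im z\<bar> < pi / 2}"
    have U: "T z \<in> unit_disc \<inter> ball \<sigma> \<delta>" if "z \<in> U" for z
      using that T_disc[of z] T_near[of z] n(1) by (auto simp: U_def)
    have "(cmod ((F \<circ> T) (of_real (x n))))\<^sup>2 \<le> exp (- L * (1 - sqrt 2 / cosh (X / 2)))"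
    proof (rule reflection_two_constants[where X' = "X + 1" and p = "Z \<circ> g"])
      have "T holomorphic_on U"
        unfolding T_def
      proof (intro holomorphic_intros)
        show "1 + exp (- z) \<noteq> 0" if "z \<in> U" for z
          using that norm_cayley_less_one(2)[OF Re_exp_pos] by (simp add: U_def)
      qed
      then have "(F \<circ> T) holomorphic_on U"
        by (rule holomorphic_on_compose_gen[OF _ F(1)]) (use U in blast)
      then show "(F \<circ> T) holomorphic_on {z. \<bar>Re z - x n\<bar> < X + 1 \<and> \<bar>Im z\<bar> < pi / 2}" by (simp add: U_def)
      show "cmod ((F \<circ> T) z) \<le> 1" if "z \<in> {z. \<bar>Re z - x n\<bar> < X + 1 \<and> \<bar>Im z\<bar> < pi / 2}" for z
        using F(2)[OF U] that by (simp add: U_def)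
      show "path (Z \<circ> g)" using g(1) gd Z_cont by (intro path_continuous_image continuous_on_subset[OF Z_cont])
      show "Re (pathstart (Z \<circ> g)) \<le> x n - X" using n(2) by (simp add: pathstart_compose g(3))
      show "x n + X \<le> Re (pathfinish (Z \<circ> g))"
        using \<eta>(2)[of z'] z' \<Delta>(1) by (auto simp: pathfinish_compose g(4) dist_norm)
      show "\<bar>Im z\<bar> < pi / 2" if "z \<in> path_image (Z \<circ> g)" for z
        using that Z_strip gd by (auto simp: path_image_compose)
      show "cmod ((F \<circ> T) z) \<le> exp (- L)" if z: "z \<in> path_image (Z \<circ> g)" "\<bar>Re z - x n\<bar> \<le> X" for z
      proof -
        obtain y where y: "y \<in> path_image g" "z = Z y" using z(1) by (auto simp: path_image_compose)
        have yd: "cmod y < 1" using y(1) gd by auto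
        have "T z = y" using TZ[OF yd] y(2) by simp
        moreover have "T z \<in> ball \<sigma> \<delta>"
          using T_near[of z] Z_strip[OF yd] y(2) z(2) n(1) by (simp add: abs_le_iff)
        ultimately show ?thesis using small[of y] y(1) g(2) by auto
      qed
    qed (use X L in auto)
    also have "\<dots> \<le> exp (- L / 2)"
    proof -
      have "L * (1 / 2) \<le> L * (1 - sqrt 2 / cosh (X / 2))" using q L by (intro mult_left_mono) auto
      then show ?thesis by simp
    qed
    finally have "(cmod ((F \<circ> T) (of_real (x n))))\<^sup>2 \<le> exp (- L / 2)" .
    moreover have "T (of_real (x n)) = of_real (r n) * \<sigma>" using TZ[OF rd[of n]] xZ[of n] by simp
    ultimately show ?thesis by simp
  qed
  have "\<forall>\<^sub>F n in sequentially. (cmod (F (of_real (r n) * \<sigma>)))\<^sup>2 \<le> exp (- L / 2)"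
    using x_large[of "A + X + 1"] x_large[of "Re (Z p0) + X"] by eventually_elim (rule claim)
  moreover have "(\<lambda>n. (cmod (F (of_real (r n) * \<sigma>)))\<^sup>2) \<longlonglongrightarrow> 1\<^sup>2" by (intro tendsto_power r)
  ultimately have "1\<^sup>2 \<le> exp (- L / 2)" using tendsto_upperbound trivial_limit_sequentially by blast
  then show False using L by simp
qed

text \<open>The argument in the plane slit along the half-line going down from \<open>b\<close>: it
  is 0 above \<open>b\<close>, pi on the left edge of the slit and - pi on the right edge.\<close>

definition slit_arg :: "complex \<Rightarrow> complex \<Rightarrow> real" where
  "slit_arg b w = Im (Ln (- \<i> * (w - b)))"

lemma slit_arg_bounds:
  assumes "\<And>s. s \<ge> 0 \<Longrightarrow> w \<noteq> b - \<i> * of_real s"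
  shows "- \<i> * (w - b) \<notin> \<real>\<^sub>\<le>\<^sub>0"
    and "- pi \<le> slit_arg b w" "slit_arg b w \<le> pi"
    and "Re b \<le> Re w \<Longrightarrow> slit_arg b w \<le> 0" "Re w \<le> Re b \<Longrightarrow> slit_arg b w \<ge> 0"
proof -
  define q where "q = - \<i> * (w - b)"
  have Im_q: "Im q = Re b - Re w" and Re_q: "Re q = Im w - Im b" by (simp_all add: q_def)
  have n: "q \<notin> \<real>\<^sub>\<le>\<^sub>0"
  proof
    assume "q \<in> \<real>\<^sub>\<le>\<^sub>0"
    then have "Im q = 0" "Re q \<le> 0" by (auto simp: complex_nonpos_Reals_iff)
    then have "w = b - \<i> * of_real (- Re q)" using Im_q Re_q by (simp add: complex_eq_iff)
    then show False using assms[of "- Re q"] \<open>Re q \<le> 0\<close> by simp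
  qed
  then show "- \<i> * (w - b) \<notin> \<real>\<^sub>\<le>\<^sub>0" by (simp add: q_def)
  have "q \<noteq> 0" using n by auto
  show "- pi \<le> slit_arg b w" "slit_arg b w \<le> pi"
    using mpi_less_Im_Ln[OF \<open>q \<noteq> 0\<close>] Im_Ln_le_pi[OF \<open>q \<noteq> 0\<close>] by (simp_all add: slit_arg_def q_def)
  show "slit_arg b w \<ge> 0" if "Re w \<le> Re b"
    using Im_Ln_pos_le[OF \<open>q \<noteq> 0\<close>] that Im_q by (simp add: slit_arg_def q_def)
  show "slit_arg b w \<le> 0" if "Re b \<le> Re w"
  proof (cases "Re b = Re w")
    case True
    then have "Re q > 0" using n Im_q by (auto simp: complex_nonpos_Reals_iff)
    then show ?thesis using Im_Ln_eq_0[OF \<open>q \<noteq> 0\<close>] True Im_q by (simp add: slit_arg_def q_def)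
  next
    case False
    then show ?thesis
      using Im_Ln_pos_le[OF \<open>q \<noteq> 0\<close>] Im_Ln_le_pi[OF \<open>q \<noteq> 0\<close>] that Im_q by (simp add: slit_arg_def q_def)
  qed
qed

lemma Im_Ln_tendsto_scaled:
  assumes lim: "(\<lambda>n. y n / of_nat n) \<longlonglongrightarrow> a" and a: "a \<notin> \<real>\<^sub>\<le>\<^sub>0"
    and y: "\<forall>\<^sub>F n in sequentially. y n \<noteq> 0"
  shows "(\<lambda>n. Im (Ln (y n))) \<longlonglongrightarrow> Im (Ln a)"
proof -
  have "(\<lambda>n. Im (Ln (y n / of_nat n))) \<longlonglongrightarrow> Im (Ln a)"
    by (intro tendsto_Im tendsto_Ln lim a)
  moreover have "\<forall>\<^sub>F n in sequentially. Im (Ln (y n / of_nat n)) = Im (Ln (y n))"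
    using y eventually_gt_at_top[of 0]
  proof eventually_elim
    case (elim n)
    then show ?case using Ln_divide_of_real[of "real n" "y n"] by simp
  qed
  ultimately show ?thesis by (rule Lim_transform_eventually)
qed

text \<open>The rescaled points tend to a point of the branch cut, where the logarithm is
  discontinuous. On each side of the slit the argument is therefore written as that of
  \<open>b - w n\<close> or \<open>w n - b\<close>, turned by a right angle, where the limit is off
  the cut.\<close>

lemma slit_arg_tendsto:
  assumes w: "(\<lambda>n. w n / of_nat n) \<longlonglongrightarrow> - \<i>"
  shows "\<forall>\<^sub>F n in sequentially. Re (w n) < Re b \<Longrightarrow> (\<lambda>n. slit_arg b (w n)) \<longlonglongrightarrow> pi"
    and "\<forall>\<^sub>F n in sequentially. Re b < Re (w n) \<Longrightarrow> (\<lambda>n. slit_arg b (w n)) \<longlonglongrightarrow> - pi"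
proof -
  have b: "(\<lambda>n. b / of_nat n) \<longlonglongrightarrow> 0" by (rule lim_const_over_n)
  have l1: "(\<lambda>n. (b - w n) / of_nat n) \<longlonglongrightarrow> \<i>"
    using tendsto_diff[OF b w] by (simp add: diff_divide_distrib)
  have l2: "(\<lambda>n. (w n - b) / of_nat n) \<longlonglongrightarrow> - \<i>"
    using tendsto_diff[OF w b] by (simp add: diff_divide_distrib)
  {
    assume ev: "\<forall>\<^sub>F n in sequentially. Re (w n) < Re b"
    then have "\<forall>\<^sub>F n in sequentially. b - w n \<noteq> 0" by eventually_elim auto
    then have "(\<lambda>n. pi / 2 + Im (Ln (b - w n))) \<longlonglongrightarrow> pi / 2 + Im (Ln \<i>)"
      by (intro tendsto_intros Im_Ln_tendsto_scaled l1) (auto simp: complex_nonpos_Reals_iff)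
    moreover have "\<forall>\<^sub>F n in sequentially. pi / 2 + Im (Ln (b - w n)) = slit_arg b (w n)"
      using ev
    proof eventually_elim
      case (elim n)
      have "- \<i> * (w n - b) = \<i> * (b - w n)" by (simp add: algebra_simps)
      moreover have "Ln (\<i> * (b - w n)) = Ln (b - w n) + \<i> * of_real pi / 2"
        using elim by (subst Ln_times_ii) auto
      ultimately show ?case by (simp add: slit_arg_def)
    qed
    ultimately show "(\<lambda>n. slit_arg b (w n)) \<longlonglongrightarrow> pi" using Lim_transform_eventually by fastforce
  }
  {
    assume ev: "\<forall>\<^sub>F n in sequentially. Re b < Re (w n)"
    then have "\<forall>\<^sub>F n in sequentially. w n - b \<noteq> 0" by eventually_elim auto
    then have "(\<lambda>n. Im (Ln (w n - b)) - pi / 2) \<longlonglongrightarrow> Im (Ln (- \<i>)) - pi / 2"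
      by (intro tendsto_intros Im_Ln_tendsto_scaled l2) (auto simp: complex_nonpos_Reals_iff)
    moreover have "\<forall>\<^sub>F n in sequentially. Im (Ln (w n - b)) - pi / 2 = slit_arg b (w n)"
      using ev
    proof eventually_elim
      case (elim n)
      have "\<i> * (- \<i> * (w n - b)) = w n - b" by simp
      moreover have "Ln (\<i> * (- \<i> * (w n - b))) = Ln (- \<i> * (w n - b)) + \<i> * of_real pi / 2"
        using elim by (subst Ln_times_ii) auto
      ultimately show ?case by (simp add: slit_arg_def)
    qed
    ultimately show "(\<lambda>n. slit_arg b (w n)) \<longlonglongrightarrow> - pi" using Lim_transform_eventually by fastforce
  }
qed

lemma cesaro_increments:
  fixes x :: "nat \<Rightarrow> complex"
  assumes "(\<lambda>n. x (Suc n) - x n) \<longlonglongrightarrow> d"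
  shows "(\<lambda>n. x n / of_nat n) \<longlonglongrightarrow> d"
proof (rule tendstoI)
  fix e :: real assume "e > 0"
  then have "\<forall>\<^sub>F n in sequentially. dist (x (Suc n) - x n) d < e / 2" using assms by (intro tendstoD) auto
  then obtain N where N: "\<And>n. n \<ge> N \<Longrightarrow> cmod (x (Suc n) - x n - d) < e / 2"
    by (auto simp: eventually_sequentially dist_norm)
  define C where "C = cmod (x N - of_nat N * d)"
  have bd: "cmod (x (N + m) - of_nat (N + m) * d) \<le> C + real m * (e / 2)" for m
  proof (induction m)
    case (Suc m)
    have "x (N + Suc m) - of_nat (N + Suc m) * d = (x (N + m) - of_nat (N + m) * d) + (x (Suc (N + m)) - x (N + m) - d)"
      by (simp add: algebra_simps)
    then have "cmod (x (N + Suc m) - of_nat (N + Suc m) * d)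
      \<le> cmod (x (N + m) - of_nat (N + m) * d) + cmod (x (Suc (N + m)) - x (N + m) - d)"
      by (simp only: norm_triangle_ineq)
    moreover have "real (Suc m) * (e / 2) = real m * (e / 2) + e / 2" by (simp add: algebra_simps)
    moreover have "cmod (x (Suc (N + m)) - x (N + m) - d) < e / 2" by (rule N) simp
    ultimately show ?case using Suc by linarith
  qed (simp add: C_def)
  have "(\<lambda>n. C / real n) \<longlonglongrightarrow> 0" by (rule lim_const_over_n)
  then have "\<forall>\<^sub>F n in sequentially. C / real n < e / 2" using \<open>e > 0\<close> by (intro order_tendstoD) auto
  then show "\<forall>\<^sub>F n in sequentially. dist (x n / of_nat n) d < e"
    using eventually_ge_at_top[of "max N 1"]
  proof eventually_elim
    case (elim n)
    then have n: "n \<ge> N" "n > 0" by auto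
    have "cmod (x n - of_nat n * d) \<le> C + real (n - N) * (e / 2)" using bd[of "n - N"] n by simp
    also have "\<dots> \<le> C + real n * (e / 2)" using \<open>e > 0\<close> by (intro add_left_mono mult_right_mono) auto
    finally have le: "cmod (x n - of_nat n * d) \<le> C + real n * (e / 2)" .
    have "x n / of_nat n - d = (x n - of_nat n * d) / of_nat n" using n(2) by (simp add: diff_divide_distrib)
    then have "dist (x n / of_nat n) d = cmod (x n - of_nat n * d) / real n" by (simp add: dist_norm norm_divide)
    also have "\<dots> \<le> (C + real n * (e / 2)) / real n" using le by (intro divide_right_mono) auto
    also have "\<dots> = C / real n + e / 2" using n(2) by (simp add: add_divide_distrib)
    finally show ?case using elim(1) by linarith
  qed
qed

section \<open>Radial behaviour at boundary fixed points\<close>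

lemma schwarz_pick_mob:
  assumes f: "f holomorphic_on unit_disc" "\<And>z. cmod z < 1 \<Longrightarrow> cmod (f z) < 1"
    and y: "cmod y < 1" and z: "cmod z < 1"
  shows "cmod (mob (- f y) (f z)) \<le> cmod (mob (- y) z)"
proof -
  define F where "F = mob (- f y) \<circ> (f \<circ> mob y)"
  have fy: "cmod (f y) < 1" using f y by blast
  have F: "F holomorphic_on unit_disc" unfolding F_def
    by (intro holomorphic_on_compose_gen[of _ _ _ unit_disc] f holomorphic_mob)
      (use f y fy fy[THEN less_imp_le] norm_mob_less_one in auto)
  have "cmod (F (mob (- y) z)) \<le> cmod (mob (- y) z)"
  proof (rule Schwarz_Lemma(1)[OF F])
    show "F 0 = 0" by (simp add: F_def)
    show "cmod (F u) < 1" if "cmod u < 1" for u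
      unfolding F_def using that fy y by (simp add: f norm_mob_less_one)
    show "cmod (mob (- y) z) < 1" using norm_mob_less_one[of "- y" z] y z by simp
  qed
  then show ?thesis by (simp add: F_def mob_mob_minus[OF y z])
qed

lemma frac_rearrange:
  fixes A B p q s t :: real
  assumes "q * s / B \<le> p * t / A" "0 < p" "0 < q" "0 < t" "0 < s" "A > 0" "B > 0"
  shows "A / p \<le> t / s * (B / q)"
  using assms by (simp add: field_simps)

lemma angular_limit_radial:
  assumes "has_angular_limit f \<sigma> l" "cmod \<sigma> = 1"
  shows "((\<lambda>x. f (of_real (1 - x) * \<sigma>)) \<longlongrightarrow> l) (at_right 0)"
proof -
  have "(f \<longlongrightarrow> l) (at \<sigma> within stolz_region \<sigma> 2)" using assms(1) by (simp add: has_angular_limit_def)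
  moreover have "filterlim (\<lambda>x. of_real (1 - x) * \<sigma>) (at \<sigma> within stolz_region \<sigma> 2) (at_right 0)"
    unfolding filterlim_at
  proof
    have "((\<lambda>x. of_real (1 - x) * \<sigma>) \<longlongrightarrow> of_real (1 - 0) * \<sigma>) (at_right 0)" by (intro tendsto_intros)
    then show "filterlim (\<lambda>x. of_real (1 - x) * \<sigma>) (nhds \<sigma>) (at_right 0)" by simp
    show "\<forall>\<^sub>F x in at_right 0. of_real (1 - x) * \<sigma> \<in> stolz_region \<sigma> 2 \<and> of_real (1 - x) * \<sigma> \<noteq> \<sigma>"
      unfolding eventually_at_right_field
    proof (intro exI conjI allI impI)
      show "(0::real) < 1" by simp
      fix x :: real assume x: "0 < x" "x < 1"
      have n1: "cmod (of_real (1 - x) * \<sigma>) = 1 - x" using x assms(2) by (simp only: norm_mult norm_of_real) simp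
      have "\<sigma> - of_real (1 - x) * \<sigma> = of_real x * \<sigma>" by (simp add: algebra_simps)
      then have n2: "cmod (\<sigma> - of_real (1 - x) * \<sigma>) = x" using x assms(2) by (simp add: norm_mult)
      show "of_real (1 - x) * \<sigma> \<in> stolz_region \<sigma> 2" using x n1 n2 by (simp add: stolz_region_def)
      show "of_real (1 - x) * \<sigma> \<noteq> \<sigma>" using n2 x by auto
    qed
  qed
  ultimately show ?thesis by (rule filterlim_compose)
qed

text \<open>The mean value inequality for f z - d z between two points of the radius; then the outer
  point is sent to \<sigma>, where \<open>f\<close> has the radial limit \<sigma>.\<close>

lemma angular_derivative_radial:
  assumes f: "f holomorphic_on unit_disc" and \<sigma>: "cmod \<sigma> = 1"
    and lim: "has_angular_limit f \<sigma> \<sigma>" and der: "has_angular_limit (deriv f) \<sigma> d"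
  shows "((\<lambda>x. (\<sigma> - f (of_real (1 - x) * \<sigma>)) / of_real x) \<longlongrightarrow> d * \<sigma>) (at_right 0)"
proof (rule tendstoI)
  fix e :: real assume "e > 0"
  define y where "y = (\<lambda>x. complex_of_real (1 - x) * \<sigma>)"
  have yd: "cmod (y x) < 1" if "0 < x" "x < 1" for x
    using that \<sigma> by (simp only: y_def norm_mult norm_of_real) simp
  have "\<forall>\<^sub>F x in at_right 0. dist (deriv f (y x)) d < e / 2"
    using angular_limit_radial[OF der \<sigma>] \<open>e > 0\<close> unfolding y_def by (intro tendstoD) auto
  then obtain \<eta> where \<eta>: "\<eta> > 0" "\<And>x. 0 < x \<Longrightarrow> x < \<eta> \<Longrightarrow> dist (deriv f (y x)) d < e / 2"
    unfolding eventually_at_right_field by auto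
  define \<eta>' where "\<eta>' = min \<eta> 1"
  have "dist ((\<sigma> - f (y x)) / of_real x) (d * \<sigma>) < e" if x: "0 < x" "x < \<eta>'" for x
  proof -
    define u where "u = (\<lambda>z. f z - d * z)"
    have bd: "cmod (u (y x') - u (y x)) \<le> e / 2 * x" if x': "0 < x'" "x' < x" for x'
    proof -
      have seg: "\<exists>s. x' \<le> s \<and> s \<le> x \<and> z = y s" if z: "z \<in> closed_segment (y x') (y x)" for z
      proof -
        obtain t where t: "0 \<le> t" "t \<le> 1" "z = (1 - t) *\<^sub>R y x' + t *\<^sub>R y x"
          using z by (auto simp: closed_segment_def)
        define s where "s = (1 - t) * x' + t * x"
        have "z = y s" unfolding t(3) y_def s_def by (simp add: scaleR_conv_of_real algebra_simps)
        moreover have "s = x' + t * (x - x')" by (simp add: s_def algebra_simps)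
        moreover have "0 \<le> t * (x - x')" "t * (x - x') \<le> 1 * (x - x')"
          using t x' by (auto intro: mult_right_mono)
        ultimately show ?thesis by (intro exI[of _ s]) auto
      qed
      have "cmod (u (y x') - u (y x)) \<le> e / 2 * cmod (y x' - y x)"
      proof (rule field_differentiable_bound[where f' = "\<lambda>z. deriv f z - d" and S = "closed_segment (y x') (y x)"])
        fix z assume "z \<in> closed_segment (y x') (y x)"
        then obtain s where s: "x' \<le> s" "s \<le> x" "z = y s" using seg by blast
        have sx: "0 < s" "s < 1" "s < \<eta>" using s x x' by (auto simp: \<eta>'_def)
        have "f field_differentiable at z"
          using holomorphic_on_imp_differentiable_at[OF f open_ball] yd[OF sx(1,2)] s(3) by simp
        then have "(f has_field_derivative deriv f z) (at z)" by (rule field_differentiable_derivI)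
        then have "(u has_field_derivative (deriv f z - d)) (at z)"
          unfolding u_def by (auto intro!: derivative_eq_intros)
        then show "(u has_field_derivative (deriv f z - d)) (at z within closed_segment (y x') (y x))"
          by (rule has_field_derivative_at_within)
        show "cmod (deriv f z - d) \<le> e / 2" using \<eta>(2)[OF sx(1,3)] s(3) by (simp add: dist_norm)
      qed auto
      also have "cmod (y x' - y x) = x - x'"
      proof -
        have "y x' - y x = of_real (x - x') * \<sigma>" by (simp add: y_def algebra_simps)
        then show ?thesis using x' \<sigma> by (simp only: norm_mult norm_of_real) simp
      qed
      also have "e / 2 * (x - x') \<le> e / 2 * x" using \<open>e > 0\<close> x' by (intro mult_left_mono) auto
      finally show ?thesis .
    qed
    have "((\<lambda>x'. cmod (u (y x') - u (y x))) \<longlongrightarrow> cmod ((\<sigma> - d * \<sigma>) - u (y x))) (at_right 0)"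
    proof -
      have "((\<lambda>x'. f (y x')) \<longlongrightarrow> \<sigma>) (at_right 0)" using angular_limit_radial[OF lim \<sigma>] by (simp add: y_def)
      moreover have "(y \<longlongrightarrow> of_real (1 - 0) * \<sigma>) (at_right 0)" unfolding y_def by (intro tendsto_intros)
      ultimately show ?thesis unfolding u_def by (intro tendsto_intros) auto
    qed
    moreover have "\<forall>\<^sub>F x' in at_right 0. cmod (u (y x') - u (y x)) \<le> e / 2 * x"
      unfolding eventually_at_right_field using x bd by (intro exI[of _ x]) auto
    ultimately have "cmod ((\<sigma> - d * \<sigma>) - u (y x)) \<le> e / 2 * x"
      by (intro tendsto_upperbound) auto
    moreover have "(\<sigma> - d * \<sigma>) - u (y x) = \<sigma> - f (y x) - of_real x * (d * \<sigma>)"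
      by (simp add: u_def y_def algebra_simps)
    moreover have "\<sigma> - f (y x) - of_real x * (d * \<sigma>) = of_real x * ((\<sigma> - f (y x)) / of_real x - d * \<sigma>)"
      using x by (simp add: field_simps)
    ultimately have "cmod (of_real x * ((\<sigma> - f (y x)) / of_real x - d * \<sigma>)) \<le> e / 2 * x" by (simp only:)
    moreover have "cmod (of_real x * ((\<sigma> - f (y x)) / of_real x - d * \<sigma>)) = x * cmod ((\<sigma> - f (y x)) / of_real x - d * \<sigma>)"
      unfolding norm_mult norm_of_real using x by simp
    ultimately have "x * cmod ((\<sigma> - f (y x)) / of_real x - d * \<sigma>) \<le> x * (e / 2)"
      by (simp only: mult.commute)
    then have "cmod ((\<sigma> - f (y x)) / of_real x - d * \<sigma>) \<le> e / 2" using x by simp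
    then show ?thesis using \<open>e > 0\<close> by (simp add: dist_norm)
  qed
  moreover have "\<eta>' > 0" using \<eta>(1) by (simp add: \<eta>'_def)
  ultimately show "\<forall>\<^sub>F x in at_right 0. dist ((\<sigma> - f (of_real (1 - x) * \<sigma>)) / of_real x) (d * \<sigma>) < e"
    unfolding eventually_at_right_field y_def by blast
qed

text \<open>Julia's lemma, from the Schwarz--Pick inequality for \<open>z\<close> and a radial point tending to \<open>\<sigma>\<close>.\<close>

lemma julia_radial:
  assumes f: "f holomorphic_on unit_disc" "\<And>z. cmod z < 1 \<Longrightarrow> cmod (f z) < 1"
    and \<sigma>: "cmod \<sigma> = 1" and a: "a > 0"
    and der: "((\<lambda>x. (\<sigma> - f (of_real (1 - x) * \<sigma>)) / of_real x) \<longlongrightarrow> of_real a * \<sigma>) (at_right 0)"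
    and x: "0 < x" "x \<le> 1"
  shows "cmod (f (of_real (1 - x) * \<sigma>) - \<sigma>) \<le> 2 * a * x"
proof -
  have ss: "cnj \<sigma> * \<sigma> = 1" using complex_norm_square[of \<sigma>] \<sigma> by (simp add: mult.commute)
  define y where "y = (\<lambda>x. complex_of_real (1 - x) * \<sigma>)"
  have ny: "cmod (y s) = 1 - s" if "0 < s" "s \<le> 1" for s
    using that \<sigma> by (simp only: y_def norm_mult norm_of_real) simp
  have yd: "cmod (y s) < 1" if "0 < s" "s \<le> 1" for s using ny[OF that] that by simp
  define z where "z = y x"
  have zd: "cmod z < 1" and fz: "cmod (f z) < 1" using yd[OF x] f(2) by (auto simp: z_def)
  define e where "e = (\<lambda>s. (\<sigma> - f (y s)) / of_real s)"
  have elim: "(e \<longlongrightarrow> of_real a * \<sigma>) (at_right 0)" using der by (simp add: e_def y_def)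
  have fy: "f (y s) = \<sigma> - of_real s * e s" if "s > 0" for s using that by (simp add: e_def)
  \<comment> \<open>The quotient (1 - |f (y s)|^2) / (1 - |y s|^2) after cancelling s; it extends
    continuously to s = 0 with the value \<open>a\<close>.\<close>
  define Q where "Q = (\<lambda>s. (2 * Re (cnj \<sigma> * e s) - s * (cmod (e s))\<^sup>2) / (2 - s))"
  have ratio: "(1 - (cmod (f (y s)))\<^sup>2) / (1 - (cmod (y s))\<^sup>2) = Q s" if s: "0 < s" "s \<le> 1" for s
  proof -
    have "(cmod (\<sigma> - of_real s * e s))\<^sup>2 = (cmod \<sigma>)\<^sup>2 - 2 * s * Re (cnj \<sigma> * e s) + s\<^sup>2 * (cmod (e s))\<^sup>2"
      by (simp add: cmod_power2) (simp add: algebra_simps power2_eq_square)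
    then have "1 - (cmod (f (y s)))\<^sup>2 = s * (2 * Re (cnj \<sigma> * e s) - s * (cmod (e s))\<^sup>2)"
      unfolding fy[OF s(1)] \<sigma> by (simp add: algebra_simps power2_eq_square)
    moreover have "1 - (cmod (y s))\<^sup>2 = s * (2 - s)"
      unfolding ny[OF s] by (simp add: algebra_simps power2_eq_square)
    ultimately show ?thesis using s by (simp add: Q_def)
  qed
  have sp: "(cmod (1 - cnj (f z) * f (y s)))\<^sup>2 / (1 - (cmod (f z))\<^sup>2) \<le> Q s * ((cmod (1 - cnj z * y s))\<^sup>2 / (1 - (cmod z)\<^sup>2))"
    if s: "0 < s" "s \<le> 1" for s
  proof -
    have fys: "cmod (f (y s)) < 1" using f(2) yd[OF s] by blast
    define A where "A = (cmod (1 - cnj (f z) * f (y s)))\<^sup>2"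
    define B where "B = (cmod (1 - cnj z * y s))\<^sup>2"
    have "A > 0" "B > 0"
      using mob_denom_nonzero[of "- f z" "f (y s)"] mob_denom_nonzero[of "- z" "y s"] fz fys zd yd[OF s]
      by (auto simp: A_def B_def)
    have pos: "1 - (cmod (f z))\<^sup>2 > 0" "1 - (cmod z)\<^sup>2 > 0" "1 - (cmod (f (y s)))\<^sup>2 > 0" "1 - (cmod (y s))\<^sup>2 > 0"
      using norm_sq_less_one fz zd fys yd[OF s] by auto
    have "(cmod (mob (- f z) (f (y s))))\<^sup>2 \<le> (cmod (mob (- z) (y s)))\<^sup>2"
      by (intro power_mono schwarz_pick_mob f zd yd s) auto
    then have "1 - (cmod (mob (- z) (y s)))\<^sup>2 \<le> 1 - (cmod (mob (- f z) (f (y s))))\<^sup>2" by simp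
    then have "(1 - (cmod z)\<^sup>2) * (1 - (cmod (y s))\<^sup>2) / B \<le> (1 - (cmod (f z))\<^sup>2) * (1 - (cmod (f (y s)))\<^sup>2) / A"
      using one_minus_norm_mob[of "- z" "y s"] one_minus_norm_mob[of "- f z" "f (y s)"] zd fz fys yd[OF s]
      by (simp add: A_def B_def)
    then have "A / (1 - (cmod (f z))\<^sup>2) \<le> (1 - (cmod (f (y s)))\<^sup>2) / (1 - (cmod (y s))\<^sup>2) * (B / (1 - (cmod z)\<^sup>2))"
      using pos \<open>A > 0\<close> \<open>B > 0\<close> by (intro frac_rearrange)
    then show ?thesis unfolding ratio[OF s] A_def B_def .
  qed
  have ylim: "(y \<longlongrightarrow> of_real (1 - 0) * \<sigma>) (at_right 0)" unfolding y_def by (intro tendsto_intros)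
  have fylim: "((\<lambda>s. f (y s)) \<longlongrightarrow> \<sigma>) (at_right 0)"
  proof -
    have "((\<lambda>s. \<sigma> - of_real s * e s) \<longlongrightarrow> \<sigma> - of_real 0 * (of_real a * \<sigma>)) (at_right 0)"
      by (intro tendsto_intros elim)
    moreover have "\<forall>\<^sub>F s in at_right 0. \<sigma> - of_real s * e s = f (y s)"
      using eventually_at_right_less[of "0::real"] by eventually_elim (simp add: fy)
    ultimately show ?thesis using Lim_transform_eventually by fastforce
  qed
  have Qlim: "(Q \<longlongrightarrow> (2 * Re (cnj \<sigma> * (of_real a * \<sigma>)) - 0 * (cmod (of_real a * \<sigma>))\<^sup>2) / (2 - 0)) (at_right 0)"
    unfolding Q_def by (intro tendsto_intros elim) auto
  have "cnj \<sigma> * (of_real a * \<sigma>) = of_real a" using ss by (simp add: mult.left_commute)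
  then have Qlim': "(Q \<longlongrightarrow> a) (at_right 0)" using Qlim unfolding \<open>cnj \<sigma> * (of_real a * \<sigma>) = of_real a\<close> by simp
  have "((\<lambda>s. Q s * ((cmod (1 - cnj z * y s))\<^sup>2 / (1 - (cmod z)\<^sup>2)) - (cmod (1 - cnj (f z) * f (y s)))\<^sup>2 / (1 - (cmod (f z))\<^sup>2))
    \<longlongrightarrow> a * ((cmod (1 - cnj z * (of_real (1 - 0) * \<sigma>)))\<^sup>2 / (1 - (cmod z)\<^sup>2)) - (cmod (1 - cnj (f z) * \<sigma>))\<^sup>2 / (1 - (cmod (f z))\<^sup>2)) (at_right 0)"
    using norm_sq_less_one[OF zd] norm_sq_less_one[OF fz] by (intro tendsto_intros Qlim' ylim fylim) auto
  moreover have "\<forall>\<^sub>F s in at_right 0. 0 \<le> Q s * ((cmod (1 - cnj z * y s))\<^sup>2 / (1 - (cmod z)\<^sup>2)) - (cmod (1 - cnj (f z) * f (y s)))\<^sup>2 / (1 - (cmod (f z))\<^sup>2)"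
    unfolding eventually_at_right_field using sp by (intro exI[of _ 1]) (auto simp: less_imp_le)
  ultimately have "0 \<le> a * ((cmod (1 - cnj z * (of_real (1 - 0) * \<sigma>)))\<^sup>2 / (1 - (cmod z)\<^sup>2)) - (cmod (1 - cnj (f z) * \<sigma>))\<^sup>2 / (1 - (cmod (f z))\<^sup>2)"
    by (intro tendsto_lowerbound) auto
  moreover have "cmod (1 - cnj u * \<sigma>) = cmod (\<sigma> - u)" for u
  proof -
    have "1 - cnj u * \<sigma> = cnj (\<sigma> - u) * \<sigma>" using ss by (simp add: algebra_simps)
    then show ?thesis using \<sigma> by (simp only: norm_mult complex_mod_cnj mult_1_right)
  qed
  \<comment> \<open>Julia's inequality for horocycles at \<sigma>. On the radius the right-hand side
    is at most a x, and 1 - |f z|^2 <= 2 |\<sigma> - f z| turns the left-hand side into a bound on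
    the Euclidean distance.\<close>
  ultimately have jl: "(cmod (\<sigma> - f z))\<^sup>2 / (1 - (cmod (f z))\<^sup>2) \<le> a * ((cmod (\<sigma> - z))\<^sup>2 / (1 - (cmod z)\<^sup>2))" by simp
  have "\<sigma> - z = of_real x * \<sigma>" by (simp add: z_def y_def algebra_simps)
  then have sz: "cmod (\<sigma> - z) = x" using x \<sigma> by (simp add: norm_mult)
  have "1 - (cmod z)\<^sup>2 = x * (2 - x)" unfolding z_def ny[OF x] by (simp add: algebra_simps power2_eq_square)
  then have "(cmod (\<sigma> - z))\<^sup>2 / (1 - (cmod z)\<^sup>2) = x / (2 - x)" unfolding sz using x by (simp add: power2_eq_square)
  also have "\<dots> \<le> x / 1" using x by (intro divide_left_mono) auto
  finally have "a * ((cmod (\<sigma> - z))\<^sup>2 / (1 - (cmod z)\<^sup>2)) \<le> a * x" using a by (intro mult_left_mono) auto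
  with jl have "(cmod (\<sigma> - f z))\<^sup>2 / (1 - (cmod (f z))\<^sup>2) \<le> a * x" by linarith
  then have "(cmod (\<sigma> - f z))\<^sup>2 \<le> a * x * (1 - (cmod (f z))\<^sup>2)"
    using norm_sq_less_one[OF fz] by (simp add: pos_divide_le_eq)
  also have "\<dots> \<le> a * x * (2 * cmod (\<sigma> - f z))"
  proof (rule mult_left_mono)
    have "1 - (cmod (f z))\<^sup>2 = (1 - cmod (f z)) * (1 + cmod (f z))" by (simp add: algebra_simps power2_eq_square)
    also have "\<dots> \<le> (1 - cmod (f z)) * 2" using fz by (intro mult_left_mono) auto
    also have "\<dots> \<le> 2 * cmod (\<sigma> - f z)" using norm_triangle_ineq2[of \<sigma> "f z"] \<sigma> by simp
    finally show "1 - (cmod (f z))\<^sup>2 \<le> 2 * cmod (\<sigma> - f z)" .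
  qed (use a x in auto)
  finally have "cmod (\<sigma> - f z) * cmod (\<sigma> - f z) \<le> (2 * a * x) * cmod (\<sigma> - f z)"
    by (simp add: power2_eq_square algebra_simps)
  then have "cmod (\<sigma> - f z) \<le> 2 * a * x"
    using a x by (cases "cmod (\<sigma> - f z) = 0") (auto simp: mult_le_cancel_right)
  then show ?thesis by (simp add: z_def y_def norm_minus_commute)
qed

text \<open>In hyperbolic coordinates centred at \<open>(1 - x) * \<sigma>\<close> the map behaves like the hyperbolic
  automorphism with the same multiplier.\<close>

lemma radial_rescaling_limit:
  fixes e :: "nat \<Rightarrow> complex" and x :: "nat \<Rightarrow> real"
  assumes \<sigma>: "cmod \<sigma> = 1" and a: "a > 0" and \<gamma>: "\<gamma> > 0" and x: "\<And>n. 0 < x n" "x \<longlonglongrightarrow> 0"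
    and e: "e \<longlonglongrightarrow> of_real a * \<sigma>"
  shows "(\<lambda>n. mob (- (of_real (1 - x n) * \<sigma>)) (\<sigma> - of_real (\<gamma> * x n) * e n))
    \<longlonglongrightarrow> of_real ((1 - \<gamma> * a) / (1 + \<gamma> * a)) * \<sigma>"
proof -
  have ss: "cnj \<sigma> * \<sigma> = 1" using complex_norm_square[of \<sigma>] \<sigma> by (simp add: mult.commute)
  \<comment> \<open>Numerator and denominator are both divisible by \<open>x n\<close>, so the
    indeterminate quotient becomes continuous at x = 0.\<close>
  have eq: "mob (- (of_real (1 - x n) * \<sigma>)) (\<sigma> - of_real (\<gamma> * x n) * e n) =
    (\<sigma> - of_real \<gamma> * e n) / (1 + of_real \<gamma> * (cnj \<sigma> * e n) - of_real (\<gamma> * x n) * (cnj \<sigma> * e n))" for n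
  proof -
    have "\<sigma> - of_real (\<gamma> * x n) * e n + - (of_real (1 - x n) * \<sigma>) = of_real (x n) * (\<sigma> - of_real \<gamma> * e n)"
      by (simp add: algebra_simps)
    moreover have "1 + cnj (- (of_real (1 - x n) * \<sigma>)) * (\<sigma> - of_real (\<gamma> * x n) * e n) = of_real (x n) * (1 + of_real \<gamma> * (cnj \<sigma> * e n) - of_real (\<gamma> * x n) * (cnj \<sigma> * e n))"
    proof -
      have "1 + cnj (- (of_real (1 - x n) * \<sigma>)) * (\<sigma> - of_real (\<gamma> * x n) * e n) =
        1 - of_real (1 - x n) * (cnj \<sigma> * \<sigma>) + of_real (1 - x n) * of_real (\<gamma> * x n) * (cnj \<sigma> * e n)"
        by (simp add: algebra_simps)
      also have "\<dots> = of_real (x n) * (1 + of_real \<gamma> * (cnj \<sigma> * e n) - of_real (\<gamma> * x n) * (cnj \<sigma> * e n))"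
        unfolding ss by (simp add: algebra_simps)
      finally show ?thesis .
    qed
    ultimately have "mob (- (of_real (1 - x n) * \<sigma>)) (\<sigma> - of_real (\<gamma> * x n) * e n) =
      of_real (x n) * (\<sigma> - of_real \<gamma> * e n) /
        (of_real (x n) * (1 + of_real \<gamma> * (cnj \<sigma> * e n) - of_real (\<gamma> * x n) * (cnj \<sigma> * e n)))"
      by (simp only: mob_def)
    then show ?thesis using x(1)[of n] by simp
  qed
  have den: "cnj \<sigma> * (of_real a * \<sigma>) = of_real a" using ss by (simp add: mult.left_commute)
  have "1 + \<gamma> * a \<noteq> 0" using a \<gamma> by (simp add: add_pos_pos less_imp_neq[symmetric])
  then have nz: "1 + of_real \<gamma> * of_real a \<noteq> (0::complex)"
    by (metis of_real_1 of_real_add of_real_eq_0_iff of_real_mult)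
  have "(\<lambda>n. mob (- (of_real (1 - x n) * \<sigma>)) (\<sigma> - of_real (\<gamma> * x n) * e n)) \<longlonglongrightarrow>
    (\<sigma> - of_real \<gamma> * (of_real a * \<sigma>)) / (1 + of_real \<gamma> * (cnj \<sigma> * (of_real a * \<sigma>)) - of_real (\<gamma> * 0) * (cnj \<sigma> * (of_real a * \<sigma>)))"
    unfolding eq by (intro tendsto_intros e x)
      (use nz in \<open>simp only: den mult_zero_right of_real_0 mult_zero_left diff_zero not_False_eq_True\<close>)
  also have "(\<sigma> - of_real \<gamma> * (of_real a * \<sigma>)) / (1 + of_real \<gamma> * (cnj \<sigma> * (of_real a * \<sigma>)) - of_real (\<gamma> * 0) * (cnj \<sigma> * (of_real a * \<sigma>)))
    = of_real ((1 - \<gamma> * a) / (1 + \<gamma> * a)) * \<sigma>"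
    unfolding den by (simp add: algebra_simps)
  finally show ?thesis .
qed

text \<open>The Schwarz lemma after the Cayley transform that sends \<open>f 0\<close> to 0. The
  second inequality is of Harnack type: the values at two points at bounded hyperbolic distance are
  comparable.\<close>

lemma half_plane_schwarz:
  assumes f: "f holomorphic_on ball 0 r" "\<And>u. cmod u < r \<Longrightarrow> Re (f u) > 0" and u: "cmod u < r"
  shows "cmod (f u - f 0) \<le> cmod u / r * cmod (f u + cnj (f 0))"
    and "cmod (f u) \<le> (r + cmod u) / (r - cmod u) * cmod (f 0)"
proof -
  have r: "r > 0" using u norm_ge_zero[of u] by linarith
  define F where "F = (\<lambda>v. (f (of_real r * v) - f 0) / (f (of_real r * v) + cnj (f 0)))"
  have f0: "Re (f 0) > 0" using f(2)[of 0] r by simp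
  have rv: "cmod (of_real r * v) < r" if "cmod v < 1" for v
    using that r by (simp add: norm_mult)
  have nz: "f (of_real r * v) + cnj (f 0) \<noteq> 0" if "cmod v < 1" for v
  proof -
    have "Re (f (of_real r * v) + cnj (f 0)) > 0" using f(2)[OF rv[OF that]] f0 by simp
    then show ?thesis by (metis less_irrefl zero_complex.simps(1))
  qed
  have hol: "(f \<circ> (\<lambda>v. of_real r * v)) holomorphic_on unit_disc"
    by (rule holomorphic_on_compose_gen[OF _ f(1)]) (use rv in \<open>auto intro!: holomorphic_intros\<close>)
  have F: "F holomorphic_on unit_disc"
    using hol nz unfolding F_def o_def by (intro holomorphic_intros) auto
  have "cmod (F (u / of_real r)) \<le> cmod (u / of_real r)"
  proof (rule Schwarz_Lemma(1)[OF F])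
    show "F 0 = 0" by (simp add: F_def)
    show "cmod (F v) < 1" if v: "cmod v < 1" for v
    proof -
      define p where "p = f (of_real r * v)"
      have p: "Re p > 0" using f(2)[OF rv[OF v]] by (simp add: p_def)
      have "(cmod (p - f 0))\<^sup>2 = (cmod (p + cnj (f 0)))\<^sup>2 - 4 * Re p * Re (f 0)"
        by (simp add: cmod_power2) (simp add: algebra_simps power2_eq_square)
      then have "(cmod (p - f 0))\<^sup>2 < (cmod (p + cnj (f 0)))\<^sup>2" using p f0 by simp
      then have "cmod (p - f 0) < cmod (p + cnj (f 0))" by (rule power2_less_imp_less) simp
      then show ?thesis using nz[OF v] by (simp add: F_def p_def norm_divide)
    qed
    show "cmod (u / of_real r) < 1" using u r by (simp add: norm_divide)
  qed
  moreover have "f u + cnj (f 0) \<noteq> 0" using nz[of "u / of_real r"] u r by (simp add: norm_divide)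
  ultimately show 1: "cmod (f u - f 0) \<le> cmod u / r * cmod (f u + cnj (f 0))"
    using r by (simp add: F_def norm_divide pos_divide_le_eq)
  define q where "q = cmod u / r"
  have q: "0 \<le> q" "q < 1" using u r by (auto simp: q_def)
  have "cmod (f u) \<le> cmod (f 0) + cmod (f u - f 0)" by (rule norm_triangle_sub)
  also have "\<dots> \<le> cmod (f 0) + q * (cmod (f u) + cmod (f 0))"
    using 1 norm_triangle_ineq[of "f u" "cnj (f 0)"] q
    by (intro add_left_mono order_trans[OF 1[folded q_def]] mult_left_mono) auto
  finally have "(1 - q) * cmod (f u) \<le> (1 + q) * cmod (f 0)" by (simp add: algebra_simps)
  then have "cmod (f u) \<le> (1 + q) * cmod (f 0) / (1 - q)" using q by (simp add: pos_le_divide_eq mult.commute)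
  also have "(1 + q) * cmod (f 0) / (1 - q) = (r + cmod u) / (r - cmod u) * cmod (f 0)"
    using r u by (simp add: q_def divide_simps)
  finally show "cmod (f u) \<le> (r + cmod u) / (r - cmod u) * cmod (f 0)" .
qed

section \<open>Petals in Koenigs coordinates\<close>

text \<open>
  The chart \<open>k\<close> is the inverse Koenigs function in coordinates in which the semigroup is
  \<open>\<zeta> \<mapsto> \<zeta> + \<i> t\<close>. It is injective in the non-elliptic case (\<open>\<omega> = 0\<close>), and \<open>2 pi / \<mu>\<close>-periodic
  in the elliptic case, when it misses the Denjoy-Wolff point. The blockers express maximality of
  the strip.
\<close>

locale petal_chart =
  fixes \<phi> :: "real \<Rightarrow> complex \<Rightarrow> complex" and D :: "complex set" and k :: "complex \<Rightarrow> complex"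
    and \<omega> :: complex and \<rho> :: real
  assumes sem: "holomorphic_semigroup \<phi>"
    and open_D: "open D" and hol_k: "k holomorphic_on D" and k_disc: "\<And>\<zeta>. \<zeta> \<in> D \<Longrightarrow> cmod (k \<zeta>) < 1"
    and up: "\<And>\<zeta> t. \<zeta> \<in> D \<Longrightarrow> t \<ge> 0 \<Longrightarrow> \<zeta> + \<i> * of_real t \<in> D"
    and k_up: "\<And>\<zeta> t. \<zeta> \<in> D \<Longrightarrow> t \<ge> 0 \<Longrightarrow> k (\<zeta> + \<i> * of_real t) = \<phi> t (k \<zeta>)"
    and period: "\<And>\<zeta> j. \<zeta> \<in> D \<Longrightarrow> \<zeta> + of_int j * \<omega> \<in> D"
    and k_period: "\<And>\<zeta> j. \<zeta> \<in> D \<Longrightarrow> k (\<zeta> + of_int j * \<omega>) = k \<zeta>"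
    and fibre: "\<And>\<zeta> \<zeta>'. \<zeta> \<in> D \<Longrightarrow> \<zeta>' \<in> D \<Longrightarrow> k \<zeta> = k \<zeta>' \<Longrightarrow> \<exists>j. \<zeta>' = \<zeta> + of_int j * \<omega>"
    and rho: "\<rho> > 0" and omega: "\<omega> = 0 \<or> \<rho> \<le> Re \<omega>"
    and strip_D: "\<And>\<zeta>. \<bar>Re \<zeta>\<bar> < \<rho> / 2 \<Longrightarrow> \<zeta> \<in> D"
    and blocker_left: "\<And>\<epsilon>. \<epsilon> > 0 \<Longrightarrow> \<exists>b. b \<notin> D \<and> - \<rho> / 2 - \<epsilon> < Re b \<and> Re b \<le> - \<rho> / 2"
    and blocker_right: "\<And>\<epsilon>. \<epsilon> > 0 \<Longrightarrow> \<exists>b. b \<notin> D \<and> \<rho> / 2 \<le> Re b \<and> Re b < \<rho> / 2 + \<epsilon>"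
    and lift: "\<And>\<sigma>. cmod \<sigma> = 1 \<Longrightarrow> \<exists>\<delta> l. \<delta> > 0 \<and> l holomorphic_on (unit_disc \<inter> ball \<sigma> \<delta>) \<and>
      (\<forall>z\<in>unit_disc \<inter> ball \<sigma> \<delta>. l z \<in> D \<and> k (l z) = z)"
    and fixed_outside: "\<And>z t. cmod z < 1 \<Longrightarrow> z \<notin> k ` D \<Longrightarrow> t \<ge> 0 \<Longrightarrow> \<phi> t z = z"
    and accumulate_outside: "\<And>z b V. cmod z < 1 \<Longrightarrow> z \<notin> k ` D \<Longrightarrow> open V \<Longrightarrow> z \<in> V \<Longrightarrow>
      \<exists>y. b + \<i> * of_real y \<in> D \<and> k (b + \<i> * of_real y) \<in> V"
begin

definition S :: "complex set" where "S = {\<zeta>. \<bar>Re \<zeta>\<bar> < \<rho> / 2}"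

lemma S_subset: "S \<subseteq> D" using strip_D by (auto simp: S_def)

lemma open_S: "open S"
  unfolding S_def by (intro open_Collect_less continuous_intros)

lemma connected_S: "connected S"
proof -
  have "S = {\<zeta>. Re \<zeta> < \<rho> / 2} \<inter> {\<zeta>. Re \<zeta> > - \<rho> / 2}" by (auto simp: S_def)
  then have "convex S" by (simp only: convex_Int convex_halfspace_Re_lt convex_halfspace_Re_gt)
  then show ?thesis by (rule convex_connected)
qed

lemma period_zero:
  assumes "\<bar>Re (of_int j * \<omega>)\<bar> < \<rho>"
  shows "of_int j * \<omega> = 0"
proof (cases "\<omega> = 0 \<or> j = 0")
  case False
  then have "Re \<omega> \<ge> \<rho>" using omega by auto
  have "\<bar>of_int j :: real\<bar> \<ge> 1" using False by linarith
  then have "1 * Re \<omega> \<le> \<bar>of_int j\<bar> * Re \<omega>" using \<open>Re \<omega> \<ge> \<rho>\<close> rho by (intro mult_right_mono) auto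
  also have "\<dots> = \<bar>Re (of_int j * \<omega>)\<bar>" using \<open>Re \<omega> \<ge> \<rho>\<close> rho by (simp add: abs_mult)
  finally show ?thesis using assms \<open>Re \<omega> \<ge> \<rho>\<close> by simp
qed auto

lemma inj_on_k:
  assumes "U \<subseteq> D" "\<And>\<zeta> \<zeta>'. \<zeta> \<in> U \<Longrightarrow> \<zeta>' \<in> U \<Longrightarrow> \<bar>Re \<zeta>' - Re \<zeta>\<bar> < \<rho>"
  shows "inj_on k U"
proof (rule inj_onI)
  fix \<zeta> \<zeta>' assume z: "\<zeta> \<in> U" "\<zeta>' \<in> U" "k \<zeta> = k \<zeta>'"
  then obtain j where j: "\<zeta>' = \<zeta> + of_int j * \<omega>" using fibre assms(1) by blast
  then have "of_int j * \<omega> = 0" using assms(2)[OF z(1,2)] by (intro period_zero) auto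
  then show "\<zeta> = \<zeta>'" using j by simp
qed

lemma inj_on_k_S: "inj_on k S"
  by (rule inj_on_k[OF S_subset]) (auto simp: S_def)

lemma column:
  assumes "\<zeta> \<in> D" "k \<zeta> \<in> (\<Inter>t\<in>{0..}. \<phi> t ` unit_disc)"
  shows "\<zeta> + \<i> * of_real y \<in> D"
proof (cases "y \<ge> 0")
  case True
  then show ?thesis using up assms(1) by blast
next
  case False
  then obtain z where z: "cmod z < 1" "k \<zeta> = \<phi> (- y) z" using assms(2) by fastforce
  have "z \<in> k ` D"
  proof (rule ccontr)
    assume "z \<notin> k ` D"
    then have "k \<zeta> = z" using fixed_outside[of z "- y"] z False by simp
    then show False using \<open>z \<notin> k ` D\<close> assms(1) by blast
  qed
  then obtain \<zeta>1 where \<zeta>1: "\<zeta>1 \<in> D" "z = k \<zeta>1" by blast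
  have "k \<zeta> = k (\<zeta>1 + \<i> * of_real (- y))" using k_up[OF \<zeta>1(1), of "- y"] z(2) \<zeta>1(2) False by simp
  moreover have "\<zeta>1 + \<i> * of_real (- y) \<in> D" using up[OF \<zeta>1(1), of "- y"] False by simp
  ultimately obtain j where "\<zeta>1 + \<i> * of_real (- y) = \<zeta> + of_int j * \<omega>" using fibre assms(1) by blast
  then have "\<zeta> + \<i> * of_real y = \<zeta>1 + of_int (- j) * \<omega>" by (simp add: algebra_simps)
  then show ?thesis using period[OF \<zeta>1(1), of "- j"] by simp
qed

lemma not_column:
  assumes "b \<notin> D" "b + \<i> * of_real y \<in> D"
  shows "k (b + \<i> * of_real y) \<notin> (\<Inter>t\<in>{0..}. \<phi> t ` unit_disc)"
proof
  assume "k (b + \<i> * of_real y) \<in> (\<Inter>t\<in>{0..}. \<phi> t ` unit_disc)"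
  from column[OF assms(2) this, of "- y"] show False using assms(1) by simp
qed

lemma image_S_subset_Inter: "k ` S \<subseteq> (\<Inter>t\<in>{0..}. \<phi> t ` unit_disc)"
proof
  fix z assume "z \<in> k ` S"
  then obtain \<zeta> where \<zeta>: "\<zeta> \<in> S" "z = k \<zeta>" by blast
  have "z \<in> \<phi> t ` unit_disc" if "t \<ge> 0" for t
  proof -
    have "\<zeta> - \<i> * of_real t \<in> D" using \<zeta>(1) by (intro strip_D) (simp add: S_def)
    then have "z = \<phi> t (k (\<zeta> - \<i> * of_real t))" using k_up[of "\<zeta> - \<i> * of_real t" t] that \<zeta>(2) by simp
    then show ?thesis using k_disc[OF \<open>\<zeta> - \<i> * of_real t \<in> D\<close>] by auto
  qed
  then show "z \<in> (\<Inter>t\<in>{0..}. \<phi> t ` unit_disc)" by auto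
qed

lemma open_image_S: "open (k ` S)"
  by (rule open_mapping_thm3[OF holomorphic_on_subset[OF hol_k S_subset] open_S inj_on_k_S])

lemma petal_image_S: "petal \<phi> (k ` S)"
proof -
  define I where "I = interior (\<Inter>t\<in>{0..}. \<phi> t ` unit_disc)"
  have "open I" by (simp add: I_def)
  have I_sub: "I \<subseteq> (\<Inter>t\<in>{0..}. \<phi> t ` unit_disc)" unfolding I_def by (rule interior_subset)
  have SI: "k ` S \<subseteq> I" unfolding I_def by (rule interior_maximal[OF image_S_subset_Inter open_image_S])
  have "0 \<in> S" using rho by (simp add: S_def)
  then have k0: "k 0 \<in> k ` S" by blast
  define C where "C = connected_component_set I (k 0)"
  have C_comp: "C \<in> components I" unfolding C_def using k0 SI by (intro componentsI) auto
  have "connected C" by (simp add: C_def)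
  have C_sub: "C \<subseteq> I" unfolding C_def by (rule connected_component_subset)
  have "connected (k ` S)"
    using holomorphic_on_imp_continuous_on[OF holomorphic_on_subset[OF hol_k S_subset]] connected_S
    by (rule connected_continuous_image)
  then have SC: "k ` S \<subseteq> C" unfolding C_def using k0 SI by (intro connected_component_maximal)
  have "C \<subseteq> k ` S"
  proof (rule ccontr)
    assume "\<not> C \<subseteq> k ` S"
    then have "C \<inter> frontier (k ` S) \<noteq> {}"
      using SC k0 by (intro connected_Int_frontier[OF \<open>connected C\<close>]) auto
    then obtain z where z: "z \<in> C" "z \<in> frontier (k ` S)" by blast
    have zn: "z \<notin> k ` S" using z(2) open_image_S by (simp add: frontier_def interior_open)
    have zc: "z \<in> closure (k ` S)" using z(2) by (simp add: frontier_def)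
    have "z \<in> I" using z(1) C_sub by blast
    then have "z \<in> \<phi> 0 ` unit_disc" using I_sub by blast
    then have zd: "cmod z < 1" using semigroup_0[OF sem] by auto
    show False
    proof (cases "z \<in> k ` D")
      case False
      obtain b where b: "b \<notin> D" using blocker_left[of 1] by auto
      obtain y where "b + \<i> * of_real y \<in> D" "k (b + \<i> * of_real y) \<in> I"
        using accumulate_outside[OF zd False \<open>open I\<close> \<open>z \<in> I\<close>] by blast
      then show False using not_column[OF b] I_sub by blast
    next
      case True
      then obtain \<zeta> where \<zeta>: "\<zeta> \<in> D" "z = k \<zeta>" by blast
      have "open (D \<inter> k -` I)"
        by (rule continuous_open_preimage[OF holomorphic_on_imp_continuous_on[OF hol_k] open_D \<open>open I\<close>])
      then obtain r0 where r0: "r0 > 0" "ball \<zeta> r0 \<subseteq> D \<inter> k -` I"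
        using \<zeta> \<open>z \<in> I\<close> by (meson IntI open_contains_ball vimageI)
      \<comment> \<open>The bound \<rho> / 2 makes the ball narrower than any nonzero period, so
        \<open>k\<close> is injective on it.\<close>
      define r where "r = min r0 (\<rho> / 2)"
      have r: "r > 0" "r \<le> r0" using r0 rho by (auto simp: r_def)
      have inj: "inj_on k (ball \<zeta> r)"
      proof (rule inj_on_k)
        show "ball \<zeta> r \<subseteq> D" using r0(2) r(2) subset_ball by blast
        fix u v assume "u \<in> ball \<zeta> r" "v \<in> ball \<zeta> r"
        then have "dist u v < 2 * r" using dist_triangle2[of u v \<zeta>] by (simp add: dist_commute)
        then have "cmod (v - u) < \<rho>" by (simp add: r_def dist_norm norm_minus_commute)
        then show "\<bar>Re v - Re u\<bar> < \<rho>" using abs_Re_le_cmod[of "v - u"] by simp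
      qed
      have "ball \<zeta> r \<subseteq> D" using r0(2) r(2) subset_ball by blast
      then have "open (k ` ball \<zeta> r)"
        using inj by (intro open_mapping_thm3 holomorphic_on_subset[OF hol_k]) auto
      moreover have "z \<in> k ` ball \<zeta> r" using \<zeta> r by auto
      ultimately have "k ` ball \<zeta> r \<inter> k ` S \<noteq> {}" using zc closure_iff_nhds_not_empty by blast
      then obtain y where y: "y \<in> k ` ball \<zeta> r" "y \<in> k ` S" by blast
      obtain u where u1: "u \<in> ball \<zeta> r" "y = k u" using y(1) by blast
      obtain s where u2: "s \<in> S" "y = k s" using y(2) by blast
      note u = u1(1) u2(1) trans[OF u2(2)[symmetric] u1(2)]
      then obtain j where j: "u = s + of_int j * \<omega>"
        using fibre[of s u] S_subset \<open>ball \<zeta> r \<subseteq> D\<close> by blast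
      \<comment> \<open>The abscissa of \<zeta> after moving it next to the strip by a period. It is
        outside the strip but within \<open>r\<close> of a point inside, hence within
        \<open>r\<close> of an edge, like the blocker on that side.\<close>
      define x where "x = Re (\<zeta> + of_int (- j) * \<omega>)"
      have "\<bar>x\<bar> \<ge> \<rho> / 2"
      proof (rule ccontr)
        assume "\<not> \<bar>x\<bar> \<ge> \<rho> / 2"
        then have "\<zeta> + of_int (- j) * \<omega> \<in> S" by (simp add: S_def x_def)
        moreover have "k (\<zeta> + of_int (- j) * \<omega>) = z" using k_period[OF \<zeta>(1), of "- j"] \<zeta>(2) by simp
        ultimately show False using zn by blast
      qed
      have "x - Re s = Re (\<zeta> - u)" by (simp add: x_def j)
      also have "\<bar>\<dots>\<bar> \<le> cmod (\<zeta> - u)" by (rule abs_Re_le_cmod)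
      also have "\<dots> < r" using u(1) by (simp add: dist_norm)
      finally have xs: "\<bar>x - Re s\<bar> < r" by simp
      have sS: "\<bar>Re s\<bar> < \<rho> / 2" using u(2) by (simp add: S_def)
      obtain b where b: "b \<notin> D" "\<bar>Re b - x\<bar> < r"
      proof (cases "x \<ge> 0")
        case True
        obtain b where "b \<notin> D" "\<rho> / 2 \<le> Re b" "Re b < \<rho> / 2 + r" using blocker_right[OF r(1)] by blast
        then show ?thesis using True \<open>\<bar>x\<bar> \<ge> \<rho> / 2\<close> xs sS by (intro that[of b]) auto
      next
        case False
        obtain b where "b \<notin> D" "- \<rho> / 2 - r < Re b" "Re b \<le> - \<rho> / 2" using blocker_left[OF r(1)] by blast
        then show ?thesis using False \<open>\<bar>x\<bar> \<ge> \<rho> / 2\<close> xs sS by (intro that[of b]) auto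
      qed
      define b' where "b' = b + of_int j * \<omega>"
      have "b' \<notin> D"
      proof
        assume "b' \<in> D"
        from period[OF this, of "- j"] show False using b(1) by (simp add: b'_def)
      qed
      define y where "y = Im \<zeta> - Im b'"
      have "\<zeta> - (b' + \<i> * of_real y) = of_real (x - Re b)"
        by (simp add: complex_eq_iff y_def x_def b'_def)
      then have "cmod (\<zeta> - (b' + \<i> * of_real y)) = \<bar>x - Re b\<bar>" by (simp only: norm_of_real)
      then have "b' + \<i> * of_real y \<in> ball \<zeta> r0" using b(2) r(2) by (simp add: dist_norm)
      then have "b' + \<i> * of_real y \<in> D" "k (b' + \<i> * of_real y) \<in> I" using r0(2) by auto
      then show False using not_column[OF \<open>b' \<notin> D\<close>] I_sub by blast
    qed
  qed
  then have "C = k ` S" using SC by blast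
  then show ?thesis using C_comp by (simp add: petal_def I_def)
qed

section \<open>The conformal map of the disc onto the strip, taking the real diameter to the
  axis\<close>

definition strip_map :: "complex \<Rightarrow> complex" where
  "strip_map v = \<i> * of_real (\<rho> / pi) * Ln ((1 + v) / (1 - v))"

definition strip_coord :: "complex \<Rightarrow> complex" where
  "strip_coord \<zeta> = (exp (- \<i> * of_real (pi / \<rho>) * \<zeta>) - 1) / (exp (- \<i> * of_real (pi / \<rho>) * \<zeta>) + 1)"

text \<open>Half the exponent of the multiplier exp (pi t / \<rho>): the translation with parameter
  tanh x multiplies the half-plane coordinate by exp (2 x).\<close>

definition rate :: real where "rate = pi / (2 * \<rho>)"

lemma half_plane_coord: "cmod v < 1 \<Longrightarrow> Re ((1 + v) / (1 - v)) > 0"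
  using Re_half_plane_cayley[of "- v"] by simp

lemma strip_map_S:
  assumes "cmod v < 1"
  shows "strip_map v \<in> S"
proof -
  have "\<bar>Im (Ln ((1 + v) / (1 - v)))\<bar> < pi / 2"
    by (rule Re_Ln_pos_lt_imp[OF half_plane_coord[OF assms]])
  then have "\<rho> / pi * \<bar>Im (Ln ((1 + v) / (1 - v)))\<bar> < \<rho> / pi * (pi / 2)"
    using rho by (intro mult_strict_left_mono) auto
  moreover have "\<bar>Re (strip_map v)\<bar> = \<rho> / pi * \<bar>Im (Ln ((1 + v) / (1 - v)))\<bar>"
  proof -
    have "Re (strip_map v) = - (\<rho> / pi * Im (Ln ((1 + v) / (1 - v))))"
      unfolding strip_map_def by (simp del: of_real_divide)
    then show ?thesis using rho by (simp only: abs_minus_cancel abs_mult) simp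
  qed
  ultimately show ?thesis by (simp add: S_def)
qed

lemma strip_map_holomorphic: "strip_map holomorphic_on unit_disc"
  unfolding strip_map_def
proof (intro holomorphic_intros)
  show "(1 + v) / (1 - v) \<notin> \<real>\<^sub>\<le>\<^sub>0" if "v \<in> unit_disc" for v
    using half_plane_coord[of v] that by (auto simp: complex_nonpos_Reals_iff simp del: Re_divide)
qed auto

lemma strip_coord_inverse:
  assumes "\<zeta> \<in> S"
  shows "cmod (strip_coord \<zeta>) < 1" "strip_map (strip_coord \<zeta>) = \<zeta>"
proof -
  define w where "w = - \<i> * of_real (pi / \<rho>) * \<zeta>"
  have "Im w = - (pi / \<rho> * Re \<zeta>)" by (simp add: w_def)
  moreover have "pi / \<rho> * \<bar>Re \<zeta>\<bar> < pi / \<rho> * (\<rho> / 2)"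
    using assms rho by (intro mult_strict_left_mono) (auto simp: S_def)
  ultimately have im: "\<bar>Im w\<bar> < pi / 2" using rho by (simp add: abs_mult)
  have "Re (exp w) > 0" using im by (simp add: Re_exp cos_gt_zero_pi abs_less_iff)
  note cay = norm_cayley_less_one[OF this]
  have "strip_coord \<zeta> = - ((1 - exp w) / (1 + exp w))"
  proof -
    have "(e - 1) / (e + 1) = - ((1 - e) / (1 + e))" for e :: complex
      unfolding minus_divide_left by (simp add: add.commute)
    then show ?thesis by (simp only: strip_coord_def w_def)
  qed
  then show "cmod (strip_coord \<zeta>) < 1" using cay(1) by simp
  have "(1 + strip_coord \<zeta>) / (1 - strip_coord \<zeta>) = exp w"
  proof -
    have "1 + strip_coord \<zeta> = 2 * exp w / (1 + exp w)" "1 - strip_coord \<zeta> = 2 / (1 + exp w)"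
      unfolding \<open>strip_coord \<zeta> = _\<close> using cay(2) by (simp_all add: field_simps)
    then show ?thesis using cay(2) by simp
  qed
  then have "strip_map (strip_coord \<zeta>) = \<i> * of_real (\<rho> / pi) * w"
    unfolding strip_map_def using im by (simp add: abs_less_iff)
  also have "\<dots> = \<zeta>" using rho by (simp add: w_def)
  finally show "strip_map (strip_coord \<zeta>) = \<zeta>" .
qed

lemma strip_map_inj: "inj_on strip_map unit_disc"
proof (rule inj_onI)
  fix v v' assume v: "v \<in> unit_disc" "v' \<in> unit_disc" "strip_map v = strip_map v'"
  have nz: "(1 + v) / (1 - v) \<noteq> 0" if "v \<in> unit_disc" for v :: complex
    using half_plane_coord[of v] that by auto
  have "Ln ((1 + v) / (1 - v)) = Ln ((1 + v') / (1 - v'))" using v(3) rho by (simp add: strip_map_def)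
  then have "exp (Ln ((1 + v) / (1 - v))) = exp (Ln ((1 + v') / (1 - v')))" by (rule arg_cong)
  then have "(1 + v) / (1 - v) = (1 + v') / (1 - v')"
    unfolding exp_Ln[OF nz[OF v(1)]] exp_Ln[OF nz[OF v(2)]] .
  moreover have "1 - v \<noteq> 0" "1 - v' \<noteq> 0" using v by auto
  ultimately show "v = v'" by (simp add: frac_eq_eq algebra_simps)
qed

lemma strip_map_image: "strip_map ` unit_disc = S"
proof
  show "strip_map ` unit_disc \<subseteq> S" using strip_map_S by auto
  show "S \<subseteq> strip_map ` unit_disc"
  proof
    fix \<zeta> assume "\<zeta> \<in> S"
    from strip_coord_inverse[OF this] show "\<zeta> \<in> strip_map ` unit_disc"
      by (intro image_eqI[of _ _ "strip_coord \<zeta>"]) auto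
  qed
qed

text \<open>In the half-plane coordinate (1 + v) / (1 - v) the translation is multiplication by the
  positive number \<open>E\<close>, which the logarithm turns into an addition.\<close>

lemma strip_map_translation:
  assumes "cmod v < 1"
  shows "strip_map (mob (of_real (tanh (rate * t))) v) = strip_map v + \<i> * of_real t"
proof -
  define \<tau> where "\<tau> = tanh (rate * t)"
  define E where "E = exp (2 * (rate * t))"
  have "E > 0" by (simp add: E_def)
  have \<tau>: "\<tau> = (E - 1) / (E + 1)" by (simp add: \<tau>_def E_def tanh_exp_double)
  have "\<bar>\<tau>\<bar> < 1" by (simp add: \<tau>_def tanh_real_abs_less_1)
  have p: "1 + \<tau> = 2 * E / (E + 1)" "1 - \<tau> = 2 / (E + 1)" using \<open>E > 0\<close> unfolding \<tau> by (simp_all add: field_simps)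
  have nz: "1 + of_real \<tau> * v \<noteq> 0" using mob_denom_nonzero[of "of_real \<tau>" v] assms \<open>\<bar>\<tau>\<bar> < 1\<close> by simp
  have v1: "1 - v \<noteq> 0" using assms by auto
  have mv: "mob (of_real \<tau>) v = (v + of_real \<tau>) / (1 + of_real \<tau> * v)" by (simp add: mob_def)
  have q: "1 + x / d = (d + x) / d" "1 - x / d = (d - x) / d" if "d \<noteq> 0" for x d :: complex
    using that by (simp_all add: add_divide_distrib diff_divide_distrib)
  have "(1 + of_real \<tau> * v) + (v + of_real \<tau>) = of_real (1 + \<tau>) * (1 + v)"
    "(1 + of_real \<tau> * v) - (v + of_real \<tau>) = of_real (1 - \<tau>) * (1 - v)"
    by (simp_all add: algebra_simps)
  then have "1 + mob (of_real \<tau>) v = of_real (1 + \<tau>) * (1 + v) / (1 + of_real \<tau> * v)"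
    and "1 - mob (of_real \<tau>) v = of_real (1 - \<tau>) * (1 - v) / (1 + of_real \<tau> * v)"
    unfolding mv q[OF nz] by (simp_all only:)
  then have "(1 + mob (of_real \<tau>) v) / (1 - mob (of_real \<tau>) v) = of_real ((1 + \<tau>) / (1 - \<tau>)) * ((1 + v) / (1 - v))"
    using nz by simp
  also have "(1 + \<tau>) / (1 - \<tau>) = E" unfolding p using \<open>E > 0\<close> by simp
  finally have "(1 + mob (of_real \<tau>) v) / (1 - mob (of_real \<tau>) v) = of_real E * ((1 + v) / (1 - v))" .
  moreover have "Ln (of_real E * ((1 + v) / (1 - v))) = of_real (ln E) + Ln ((1 + v) / (1 - v))"
    using half_plane_coord[OF assms] \<open>E > 0\<close> by (subst Ln_times_of_real) (auto simp: Ln_of_real)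
  ultimately have "strip_map (mob (of_real \<tau>) v) = strip_map v + \<i> * of_real (\<rho> / pi * ln E)"
    unfolding strip_map_def by (simp add: algebra_simps)
  moreover have "\<rho> / pi * ln E = t" using rho by (simp add: E_def rate_def)
  ultimately show ?thesis by (simp only: \<tau>_def)
qed

end

sublocale petal_chart \<subseteq> linearized_petal \<phi> "k ` S" "k \<circ> strip_map" rate
proof
  show "holomorphic_semigroup \<phi>" by (rule sem)
  show "petal \<phi> (k ` S)" by (rule petal_image_S)
  show "(k \<circ> strip_map) holomorphic_on unit_disc"
    by (rule holomorphic_on_compose_gen[OF strip_map_holomorphic holomorphic_on_subset[OF hol_k S_subset]])
      (simp add: strip_map_image)
  show "inj_on (k \<circ> strip_map) unit_disc"
    using strip_map_inj inj_on_k_S strip_map_image by (auto intro: comp_inj_on)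
  show "(k \<circ> strip_map) ` unit_disc = k ` S" unfolding image_comp[symmetric] strip_map_image ..
  show "rate > 0" using rho by (simp add: rate_def)
  show "\<phi> t ((k \<circ> strip_map) v) = (k \<circ> strip_map) (mob (of_real (tanh (rate * t))) v)"
    if "t \<ge> 0" "cmod v < 1" for t v
    using strip_map_translation[OF that(2)] k_up[of "strip_map v" t] strip_map_S[OF that(2)] S_subset that(1)
    by auto
qed

context petal_chart
begin

lemma hyperbolic_petal_image_S: "hyperbolic_petal \<phi> (k ` S)"
  unfolding hyperbolic_petal_def using petal_image_S repelling_rep_pt by blast

lemma repelling_spectral_value_rep_pt: "repelling_spectral_value \<phi> rep_pt (- pi / \<rho>)"
  using repelling_rep_pt(1) rho by (simp add: rate_def)

end

section \<open>Uniqueness of the repelling fixed point\<close>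

lemma Re_csqrt_pos: "z \<notin> \<real>\<^sub>\<le>\<^sub>0 \<Longrightarrow> Re (csqrt z) > 0"
proof (rule ccontr)
  assume z: "z \<notin> \<real>\<^sub>\<le>\<^sub>0" and "\<not> Re (csqrt z) > 0"
  then have "Re (csqrt z) = 0" using csqrt_principal[of z] by auto
  then have "z = - of_real ((Im (csqrt z))\<^sup>2)"
    using power2_csqrt[of z] by (metis complex_eq_iff Re_power2 Im_power2 diff_0 mult_zero_left mult_zero_right of_real_minus
        Re_complex_of_real Im_complex_of_real power_zero_numeral zero_complex.simps)
  then show False using z by (metis neg_le_0_iff_le nonpos_Reals_of_real_iff of_real_minus zero_le_power2)
qed

context petal_chart
begin

lemma not_below:
  assumes "b \<notin> D" "w \<in> D" "s \<ge> 0"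
  shows "w \<noteq> b - \<i> * of_real s"
proof
  assume "w = b - \<i> * of_real s"
  then have "b = w + \<i> * of_real s" by simp
  then show False using up[OF assms(2,3)] assms(1) by simp
qed

text \<open>Away from the edges, a point of the strip is an integer translate of a point of the
  compact rectangle \<open>K\<close>. It is thus at bounded hyperbolic distance from the orbit point
  with that index, and shares its limit.\<close>

lemma strip_points_tendsto_rep_pt:
  assumes w: "\<And>n. \<bar>Re (w n)\<bar> \<le> \<rho>'" and \<rho>': "\<rho>' < \<rho> / 2"
    and im: "filterlim (\<lambda>n. Im (w n)) at_bot sequentially"
  shows "(\<lambda>n. k (w n)) \<longlonglongrightarrow> rep_pt"
proof -
  define K where "K = {\<zeta>. \<bar>Re \<zeta>\<bar> \<le> \<rho>' \<and> - 1 \<le> Im \<zeta> \<and> Im \<zeta> \<le> 0}"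
  have "closed K" unfolding K_def by (intro closed_Collect_conj closed_Collect_le continuous_intros)
  moreover have "bounded K"
  proof (rule boundedI)
    fix \<zeta> assume "\<zeta> \<in> K"
    then show "cmod \<zeta> \<le> \<rho>' + 1" using cmod_le[of \<zeta>] by (auto simp: K_def)
  qed
  ultimately have "compact K" by (simp add: compact_eq_bounded_closed)
  have KS: "K \<subseteq> S" using \<rho>' by (auto simp: K_def S_def)
  have cont: "continuous_on K (\<lambda>\<zeta>. cmod (strip_coord \<zeta>))"
    unfolding strip_coord_def
  proof (intro continuous_intros ballI)
    fix \<zeta> assume "\<zeta> \<in> K"
    then have \<zeta>: "\<bar>Re \<zeta>\<bar> < \<rho> / 2" using KS by (auto simp: S_def)
    have "pi / \<rho> * \<bar>Re \<zeta>\<bar> < pi / \<rho> * (\<rho> / 2)" using \<zeta> rho by (intro mult_strict_left_mono) auto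
    then have im: "\<bar>Im (- \<i> * of_real (pi / \<rho>) * \<zeta>)\<bar> < pi / 2" using rho by (simp add: abs_mult)
    have "Re (exp W) > 0" if "\<bar>Im W\<bar> < pi / 2" for W
      using that by (simp add: Re_exp cos_gt_zero_pi abs_less_iff)
    from this[OF im] show "exp (- \<i> * of_real (pi / \<rho>) * \<zeta>) + 1 \<noteq> 0"
      using norm_cayley_less_one(2) by (metis add.commute)
  qed
  obtain r where r: "r < 1" "\<And>\<zeta>. \<zeta> \<in> K \<Longrightarrow> cmod (strip_coord \<zeta>) \<le> r"
  proof (cases "K = {}")
    case True
    then show ?thesis using that[of 0] by simp
  next
    case False
    obtain \<zeta>0 where "\<zeta>0 \<in> K" "\<And>\<zeta>. \<zeta> \<in> K \<Longrightarrow> cmod (strip_coord \<zeta>) \<le> cmod (strip_coord \<zeta>0)"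
      using continuous_attains_sup[OF \<open>compact K\<close> False cont] by blast
    then show ?thesis using that strip_coord_inverse(1) KS by blast
  qed
  define m where "m = (\<lambda>n. nat \<lfloor>- Im (w n)\<rfloor>)"
  have ev0: "\<forall>\<^sub>F n in sequentially. Im (w n) \<le> 0" using im by (auto simp: filterlim_at_bot)
  have mlim: "filterlim m at_top sequentially"
    unfolding filterlim_at_top
  proof
    fix Z :: nat
    have "\<forall>\<^sub>F n in sequentially. Im (w n) \<le> - real Z" using im by (auto simp: filterlim_at_bot)
    then show "\<forall>\<^sub>F n in sequentially. Z \<le> m n"
      by eventually_elim (simp add: m_def le_nat_iff le_floor_iff)
  qed
  have ol: "(\<lambda>n. orb (m n)) \<longlonglongrightarrow> rep_pt" by (rule filterlim_compose[OF orb_tendsto mlim])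
  have "(\<lambda>n. (1 - (cmod (orb (m n)))\<^sup>2) / (1 - r)) \<longlonglongrightarrow> (1 - (cmod rep_pt)\<^sup>2) / (1 - r)"
    using r(1) by (intro tendsto_intros ol) auto
  then have lim0: "(\<lambda>n. (1 - (cmod (orb (m n)))\<^sup>2) / (1 - r)) \<longlonglongrightarrow> 0" by (simp add: norm_rep_pt)
  have "(\<lambda>n. k (w n) - orb (m n)) \<longlonglongrightarrow> 0"
  proof (rule Lim_null_comparison[OF _ lim0])
    show "\<forall>\<^sub>F n in sequentially. cmod (k (w n) - orb (m n)) \<le> (1 - (cmod (orb (m n)))\<^sup>2) / (1 - r)"
      using ev0
    proof eventually_elim
      case (elim n)
      define \<zeta> where "\<zeta> = w n + \<i> * of_real (real (m n))"
      have "real (m n) = of_int \<lfloor>- Im (w n)\<rfloor>" using elim by (simp add: m_def)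
      then have "- 1 \<le> Im \<zeta>" "Im \<zeta> \<le> 0" unfolding \<zeta>_def by (simp_all; linarith)+
      then have \<zeta>K: "\<zeta> \<in> K" using w[of n] by (simp add: K_def \<zeta>_def)
      then have \<zeta>S: "\<zeta> \<in> S" using KS by blast
      define v where "v = strip_coord \<zeta>"
      have v: "cmod v < 1" "strip_map v = \<zeta>" using strip_coord_inverse[OF \<zeta>S] by (auto simp: v_def)
      have "strip_map (M (- real (m n)) v) = strip_map v + \<i> * of_real (- real (m n))"
        unfolding M_def by (rule strip_map_translation[OF v(1)])
      then have "strip_map (M (- real (m n)) v) = w n" unfolding v(2) by (simp add: \<zeta>_def)
      then have "mob (orb (m n)) (G (m n) v) = k (w n)" using mob_orb_G[OF v(1)] by simp
      moreover have "cmod (G (m n) v) \<le> r" using G_le[OF v(1), of "m n"] r(2)[OF \<zeta>K] by (simp add: v_def)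
      ultimately show ?case using mob_dist_le[OF orb_disc, of "G (m n) v" r "m n"] r(1) by simp
    qed
  qed
  from tendsto_add[OF this ol] show ?thesis by simp
qed

text \<open>The radial sequence is chosen such that \<phi> 1 moves each point back approximately to
  its predecessor. In Koenigs coordinates \<phi> 1 is addition of \<i>, so the steps are close to -
  \<i> provided that hyperbolically small means small in the coordinate; the two-sided control of
  the distance to the complement of \<open>D\<close> ensures this.\<close>

lemma radial_koenigs_coordinates:
  assumes rep: "repelling_fixed_point \<phi> \<sigma>"
    and \<delta>: "\<delta> > 0" and l: "l holomorphic_on (unit_disc \<inter> ball \<sigma> \<delta>)"
    and lD: "\<And>z. z \<in> unit_disc \<inter> ball \<sigma> \<delta> \<Longrightarrow> l z \<in> D" and kl: "\<And>z. z \<in> unit_disc \<inter> ball \<sigma> \<delta> \<Longrightarrow> k (l z) = z"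
  obtains x :: "nat \<Rightarrow> real" and c1 where "\<And>n. 0 < x n" "\<And>n. x n \<le> 1" "x \<longlonglongrightarrow> 0" "c1 > 0"
    "\<forall>\<^sub>F n in sequentially. \<forall>b. b \<notin> D \<longrightarrow> c1 \<le> cmod (l (of_real (1 - x n) * \<sigma>) - b)"
    "(\<lambda>n. l (of_real (1 - x (Suc n)) * \<sigma>) - l (of_real (1 - x n) * \<sigma>)) \<longlonglongrightarrow> - \<i>"
proof -
  have \<sigma>: "cmod \<sigma> = 1" using rep by (simp add: repelling_fixed_point_def)
  obtain q where q: "q < 0" and qd: "\<And>t. t \<ge> 0 \<Longrightarrow> has_angular_limit (deriv (\<phi> t)) \<sigma> (of_real (exp (- q * t)))"
    using rep by (auto simp: repelling_fixed_point_def repelling_spectral_value_def)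
  have qf: "\<And>t. t \<ge> 0 \<Longrightarrow> has_angular_limit (\<phi> t) \<sigma> \<sigma>" using rep by (simp add: repelling_fixed_point_def)
  have rad: "((\<lambda>x. (\<sigma> - \<phi> t (of_real (1 - x) * \<sigma>)) / of_real x) \<longlongrightarrow> of_real (exp (- q * t)) * \<sigma>) (at_right 0)"
    if "t \<ge> 0" for t
    using angular_derivative_radial[OF semigroup_holomorphic[OF sem that] \<sigma> qf[OF that] qd[OF that]] .
  define \<alpha> where "\<alpha> = exp (- q)"
  have \<alpha>: "\<alpha> > 1" using q by (simp add: \<alpha>_def)
  \<comment> \<open>The ratio is the inverse multiplier of \<phi> 1 at \<sigma>: to first order
    \<phi> 1 maps the point at distance x (n + 1) to the point at distance x n.\<close>
  define x where "x = (\<lambda>n. (1 / \<alpha>) ^ n)"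
  have x0: "0 < x n" and x1: "x n \<le> 1" for n using \<alpha> by (simp_all add: x_def power_le_one)
  have xlim: "x \<longlonglongrightarrow> 0" unfolding x_def using \<alpha> by (intro LIMSEQ_realpow_zero) auto
  have xSuc: "x (Suc n) = 1 / \<alpha> * x n" for n by (simp add: x_def)
  define z where "z = (\<lambda>n. complex_of_real (1 - x n) * \<sigma>)"
  have nz: "cmod (z n) = 1 - x n" for n using x0[of n] x1[of n] \<sigma> by (simp only: z_def norm_mult norm_of_real) simp
  have zd: "cmod (z n) < 1" for n using nz[of n] x0[of n] by simp
  have z\<sigma>: "cmod (z n - \<sigma>) = x n" for n
  proof -
    have "z n - \<sigma> = of_real (- x n) * \<sigma>" by (simp add: z_def algebra_simps)
    then show ?thesis using x0[of n] \<sigma> by (simp add: norm_mult)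
  qed
  define f where "f = \<phi> 1"
  have fd: "cmod (f y) < 1" if "cmod y < 1" for y using semigroup_norm_less_one[OF sem _ that] by (simp add: f_def)
  define e where "e = (\<lambda>n. (\<sigma> - f (z n)) / of_real (x n))"
  have xr: "filterlim x (at_right 0) sequentially"
    using xlim by (auto simp: filterlim_at x0 less_imp_neq[OF x0, symmetric])
  have elim: "e \<longlonglongrightarrow> of_real \<alpha> * \<sigma>"
    using filterlim_compose[OF rad[of 1] xr] by (simp add: e_def z_def f_def \<alpha>_def)
  have fz: "f (z n) = \<sigma> - of_real (x n) * e n" for n using x0[of n] by (simp add: e_def)
  define v where "v = (\<lambda>n. mob (- z n) (f (z n)))"
  define u where "u = (\<lambda>n. mob (- z n) (f (z (Suc n))))"
  define \<kappa> where "\<kappa> = (\<alpha> - 1) / (\<alpha> + 1)"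
  have \<kappa>: "0 < \<kappa>" "\<kappa> < 1" using \<alpha> by (auto simp: \<kappa>_def)
  have "v \<longlonglongrightarrow> of_real ((1 - 1 * \<alpha>) / (1 + 1 * \<alpha>)) * \<sigma>"
    using radial_rescaling_limit[OF \<sigma> _ _ x0 xlim elim, of 1] \<alpha> unfolding v_def fz unfolding z_def by simp
  then have "(\<lambda>n. cmod (v n)) \<longlonglongrightarrow> cmod (of_real ((1 - 1 * \<alpha>) / (1 + 1 * \<alpha>)) * \<sigma>)" by (rule tendsto_norm)
  also have "cmod (of_real ((1 - 1 * \<alpha>) / (1 + 1 * \<alpha>)) * \<sigma>) = \<kappa>"
    unfolding norm_mult norm_of_real \<sigma> using \<alpha> by (simp add: \<kappa>_def abs_divide add.commute)
  finally have vlim: "(\<lambda>n. cmod (v n)) \<longlonglongrightarrow> \<kappa>" .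
  have "u \<longlonglongrightarrow> of_real ((1 - 1 / \<alpha> * \<alpha>) / (1 + 1 / \<alpha> * \<alpha>)) * \<sigma>"
  proof -
    have "(\<lambda>n. e (Suc n)) \<longlonglongrightarrow> of_real \<alpha> * \<sigma>" using elim by (rule LIMSEQ_Suc)
    from radial_rescaling_limit[OF \<sigma> _ _ x0 xlim this, of "1 / \<alpha>"] show ?thesis
      using \<alpha> unfolding u_def fz xSuc unfolding z_def by simp
  qed
  then have ulim: "(\<lambda>n. cmod (u n)) \<longlonglongrightarrow> 0" using \<alpha> tendsto_norm_zero by force
  \<comment> \<open>\<kappa>, r1, r, 1 are equally spaced: \<open>v n\<close> and \<open>u n\<close>
    eventually have modulus below r1, and the lift is defined on the larger disc of radius
    r.\<close>
  define r1 where "r1 = (1 + 2 * \<kappa>) / 3"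
  define r where "r = (2 + \<kappa>) / 3"
  have r: "\<kappa> < r1" "0 < r1" "r1 < r" "r < 1" using \<kappa> by (auto simp: r1_def r_def)
  define N where "N = unit_disc \<inter> ball \<sigma> \<delta>"
  define w where "w = (\<lambda>n. l (z n))"
  have mobN: "\<forall>\<^sub>F n in sequentially. \<forall>y. cmod y < r \<longrightarrow> mob (z n) y \<in> N"
  proof -
    have "(\<lambda>n. (1 - (1 - x n)\<^sup>2) / (1 - r) + x n) \<longlonglongrightarrow> (1 - (1 - 0)\<^sup>2) / (1 - r) + 0"
      using r by (intro tendsto_intros xlim) auto
    then have "\<forall>\<^sub>F n in sequentially. (1 - (1 - x n)\<^sup>2) / (1 - r) + x n < \<delta>"
      using \<delta> by (intro order_tendstoD(2)) auto
    then show ?thesis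
    proof eventually_elim
      case (elim n)
      show ?case
      proof (intro allI impI)
        fix y assume y: "cmod y < r"
        have "cmod (mob (z n) y - z n) \<le> (1 - (1 - x n)\<^sup>2) / (1 - r)"
          using mob_dist_le[OF zd[of n], of y r] y r unfolding nz by simp
        moreover have "cmod (mob (z n) y - \<sigma>) \<le> cmod (mob (z n) y - z n) + cmod (z n - \<sigma>)"
          using norm_triangle_ineq[of "mob (z n) y - z n" "z n - \<sigma>"] by simp
        ultimately have "cmod (mob (z n) y - \<sigma>) < \<delta>" using elim z\<sigma>[of n] by linarith
        moreover have "cmod (mob (z n) y) < 1" using y r by (intro norm_mob_less_one zd) auto
        ultimately show "mob (z n) y \<in> N" by (simp add: N_def dist_norm norm_minus_commute)
      qed
    qed
  qed
  have zN: "z n \<in> N" if "\<forall>y. cmod y < r \<longrightarrow> mob (z n) y \<in> N" for n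
    using spec[OF that, of 0] r by simp
  have ev_v: "\<forall>\<^sub>F n in sequentially. cmod (v n) < r1" "\<forall>\<^sub>F n in sequentially. cmod (v n) > \<kappa> / 2"
    using order_tendstoD(2)[OF vlim r(1)] order_tendstoD(1)[OF vlim, of "\<kappa> / 2"] \<kappa> by auto
  have ev_u: "\<forall>\<^sub>F n in sequentially. cmod (u n) < r1" by (rule order_tendstoD(2)[OF ulim r(2)])
  have fv: "f (z n) = mob (z n) (v n)" for n unfolding v_def by (rule mob_mob_minus[OF zd fd[OF zd], symmetric])
  have fu: "f (z (Suc n)) = mob (z n) (u n)" for n unfolding u_def by (rule mob_mob_minus[OF zd fd[OF zd], symmetric])
  \<comment> \<open>Both l (\<phi> t (z n)) and w n + \<i> t are coordinates of the same point and
    differ by a period. The difference is continuous in t and 0 at t = 0, hence 0; Julia's lemma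
    keeps the path in the domain of the lift up to t = 1.\<close>
  have lift_step: "\<forall>\<^sub>F n in sequentially. l (f (z n)) = w n + \<i>"
  proof -
    have "(\<lambda>n. 2 * \<alpha> * x n) \<longlonglongrightarrow> 2 * \<alpha> * 0" by (intro tendsto_intros xlim)
    then have "\<forall>\<^sub>F n in sequentially. 2 * \<alpha> * x n < \<delta>" using \<delta> by (intro order_tendstoD(2)) auto
    then show ?thesis
    proof eventually_elim
      case (elim n)
      have inN: "\<phi> t (z n) \<in> N" if t: "t \<in> {0..1}" for t
      proof -
        have "cmod (\<phi> t (z n) - \<sigma>) \<le> 2 * exp (- q * t) * x n"
          unfolding z_def
        proof (rule julia_radial)
          show "\<phi> t holomorphic_on unit_disc" using t by (intro semigroup_holomorphic[OF sem]) auto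
          show "cmod (\<phi> t y) < 1" if "cmod y < 1" for y using t that by (intro semigroup_norm_less_one[OF sem]) auto
          show "((\<lambda>x. (\<sigma> - \<phi> t (of_real (1 - x) * \<sigma>)) / of_real x) \<longlongrightarrow> of_real (exp (- q * t)) * \<sigma>) (at_right 0)"
            using t by (intro rad) auto
        qed (use \<sigma> x0 x1 in auto)
        also have "2 * exp (- q * t) * x n \<le> 2 * \<alpha> * x n"
        proof -
          have "- q * t \<le> - q * 1" using t q by (intro mult_left_mono) auto
          then have "exp (- q * t) \<le> \<alpha>" by (simp add: \<alpha>_def)
          then show ?thesis using x0[of n] by (intro mult_right_mono mult_left_mono) auto
        qed
        finally have "cmod (\<phi> t (z n) - \<sigma>) < \<delta>" using elim by simp
        moreover have "cmod (\<phi> t (z n)) < 1" using t by (intro semigroup_norm_less_one[OF sem] zd) auto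
        ultimately show ?thesis by (simp add: N_def dist_norm norm_minus_commute)
      qed
      have "\<phi> 0 (z n) = z n" by (rule semigroup_0[OF sem zd])
      then have "z n \<in> N" using inN[of 0] by simp
      then have wD: "w n \<in> D" "k (w n) = z n" using lD kl by (auto simp: w_def N_def)
      define \<theta> where "\<theta> = (\<lambda>t. l (\<phi> t (z n)) - (w n + \<i> * of_real t))"
      have disc: "\<exists>j::int. \<theta> t = of_int j * \<omega>" if t: "t \<in> {0..1}" for t
      proof -
        have "k (l (\<phi> t (z n))) = \<phi> t (z n)" using kl inN[OF t] by (simp add: N_def)
        also have "\<dots> = k (w n + \<i> * of_real t)" using k_up[OF wD(1), of t] wD(2) t by simp
        finally have "k (w n + \<i> * of_real t) = k (l (\<phi> t (z n)))" ..
        then obtain j where "l (\<phi> t (z n)) = w n + \<i> * of_real t + of_int j * \<omega>"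
          using fibre[OF up[OF wD(1)]] lD inN[OF t] t by (metis N_def atLeastAtMost_iff)
        then show ?thesis by (auto simp: \<theta>_def)
      qed
      have "\<theta> constant_on {0..1}"
      proof (rule continuous_discrete_range_constant)
        have "continuous_on {0..1} (\<lambda>t. \<phi> t (z n))"
          unfolding continuous_on_def
        proof
          fix s :: real assume s: "s \<in> {0..1}"
          have "\<forall>s\<ge>0. \<forall>K. compact K \<and> K \<subseteq> unit_disc \<longrightarrow> uniform_limit K \<phi> (\<phi> s) (at s within {0..})"
            using sem unfolding holomorphic_semigroup_def by (elim conjE)
          from this[rule_format, of s "{z n}"]
          have "((\<lambda>t. \<phi> t (z n)) \<longlongrightarrow> \<phi> s (z n)) (at s within {0..})"
            using s zd[of n] by simp
          then show "((\<lambda>t. \<phi> t (z n)) \<longlongrightarrow> \<phi> s (z n)) (at s within {0..1})"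
            by (rule tendsto_within_subset) auto
        qed
        then have "continuous_on {0..1} (\<lambda>t. l (\<phi> t (z n)))"
          using inN by (intro continuous_on_compose2[OF holomorphic_on_imp_continuous_on[OF l]]) (auto simp: N_def)
        then show "continuous_on {0..1} \<theta>" unfolding \<theta>_def by (intro continuous_intros)
        fix t :: real assume t: "t \<in> {0..1}"
        \<comment> \<open>Different multiples of \<omega> are at least |\<omega>| apart. For
          \<omega> = 0 there are no different values, and 1 is an arbitrary positive
          constant.\<close>
        have sep: "(if \<omega> = 0 then 1 else cmod \<omega>) \<le> cmod (\<theta> s - \<theta> t)" if s: "s \<in> {0..1}" "\<theta> s \<noteq> \<theta> t" for s
        proof -
          obtain i j :: int where ij: "\<theta> s = of_int i * \<omega>" "\<theta> t = of_int j * \<omega>" using disc s(1) t by metis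
          then have "\<theta> s - \<theta> t = of_int (i - j) * \<omega>" by (simp add: algebra_simps)
          then have eq: "cmod (\<theta> s - \<theta> t) = \<bar>of_int (i - j)\<bar> * cmod \<omega>" by (simp only: norm_mult norm_of_int)
          have "i \<noteq> j" "\<omega> \<noteq> 0" using ij s(2) by auto
          then have "(1::real) \<le> \<bar>of_int (i - j)\<bar>" by linarith
          then have "1 * cmod \<omega> \<le> \<bar>of_int (i - j)\<bar> * cmod \<omega>" by (intro mult_right_mono) auto
          then show ?thesis unfolding eq using \<open>\<omega> \<noteq> 0\<close> by simp
        qed
        then show "\<exists>\<epsilon>>0. \<forall>s. s \<in> {0..1} \<and> \<theta> s \<noteq> \<theta> t \<longrightarrow> \<epsilon> \<le> cmod (\<theta> s - \<theta> t)"
          by (intro exI[of _ "if \<omega> = 0 then 1 else cmod \<omega>"]) auto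
      qed simp
      then have "\<theta> 1 = \<theta> 0" by (auto simp: constant_on_def)
      also have "\<theta> 0 = 0" using \<open>\<phi> 0 (z n) = z n\<close> by (simp add: \<theta>_def w_def)
      finally show ?case by (simp add: \<theta>_def f_def)
    qed
  qed
  define Kc where "Kc = (r + r1) / (r - r1)"
  have Kc: "Kc > 0" using r by (simp add: Kc_def)
  \<comment> \<open>Below a point \<open>b\<close> off \<open>D\<close> a whole half-line is off
    \<open>D\<close>, so the lift maps into a slit plane, and the square root maps the slit plane to
    the right half-plane, where \<open>half_plane_schwarz\<close> applies.\<close>
  define h where "h = (\<lambda>n b y. csqrt (- \<i> * (l (mob (z n) y) - b)))"
  have hsq: "(h n b y)\<^sup>2 = - \<i> * (l (mob (z n) y) - b)" for n b y by (simp add: h_def)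
  have h_harnack: "cmod (h n b y) \<le> Kc * cmod (h n b 0)"
    and h_diff: "cmod (h n b y - h n b 0) \<le> cmod y / r * cmod (h n b y + cnj (h n b 0))"
    if ev: "\<forall>y. cmod y < r \<longrightarrow> mob (z n) y \<in> N" and b: "b \<notin> D" and y: "cmod y < r1" for n b y
  proof -
    have notin: "- \<i> * (l (mob (z n) y) - b) \<notin> \<real>\<^sub>\<le>\<^sub>0" if "cmod y < r" for y
      using slit_arg_bounds(1)[of "l (mob (z n) y)" b] not_below[OF b] lD ev that by (simp add: N_def)
    have pos: "Re (h n b y) > 0" if "cmod y < r" for y
      unfolding h_def by (rule Re_csqrt_pos[OF notin[OF that]])
    have "mob (z n) holomorphic_on ball 0 r"
      by (rule holomorphic_on_subset[OF holomorphic_mob]) (use zd[of n] r in auto)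
    then have "(l \<circ> mob (z n)) holomorphic_on ball 0 r"
      by (rule holomorphic_on_compose_gen[OF _ l]) (use ev in \<open>auto simp: N_def\<close>)
    then have hol: "h n b holomorphic_on ball 0 r"
      unfolding h_def o_def using notin by (intro holomorphic_intros) auto
    have yr: "cmod y < r" using y r by simp
    show "cmod (h n b y - h n b 0) \<le> cmod y / r * cmod (h n b y + cnj (h n b 0))"
      by (rule half_plane_schwarz(1)[OF hol pos yr])
    have "cmod (h n b y) \<le> (r + cmod y) / (r - cmod y) * cmod (h n b 0)"
      by (rule half_plane_schwarz(2)[OF hol pos yr])
    also have "(r + cmod y) / (r - cmod y) \<le> Kc"
      unfolding Kc_def using y r by (intro frac_le) auto
    finally show "cmod (h n b y) \<le> Kc * cmod (h n b 0)" by (simp add: mult_right_mono)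
  qed
  have h0: "(cmod (h n b 0))\<^sup>2 = cmod (w n - b)" for n b
    using hsq[of n b 0] by (simp add: norm_power[symmetric] norm_mult w_def)
  \<comment> \<open>By Harnack |w + \<i> - b| <= Kc^2 |w - b|, while the two distances add up to at
    least 1; \<open>c1\<close> is what remains for |w - b|.\<close>
  define c1 where "c1 = 1 / (1 + Kc\<^sup>2)"
  have c1: "c1 > 0" by (simp add: c1_def add_pos_nonneg)
  have lower: "\<forall>\<^sub>F n in sequentially. \<forall>b. b \<notin> D \<longrightarrow> c1 \<le> cmod (w n - b)"
    using mobN ev_v(1) lift_step
  proof eventually_elim
    case (elim n)
    show ?case
    proof (intro allI impI)
      fix b assume b: "b \<notin> D"
      have "(cmod (h n b (v n)))\<^sup>2 \<le> (Kc * cmod (h n b 0))\<^sup>2"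
        by (intro power_mono h_harnack[OF elim(1) b elim(2)]) auto
      also have "\<dots> = Kc\<^sup>2 * cmod (w n - b)" by (simp add: power_mult_distrib h0)
      finally have "(cmod (h n b (v n)))\<^sup>2 \<le> Kc\<^sup>2 * cmod (w n - b)" .
      moreover have "(cmod (h n b (v n)))\<^sup>2 = cmod (w n + \<i> - b)"
        using hsq[of n b "v n"] fv[of n] elim(3) by (simp add: norm_power[symmetric] norm_mult)
      moreover have "1 \<le> cmod (w n + \<i> - b) + cmod (w n - b)"
        using norm_triangle_ineq4[of "w n + \<i> - b" "w n - b"] by simp
      ultimately have "1 \<le> (1 + Kc\<^sup>2) * cmod (w n - b)" by (simp add: algebra_simps)
      moreover have "1 + Kc\<^sup>2 > 0" by (simp add: add_pos_nonneg)
      ultimately show "c1 \<le> cmod (w n - b)" unfolding c1_def by (simp add: pos_divide_le_eq mult.commute)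
    qed
  qed
  \<comment> \<open>If \<open>D\<close> contained the disc of radius 2 / \<kappa> around
    \<open>w n\<close>, the Schwarz lemma would give |v n| <= \<kappa> / 2, but |v n| tends to
    \<kappa>.\<close>
  define C where "C = 2 / \<kappa>"
  have C: "C > 0" using \<kappa> by (simp add: C_def)
  have upper: "\<forall>\<^sub>F n in sequentially. \<exists>b. b \<notin> D \<and> cmod (w n - b) < C"
    using mobN ev_v(2)
  proof eventually_elim
    case (elim n)
    show ?case
    proof (rule ccontr)
      assume "\<not> (\<exists>b. b \<notin> D \<and> cmod (w n - b) < C)"
      then have sub: "w n + of_real C * y \<in> D" if "cmod y < 1" for y
        using that C by (force simp: norm_mult)
      have wD: "w n \<in> D" "k (w n) = z n" using lD kl zN[OF elim(1)] by (auto simp: w_def N_def)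
      define F where "F = mob (- z n) \<circ> (k \<circ> (\<lambda>y. w n + of_real C * y))"
      have F: "F holomorphic_on unit_disc" unfolding F_def
      proof (rule holomorphic_on_compose_gen[where t = unit_disc])
        show "(k \<circ> (\<lambda>y. w n + of_real C * y)) holomorphic_on unit_disc"
          by (rule holomorphic_on_compose_gen[OF _ hol_k]) (use sub in \<open>auto intro!: holomorphic_intros\<close>)
        show "mob (- z n) holomorphic_on unit_disc" using zd[of n] by (intro holomorphic_mob) simp
      qed (use sub k_disc in auto)
      have "cmod (F (\<i> / of_real C)) \<le> cmod (\<i> / of_real C)"
      proof (rule Schwarz_Lemma(1)[OF F])
        show "F 0 = 0" by (simp add: F_def wD)
        show "cmod (F y) < 1" if "cmod y < 1" for y
          unfolding F_def o_def using k_disc[OF sub[OF that]] zd[of n] by (intro norm_mob_less_one) auto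
        show "cmod (\<i> / of_real C) < 1" using \<kappa> by (simp add: norm_mult norm_divide C_def)
      qed
      moreover have "F (\<i> / of_real C) = v n"
        using k_up[OF wD(1), of 1] wD(2) C by (simp add: F_def v_def f_def)
      ultimately have "cmod (v n) \<le> 1 / C" using C by (simp add: norm_divide)
      then show False using elim(2) by (simp add: C_def)
    qed
  qed
  have lift_Suc: "\<forall>\<^sub>F n in sequentially. l (f (z (Suc n))) = w (Suc n) + \<i>"
    using lift_step eventually_sequentially_Suc[of "\<lambda>n. l (f (z n)) = w n + \<i>"] by simp
  have diff0: "(\<lambda>n. w (Suc n) + \<i> - w n) \<longlonglongrightarrow> 0"
  proof (rule Lim_null_comparison)
    show "\<forall>\<^sub>F n in sequentially. cmod (w (Suc n) + \<i> - w n) \<le> cmod (u n) * ((Kc + 1)\<^sup>2 * C / r)"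
      using mobN ev_u lift_Suc upper
    proof eventually_elim
      case (elim n)
      obtain b where b: "b \<notin> D" "cmod (w n - b) < C" using elim(4) by blast
      define p where "p = cmod (h n b (u n))"
      define p0 where "p0 = cmod (h n b 0)"
      have p: "p \<le> Kc * p0" using h_harnack[OF elim(1) b(1) elim(2)] by (simp add: p_def p0_def)
      have p0C: "p0\<^sup>2 \<le> C" using h0[of n b] b(2) by (simp add: p0_def)
      have "p0 \<ge> 0" "p \<ge> 0" by (simp_all add: p0_def p_def)
      \<comment> \<open>The error of a step is a difference of two squares. One factor is at most a
        multiple of |u n|, and both are bounded because \<open>b\<close> was taken within distance
        \<open>C\<close>.\<close>
      have "(h n b (u n))\<^sup>2 - (h n b 0)\<^sup>2 = - \<i> * (w (Suc n) + \<i> - w n)"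
        unfolding hsq using fu[of n] elim(3) by (simp add: w_def algebra_simps)
      moreover have "(h n b (u n))\<^sup>2 - (h n b 0)\<^sup>2 = (h n b (u n) - h n b 0) * (h n b (u n) + h n b 0)"
        by (simp add: power2_eq_square algebra_simps)
      ultimately have "cmod (w (Suc n) + \<i> - w n) = cmod (h n b (u n) - h n b 0) * cmod (h n b (u n) + h n b 0)"
        by (metis mult_1 norm_ii norm_minus_cancel norm_mult)
      also have "\<dots> \<le> (cmod (u n) / r * (p + p0)) * (p + p0)"
      proof (intro mult_mono)
        have "cmod (h n b (u n) - h n b 0) \<le> cmod (u n) / r * cmod (h n b (u n) + cnj (h n b 0))"
          by (rule h_diff[OF elim(1) b(1) elim(2)])
        also have "\<dots> \<le> cmod (u n) / r * (p + p0)"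
          using norm_triangle_ineq[of "h n b (u n)" "cnj (h n b 0)"] r
          by (intro mult_left_mono) (auto simp: p_def p0_def)
        finally show "cmod (h n b (u n) - h n b 0) \<le> cmod (u n) / r * (p + p0)" .
        show "cmod (h n b (u n) + h n b 0) \<le> p + p0" unfolding p_def p0_def by (rule norm_triangle_ineq)
      qed (use r \<open>p0 \<ge> 0\<close> \<open>p \<ge> 0\<close> in auto)
      also have "\<dots> = cmod (u n) / r * (p + p0)\<^sup>2" by (simp add: power2_eq_square)
      also have "\<dots> \<le> cmod (u n) / r * ((Kc + 1)\<^sup>2 * C)"
      proof (intro mult_left_mono)
        have "(p + p0)\<^sup>2 \<le> ((Kc + 1) * p0)\<^sup>2"
          using p \<open>p0 \<ge> 0\<close> \<open>p \<ge> 0\<close> by (intro power_mono) (auto simp: algebra_simps)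
        also have "\<dots> = (Kc + 1)\<^sup>2 * p0\<^sup>2" by (rule power_mult_distrib)
        also have "\<dots> \<le> (Kc + 1)\<^sup>2 * C" using p0C by (intro mult_left_mono) auto
        finally show "(p + p0)\<^sup>2 \<le> (Kc + 1)\<^sup>2 * C" .
      qed (use r in auto)
      finally show ?case by simp
    qed
    show "(\<lambda>n. cmod (u n) * ((Kc + 1)\<^sup>2 * C / r)) \<longlonglongrightarrow> 0"
      by (rule tendsto_mult_left_zero[OF ulim])
  qed
  have steps: "(\<lambda>n. w (Suc n) - w n) \<longlonglongrightarrow> - \<i>"
    using tendsto_diff[OF diff0 tendsto_const[of \<i>]] by simp
  show thesis
    by (rule that[OF x0 x1 xlim c1]) (use lower steps in \<open>simp_all add: w_def z_def\<close>)
qed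

end

lemma Im_at_bot:
  assumes "(\<lambda>n. w n / of_nat n) \<longlonglongrightarrow> - \<i>"
  shows "filterlim (\<lambda>n. Im (w n)) at_bot sequentially"
  unfolding filterlim_at_bot
proof
  fix Z :: real
  have "(\<lambda>n. Im (w n / of_nat n)) \<longlonglongrightarrow> Im (- \<i>)" by (intro tendsto_Im assms)
  then have "\<forall>\<^sub>F n in sequentially. Im (w n / of_nat n) < - 1 / 2" by (intro order_tendstoD(2)) auto
  then show "\<forall>\<^sub>F n in sequentially. Im (w n) \<le> Z"
    using eventually_ge_at_top[of "nat \<lceil>2 * \<bar>Z\<bar>\<rceil> + 1"]
  proof eventually_elim
    case (elim n)
    then have n: "real n > 0" "real n \<ge> 2 * \<bar>Z\<bar>" by linarith+
    have "Im (w n / of_nat n) = Im (w n) / real n" by (metis Im_divide_of_nat)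
    then have "Im (w n) < - 1 / 2 * real n" using elim(1) n(1) by (simp add: pos_divide_less_eq)
    then show ?case using n(2) by linarith
  qed
qed

section \<open>Separation of the radial sequence from the strip by half-lines\<close>

context petal_chart
begin

lemma not_in_D_period: "b \<notin> D \<Longrightarrow> b + of_int j * \<omega> \<notin> D"
proof
  assume "b \<notin> D" "b + of_int j * \<omega> \<in> D"
  from period[OF this(2), of "- j"] this(1) show False by simp
qed

text \<open>The half-line below \<open>b\<close> is off \<open>D\<close>; its point at the height of
  \<open>w\<close> gives a purely horizontal distance.\<close>

lemma horizontal_distance:
  assumes far: "\<And>b. b \<notin> D \<Longrightarrow> c \<le> cmod (w - b)" and b: "b \<notin> D" "Im w \<le> Im b"
  shows "c \<le> \<bar>Re w - Re b\<bar>"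
proof -
  define b' where "b' = b - \<i> * of_real (Im b - Im w)"
  have "b' \<notin> D" using not_below[OF b(1), of b' "Im b - Im w"] b(2) by (auto simp: b'_def)
  then have "c \<le> cmod (w - b')" by (rule far)
  also have "w - b' = of_real (Re w - Re b)" by (simp add: b'_def complex_eq_iff)
  finally show ?thesis by (simp only: norm_of_real)
qed

text \<open>The half-line below a point of the complement of \<open>D\<close> lies in the complement, and the steps are too
  short to jump over it.\<close>

lemma eventually_one_side:
  assumes c1: "c1 > 0" and far: "\<forall>\<^sub>F n in sequentially. \<forall>b. b \<notin> D \<longrightarrow> c1 \<le> cmod (w n - b)"
    and steps: "(\<lambda>n. w (Suc n) - w n) \<longlonglongrightarrow> - \<i>" and b: "b \<notin> D"
  shows "(\<forall>\<^sub>F n in sequentially. Re (w n) \<le> Re b - c1) \<or> (\<forall>\<^sub>F n in sequentially. Re b + c1 \<le> Re (w n))"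
proof -
  have "\<forall>\<^sub>F n in sequentially. Im (w n) \<le> Im b"
    using Im_at_bot[OF cesaro_increments[OF steps]] by (auto simp: filterlim_at_bot)
  moreover have "\<forall>\<^sub>F n in sequentially. dist (w (Suc n) - w n) (- \<i>) < c1" using steps c1 by (rule tendstoD)
  ultimately have "\<forall>\<^sub>F n in sequentially. c1 \<le> \<bar>Re (w n) - Re b\<bar> \<and> \<bar>Re (w (Suc n)) - Re (w n)\<bar> < c1"
    using far
  proof eventually_elim
    case (elim n)
    have "\<bar>Re (w (Suc n) - w n + \<i>)\<bar> \<le> cmod (w (Suc n) - w n + \<i>)" by (rule abs_Re_le_cmod)
    then show ?case using horizontal_distance[of c1 "w n" b] elim b by (auto simp: dist_norm)
  qed
  then obtain N where N: "\<And>n. n \<ge> N \<Longrightarrow> c1 \<le> \<bar>Re (w n) - Re b\<bar>"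
    "\<And>n. n \<ge> N \<Longrightarrow> \<bar>Re (w (Suc n)) - Re (w n)\<bar> < c1"
    by (auto simp: eventually_sequentially)
  show ?thesis
  proof (cases "Re (w N) < Re b")
    case True
    have "Re (w n) < Re b" if "n \<ge> N" for n
      using that
    proof (induction n rule: dec_induct)
      case (step n)
      then show ?case using N(1)[of n] N(1)[of "Suc n"] N(2)[of n] by linarith
    qed (rule True)
    then have "Re (w n) \<le> Re b - c1" if "n \<ge> N" for n using N(1)[of n] that by fastforce
    then show ?thesis by (auto simp: eventually_sequentially)
  next
    case False
    have "Re (w n) \<ge> Re b" if "n \<ge> N" for n
      using that
    proof (induction n rule: dec_induct)
      case (step n)
      then show ?case using N(1)[of n] N(1)[of "Suc n"] N(2)[of n] by linarith
    qed (use False in simp)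
    then have "Re b + c1 \<le> Re (w n)" if "n \<ge> N" for n using N(1)[of n] that c1 by fastforce
    then show ?thesis by (auto simp: eventually_sequentially)
  qed
qed

lemma slit_arg_bounds_lift:
  assumes "l ` U \<subseteq> D" "b \<notin> D" "z \<in> U"
  shows "- \<i> * (l z - b) \<notin> \<real>\<^sub>\<le>\<^sub>0" "- pi \<le> slit_arg b (l z)" "slit_arg b (l z) \<le> pi"
    "Re b \<le> Re (l z) \<Longrightarrow> slit_arg b (l z) \<le> 0" "Re (l z) \<le> Re b \<Longrightarrow> slit_arg b (l z) \<ge> 0"
proof -
  have "l z \<noteq> b - \<i> * of_real s" if "s \<ge> 0" for s
    using not_below[OF assms(2) _ that] assms by blast
  note slit_arg_bounds[OF this]
  then show "- \<i> * (l z - b) \<notin> \<real>\<^sub>\<le>\<^sub>0" "- pi \<le> slit_arg b (l z)" "slit_arg b (l z) \<le> pi"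
    "Re b \<le> Re (l z) \<Longrightarrow> slit_arg b (l z) \<le> 0" "Re (l z) \<le> Re b \<Longrightarrow> slit_arg b (l z) \<ge> 0"
    by simp_all
qed

text \<open>A function whose log-modulus is \<open>slit_arg b (l z) - pi\<close>: it is near 0 far
  down on the left of the slit and at most - pi on the right of \<open>b\<close>. These are the two
  opposite bounds that \<open>lindelof_exclusion\<close> needs; \<open>slit_function_right\<close>
  is the mirror image.\<close>

lemma slit_function_left:
  assumes l: "l holomorphic_on U" and lD: "l ` U \<subseteq> D" and b: "b \<notin> D"
  obtains F where "F holomorphic_on U" "\<And>z. cmod (F z) = exp (slit_arg b (l z) - pi)"
    "\<And>z. z \<in> U \<Longrightarrow> cmod (F z) \<le> 1" "\<And>z. z \<in> U \<Longrightarrow> Re b \<le> Re (l z) \<Longrightarrow> cmod (F z) \<le> exp (- pi)"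
proof
  let ?F = "\<lambda>z. exp (- \<i> * Ln (- \<i> * (l z - b)) - of_real pi)"
  note sb = slit_arg_bounds_lift[OF lD b]
  show "?F holomorphic_on U" using sb(1) by (auto intro!: holomorphic_intros l)
  show nl: "cmod (?F z) = exp (slit_arg b (l z) - pi)" for z unfolding slit_arg_def by simp
  show "cmod (?F z) \<le> 1" if "z \<in> U" for z unfolding nl using sb(3)[OF that] by simp
  show "cmod (?F z) \<le> exp (- pi)" if "z \<in> U" "Re b \<le> Re (l z)" for z unfolding nl using sb(4)[OF that] by simp
qed

lemma slit_function_right:
  assumes l: "l holomorphic_on U" and lD: "l ` U \<subseteq> D" and b: "b \<notin> D"
  obtains F where "F holomorphic_on U" "\<And>z. cmod (F z) = exp (- slit_arg b (l z) - pi)"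
    "\<And>z. z \<in> U \<Longrightarrow> cmod (F z) \<le> 1" "\<And>z. z \<in> U \<Longrightarrow> Re (l z) \<le> Re b \<Longrightarrow> cmod (F z) \<le> exp (- pi)"
proof
  let ?F = "\<lambda>z. exp (\<i> * Ln (- \<i> * (l z - b)) - of_real pi)"
  note sb = slit_arg_bounds_lift[OF lD b]
  show "?F holomorphic_on U" using sb(1) by (auto intro!: holomorphic_intros l)
  show nl: "cmod (?F z) = exp (- slit_arg b (l z) - pi)" for z unfolding slit_arg_def by simp
  show "cmod (?F z) \<le> 1" if "z \<in> U" for z unfolding nl using sb(2)[OF that] by simp
  show "cmod (?F z) \<le> exp (- pi)" if "z \<in> U" "Re (l z) \<le> Re b" for z unfolding nl using sb(5)[OF that] by simp
qed

text \<open>The blockers are within c1 / 2 of the edges while the sequence stays c1 away from their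
  half-lines, so a sequence running between them is uniformly inside the strip. Ending on the other
  side of a blocker contradicts Lindelof. For nonzero \<omega> the assumption \<open>between\<close>
  fixes the branch of the lift.\<close>

lemma repelling_fixed_point_unique_aux:
  assumes \<sigma>: "cmod \<sigma> = 1" "\<sigma> \<in> closure (k ` S)"
    and \<delta>: "\<delta> > 0" and l: "l holomorphic_on (unit_disc \<inter> ball \<sigma> \<delta>)"
    and lD: "\<And>z. z \<in> unit_disc \<inter> ball \<sigma> \<delta> \<Longrightarrow> l z \<in> D" and kl: "\<And>z. z \<in> unit_disc \<inter> ball \<sigma> \<delta> \<Longrightarrow> k (l z) = z"
    and x: "\<And>n. 0 < x n" "\<And>n. x n \<le> 1" "x \<longlonglongrightarrow> 0" and c1: "c1 > 0"
    and w: "w = (\<lambda>n. l (of_real (1 - x n) * \<sigma>))"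
    and far: "\<forall>\<^sub>F n in sequentially. \<forall>b. b \<notin> D \<longrightarrow> c1 \<le> cmod (w n - b)"
    and steps: "(\<lambda>n. w (Suc n) - w n) \<longlonglongrightarrow> - \<i>"
    and bL: "bL \<notin> D" "- \<rho> / 2 - c1 / 2 < Re bL" "Re bL \<le> - \<rho> / 2"
    and bR: "bR \<notin> D" "\<rho> / 2 \<le> Re bR" "Re bR < \<rho> / 2 + c1 / 2"
    and between: "\<omega> \<noteq> 0 \<Longrightarrow> \<forall>\<^sub>F n in sequentially. Re bL < Re (w n) \<and> Re (w n) < Re (bL + \<omega>)"
  shows "\<sigma> = rep_pt"
proof -
  define U where "U = unit_disc \<inter> ball \<sigma> \<delta>"
  define z where "z = (\<lambda>n. complex_of_real (1 - x n) * \<sigma>)"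
  have wz: "w n = l (z n)" for n by (simp add: w z_def)
  have wn: "(\<lambda>n. w n / of_nat n) \<longlonglongrightarrow> - \<i>" by (rule cesaro_increments[OF steps])
  have zlim: "z \<longlonglongrightarrow> \<sigma>"
  proof -
    have "z \<longlonglongrightarrow> of_real (1 - 0) * \<sigma>" unfolding z_def by (intro tendsto_intros x)
    then show ?thesis by simp
  qed
  have zd: "cmod (z n) < 1" for n using x(1,2)[of n] \<sigma> by (simp only: z_def norm_mult norm_of_real) simp
  have "\<forall>\<^sub>F n in sequentially. dist (z n) \<sigma> < \<delta>" using zlim \<delta> by (rule tendstoD)
  then have zU: "\<forall>\<^sub>F n in sequentially. z n \<in> U"
    by eventually_elim (use zd in \<open>simp add: U_def dist_commute\<close>)
  \<comment> \<open>The lift of a point of the petal lies in some translate S + j \<omega>, so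
    \<open>F\<close> has to be small over all translates of the strip.\<close>
  have impossible: False
    if F: "F holomorphic_on U" "\<And>z. z \<in> U \<Longrightarrow> cmod (F z) \<le> 1"
      and small: "\<And>z s j. z \<in> U \<Longrightarrow> s \<in> S \<Longrightarrow> l z = s + of_int j * \<omega> \<Longrightarrow> cmod (F z) \<le> exp (- pi)"
      and one: "(\<lambda>n. cmod (F (z n))) \<longlonglongrightarrow> 1" for F
  proof (rule lindelof_exclusion[OF \<sigma>(1) \<delta> F[unfolded U_def]])
    show "k ` S \<subseteq> unit_disc" using k_disc S_subset by auto
    have "connected (k ` S)"
      using holomorphic_on_imp_continuous_on[OF holomorphic_on_subset[OF hol_k S_subset]] connected_S
      by (rule connected_continuous_image)
    then show "path_connected (k ` S)" using connected_open_path_connected open_image_S by blast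
    show "cmod (F y) \<le> exp (- pi)" if y: "y \<in> k ` S" "y \<in> ball \<sigma> \<delta>" for y
    proof -
      obtain s where s: "s \<in> S" "y = k s" using y(1) by blast
      have "y \<in> U" using s k_disc S_subset y(2) by (auto simp: U_def)
      moreover from this have "l y \<in> D" "k s = k (l y)" using lD kl s by (auto simp: U_def)
      then obtain j where "l y = s + of_int j * \<omega>" using fibre s(1) S_subset by blast
      ultimately show ?thesis using small s(1) by blast
    qed
    show "(\<lambda>n. 1 - x n) \<longlonglongrightarrow> 1" using tendsto_diff[OF tendsto_const x(3), of 1] by simp
    show "(\<lambda>n. cmod (F (of_real (1 - x n) * \<sigma>))) \<longlonglongrightarrow> 1" using one by (simp add: z_def)
  qed (use \<sigma> x in \<open>auto\<close>)
  have "l ` U \<subseteq> D" using lD by (auto simp: U_def)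
  note lU = l[folded U_def] this
  have left: "\<not> (\<forall>\<^sub>F n in sequentially. Re (w n) \<le> Re bL - c1)"
  proof
    assume ev: "\<forall>\<^sub>F n in sequentially. Re (w n) \<le> Re bL - c1"
    have "\<omega> = 0"
    proof (rule ccontr)
      assume "\<omega> \<noteq> 0"
      from between[OF this] ev have "\<forall>\<^sub>F n in sequentially. False" by eventually_elim (use c1 in simp)
      then show False by simp
    qed
    obtain F where sfL: "F holomorphic_on U" "\<And>z. cmod (F z) = exp (slit_arg bL (l z) - pi)"
      "\<And>z. z \<in> U \<Longrightarrow> cmod (F z) \<le> 1" "\<And>z. z \<in> U \<Longrightarrow> Re bL \<le> Re (l z) \<Longrightarrow> cmod (F z) \<le> exp (- pi)"
      using slit_function_left[OF lU bL(1)] by blast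
    show False
    proof (rule impossible[of F])
      show "cmod (F y) \<le> exp (- pi)" if "y \<in> U" "s \<in> S" "l y = s + of_int j * \<omega>" for y s j
        using that bL(3) \<open>\<omega> = 0\<close> by (intro sfL(4)) (auto simp: S_def)
      have "\<forall>\<^sub>F n in sequentially. Re (w n) < Re bL" using ev by eventually_elim (use c1 in simp)
      from slit_arg_tendsto(1)[OF wn this] have "(\<lambda>n. exp (slit_arg bL (w n) - pi)) \<longlonglongrightarrow> exp (pi - pi)"
        by (intro tendsto_intros)
      then show "(\<lambda>n. cmod (F (z n))) \<longlonglongrightarrow> 1" unfolding sfL(2) wz by simp
    qed (use sfL in auto)
  qed
  have right: "\<not> (\<forall>\<^sub>F n in sequentially. Re bR + c1 \<le> Re (w n))"
  proof
    assume ev: "\<forall>\<^sub>F n in sequentially. Re bR + c1 \<le> Re (w n)"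
    obtain Fr where sfR: "Fr holomorphic_on U" "\<And>z. cmod (Fr z) = exp (- slit_arg bR (l z) - pi)"
      "\<And>z. z \<in> U \<Longrightarrow> cmod (Fr z) \<le> 1" "\<And>z. z \<in> U \<Longrightarrow> Re (l z) \<le> Re bR \<Longrightarrow> cmod (Fr z) \<le> exp (- pi)"
      using slit_function_right[OF lU bR(1)] by blast
    have "\<forall>\<^sub>F n in sequentially. Re bR < Re (w n)" using ev by eventually_elim (use c1 in simp)
    from slit_arg_tendsto(2)[OF wn this] have "(\<lambda>n. exp (- slit_arg bR (w n) - pi)) \<longlonglongrightarrow> exp (- (- pi) - pi)"
      by (intro tendsto_intros)
    then have Fr1: "(\<lambda>n. cmod (Fr (z n))) \<longlonglongrightarrow> 1" unfolding sfR(2) wz by simp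
    show False
    proof (cases "\<omega> = 0")
      case True
      show False
      proof (rule impossible[of Fr])
        show "cmod (Fr y) \<le> exp (- pi)" if "y \<in> U" "s \<in> S" "l y = s + of_int j * \<omega>" for y s j
          using that bR(2) \<open>\<omega> = 0\<close> by (intro sfR(4)) (auto simp: S_def)
      qed (use sfR Fr1 in auto)
    next
      case False
      then have Reom: "Re \<omega> \<ge> \<rho>" using omega by simp
      define b where "b = bL + \<omega>"
      have b: "b \<notin> D" using not_in_D_period[OF bL(1), of 1] by (simp add: b_def)
      obtain Fl where sfL: "Fl holomorphic_on U" "\<And>z. cmod (Fl z) = exp (slit_arg b (l z) - pi)"
        "\<And>z. z \<in> U \<Longrightarrow> cmod (Fl z) \<le> 1" "\<And>z. z \<in> U \<Longrightarrow> Re b \<le> Re (l z) \<Longrightarrow> cmod (Fl z) \<le> exp (- pi)"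
        using slit_function_left[OF lU b] by blast
      have "\<forall>\<^sub>F n in sequentially. Re (w n) < Re b" using between[OF False] by eventually_elim (simp add: b_def)
      from slit_arg_tendsto(1)[OF wn this] have "(\<lambda>n. exp (slit_arg b (w n) - pi)) \<longlonglongrightarrow> exp (pi - pi)"
        by (intro tendsto_intros)
      then have Fl1: "(\<lambda>n. cmod (Fl (z n))) \<longlonglongrightarrow> 1" unfolding sfL(2) wz by simp
      show False
      \<comment> \<open>The sequence runs down between the slits below \<open>bR\<close> and below
        bL + \<omega>, where both factors tend to modulus 1. Every translate of the strip is on the
        far side of one slit: those with j <= 0 left of \<open>bR\<close>, those with j >= 1 right
        of bL + \<omega>.\<close>
      proof (rule impossible[of "\<lambda>z. Fr z * Fl z"])
        show "(\<lambda>z. Fr z * Fl z) holomorphic_on U" by (intro holomorphic_intros sfL sfR)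
        show "cmod (Fr y * Fl y) \<le> 1" if "y \<in> U" for y
          using mult_mono[OF sfR(3)[OF that] sfL(3)[OF that]] by (simp add: norm_mult)
        show "cmod (Fr y * Fl y) \<le> exp (- pi)" if y: "y \<in> U" "s \<in> S" "l y = s + of_int j * \<omega>" for y s j
        proof -
          have s: "\<bar>Re s\<bar> < \<rho> / 2" using y(2) by (simp add: S_def)
          have Rel: "Re (l y) = Re s + of_int j * Re \<omega>" by (simp add: y(3))
          show ?thesis
          proof (cases "j \<le> 0")
            case True
            then have "of_int j * Re \<omega> \<le> 0" using Reom rho by (intro mult_nonpos_nonneg) auto
            then have "Re (l y) \<le> Re bR" using Rel s bR(2) by linarith
            from mult_mono[OF sfR(4)[OF y(1) this] sfL(3)[OF y(1)]] show ?thesis by (simp add: norm_mult)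
          next
            case False
            then have "1 * Re \<omega> \<le> of_int j * Re \<omega>" using Reom rho by (intro mult_right_mono) auto
            then have "Re b \<le> Re (l y)" using Rel s bL(3) by (simp add: b_def)
            from mult_mono[OF sfR(3)[OF y(1)] sfL(4)[OF y(1) this]] show ?thesis by (simp add: norm_mult)
          qed
        qed
        show "(\<lambda>n. cmod (Fr (z n) * Fl (z n))) \<longlonglongrightarrow> 1"
          using tendsto_mult[OF Fr1 Fl1] by (simp add: norm_mult)
      qed
    qed
  qed
  have "\<forall>\<^sub>F n in sequentially. Re bL + c1 \<le> Re (w n)" "\<forall>\<^sub>F n in sequentially. Re (w n) \<le> Re bR - c1"
    using eventually_one_side[OF c1 far steps bL(1)] eventually_one_side[OF c1 far steps bR(1)] left right by auto
  \<comment> \<open>On the left, for instance, Re bL + c1 exceeds - \<rho> / 2 + c1 / 2.\<close>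
  then have "\<forall>\<^sub>F n in sequentially. \<bar>Re (w n)\<bar> \<le> \<rho> / 2 - c1 / 2"
    by eventually_elim (use bL bR in linarith)
  then have "\<forall>\<^sub>F n in sequentially. \<bar>Re (w n)\<bar> \<le> \<rho> / 2 - c1 / 2 \<and> z n \<in> U"
    using zU by (rule eventually_conj)
  then obtain N where N: "\<And>n. n \<ge> N \<Longrightarrow> \<bar>Re (w n)\<bar> \<le> \<rho> / 2 - c1 / 2" "\<And>n. n \<ge> N \<Longrightarrow> z n \<in> U"
    by (auto simp: eventually_sequentially)
  have "(\<lambda>n. k (w (n + N))) \<longlonglongrightarrow> rep_pt"
  proof (rule strip_points_tendsto_rep_pt)
    show "\<bar>Re (w (n + N))\<bar> \<le> \<rho> / 2 - c1 / 2" for n by (rule N) simp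
    show "filterlim (\<lambda>n. Im (w (n + N))) at_bot sequentially"
      by (rule filterlim_compose[OF Im_at_bot[OF wn] filterlim_add_const_nat_at_top])
  qed (use c1 in simp)
  moreover have "k (w (n + N)) = z (n + N)" for n using kl N(2)[of "n + N"] by (simp add: wz U_def)
  ultimately have "(\<lambda>n. z (n + N)) \<longlonglongrightarrow> rep_pt" by simp
  moreover have "(\<lambda>n. z (n + N)) \<longlonglongrightarrow> \<sigma>" using zlim by (rule LIMSEQ_ignore_initial_segment)
  ultimately show ?thesis using LIMSEQ_unique by blast
qed

text \<open>In the elliptic case it remains to choose the branch of the lift. The translates of
  \<open>bL\<close> cut the plane into columns, and the sequence eventually stays in one of them,
  which a multiple of \<omega> moves to the standard position.\<close>

theorem repelling_fixed_point_unique: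
  assumes rep: "repelling_fixed_point \<phi> \<sigma>" and fr: "\<sigma> \<in> frontier (k ` S)"
  shows "\<sigma> = rep_pt"
proof -
  have \<sigma>: "cmod \<sigma> = 1" using rep by (simp add: repelling_fixed_point_def)
  have cl: "\<sigma> \<in> closure (k ` S)" using fr by (simp add: frontier_def)
  obtain \<delta> l where \<delta>: "\<delta> > 0" and l: "l holomorphic_on (unit_disc \<inter> ball \<sigma> \<delta>)"
    and lD: "\<And>z. z \<in> unit_disc \<inter> ball \<sigma> \<delta> \<Longrightarrow> l z \<in> D" and kl: "\<And>z. z \<in> unit_disc \<inter> ball \<sigma> \<delta> \<Longrightarrow> k (l z) = z"
    using lift[OF \<sigma>] by blast
  obtain x :: "nat \<Rightarrow> real" and c1 where x: "\<And>n. 0 < x n" "\<And>n. x n \<le> 1" "x \<longlonglongrightarrow> 0" and c1: "c1 > 0"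
    and far: "\<forall>\<^sub>F n in sequentially. \<forall>b. b \<notin> D \<longrightarrow> c1 \<le> cmod (l (of_real (1 - x n) * \<sigma>) - b)"
    and steps: "(\<lambda>n. l (of_real (1 - x (Suc n)) * \<sigma>) - l (of_real (1 - x n) * \<sigma>)) \<longlonglongrightarrow> - \<i>"
    using radial_koenigs_coordinates[OF rep \<delta> l lD kl] by blast
  define w where "w = (\<lambda>n. l (of_real (1 - x n) * \<sigma>))"
  have far': "\<forall>\<^sub>F n in sequentially. \<forall>b. b \<notin> D \<longrightarrow> c1 \<le> cmod (w n - b)" using far by (simp add: w_def)
  have steps': "(\<lambda>n. w (Suc n) - w n) \<longlonglongrightarrow> - \<i>" using steps by (simp add: w_def)
  obtain bL where bL: "bL \<notin> D" "- \<rho> / 2 - c1 / 2 < Re bL" "Re bL \<le> - \<rho> / 2"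
    using blocker_left[of "c1 / 2"] c1 by auto
  obtain bR where bR: "bR \<notin> D" "\<rho> / 2 \<le> Re bR" "Re bR < \<rho> / 2 + c1 / 2"
    using blocker_right[of "c1 / 2"] c1 by auto
  show ?thesis
  proof (cases "\<omega> = 0")
    case True
    show ?thesis
      by (rule repelling_fixed_point_unique_aux[OF \<sigma> cl \<delta> l lD kl x c1 w_def far' steps' bL bR]) (use True in auto)
  next
    case False
    then have \<theta>: "Re \<omega> > 0" using omega rho by simp
    define j where "j = (\<lambda>n. \<lfloor>(Re (w n) - Re bL) / Re \<omega>\<rfloor>)"
    have wn: "(\<lambda>n. w n / of_nat n) \<longlonglongrightarrow> - \<i>" by (rule cesaro_increments[OF steps'])
    \<comment> \<open>The column index grows sublinearly because Re (w n) does. Hence moving back by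
      j n periods changes the height by o(n), and the sequence still descends relative to its own
      column.\<close>
    have jlim: "(\<lambda>n. of_int (j n) / real n) \<longlonglongrightarrow> 0"
    proof -
      define y where "y = (\<lambda>n. (Re (w n) - Re bL) / Re \<omega>)"
      have "(\<lambda>n. Re (w n / of_nat n)) \<longlonglongrightarrow> Re (- \<i>)" by (intro tendsto_Re wn)
      then have "(\<lambda>n. Re (w n) / real n) \<longlonglongrightarrow> 0" by simp
      then have "(\<lambda>n. (Re (w n) / real n - Re bL / real n) / Re \<omega>) \<longlonglongrightarrow> (0 - 0) / Re \<omega>"
        using \<theta> by (intro tendsto_intros lim_const_over_n) auto
      then have y0: "(\<lambda>n. y n / real n) \<longlonglongrightarrow> 0" by (simp add: y_def diff_divide_distrib mult.commute)
      have y1: "(\<lambda>n. y n / real n - 1 / real n) \<longlonglongrightarrow> 0"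
        using tendsto_diff[OF y0 lim_const_over_n[of 1]] by simp
      show ?thesis
      proof (rule tendsto_sandwich[OF _ _ y1 y0])
        show "\<forall>\<^sub>F n in sequentially. y n / real n - 1 / real n \<le> of_int (j n) / real n"
        proof (rule always_eventually, rule allI)
          fix n
          have "y n - 1 \<le> of_int (j n)" unfolding j_def y_def by linarith
          then have "(y n - 1) / real n \<le> of_int (j n) / real n" by (intro divide_right_mono) auto
          then show "y n / real n - 1 / real n \<le> of_int (j n) / real n" by (simp add: diff_divide_distrib)
        qed
        show "\<forall>\<^sub>F n in sequentially. of_int (j n) / real n \<le> y n / real n"
        proof (rule always_eventually, rule allI)
          fix n
          have "of_int (j n) \<le> y n" unfolding j_def y_def by linarith
          then show "of_int (j n) / real n \<le> y n / real n" by (intro divide_right_mono) auto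
        qed
      qed
    qed
    have "(\<lambda>n. (w n - of_real (of_int (j n) * Im \<omega>) * \<i>) / of_nat n) \<longlonglongrightarrow> - \<i>"
    proof -
      have "(\<lambda>n. w n / of_nat n - of_real (of_int (j n) / real n) * (of_real (Im \<omega>) * \<i>)) \<longlonglongrightarrow> - \<i> - of_real 0 * (of_real (Im \<omega>) * \<i>)"
        by (intro tendsto_intros wn jlim)
      then show ?thesis by (simp add: diff_divide_distrib mult_ac)
    qed
    \<comment> \<open>Subtracting |Im \<omega>| puts \<open>w n\<close> below the blockers at both
      ends of its column, the translates with index j n and j n + 1.\<close>
    from Im_at_bot[OF this] have "\<forall>\<^sub>F n in sequentially. Im (w n - of_real (of_int (j n) * Im \<omega>) * \<i>) \<le> Im bL - \<bar>Im \<omega>\<bar>"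
      by (auto simp: filterlim_at_bot)
    moreover have "\<forall>\<^sub>F n in sequentially. dist (w (Suc n) - w n) (- \<i>) < c1" using steps' c1 by (rule tendstoD)
    ultimately have "\<forall>\<^sub>F n in sequentially. Re bL + of_int (j n) * Re \<omega> < Re (w n) \<and> j (Suc n) = j n"
      using far'
    proof eventually_elim
      case (elim n)
      define b0 where "b0 = bL + of_int (j n) * \<omega>"
      define b1 where "b1 = bL + of_int (j n + 1) * \<omega>"
      have nD: "b0 \<notin> D" "b1 \<notin> D" unfolding b0_def b1_def by (rule not_in_D_period[OF bL(1)])+
      have "Im (w n) \<le> Im b0" "Im (w n) \<le> Im b1"
        using elim(1) by (auto simp: b0_def b1_def algebra_simps)
      then have d: "c1 \<le> \<bar>Re (w n) - Re b0\<bar>" "c1 \<le> \<bar>Re (w n) - Re b1\<bar>"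
        using horizontal_distance[of c1 "w n"] elim(3) nD by auto
      have R: "Re b0 = Re bL + of_int (j n) * Re \<omega>" "Re b1 = Re bL + (of_int (j n) + 1) * Re \<omega>"
        by (simp_all add: b0_def b1_def)
      have "of_int (j n) \<le> (Re (w n) - Re bL) / Re \<omega>" "(Re (w n) - Re bL) / Re \<omega> < of_int (j n) + 1"
        unfolding j_def by linarith+
      then have fl: "of_int (j n) * Re \<omega> \<le> Re (w n) - Re bL" "Re (w n) - Re bL < (of_int (j n) + 1) * Re \<omega>"
        using \<theta> by (simp_all add: pos_le_divide_eq pos_divide_less_eq)
      have in1: "Re b0 + c1 \<le> Re (w n)" "Re (w n) \<le> Re b1 - c1" using d R fl c1 by linarith+
      have "\<bar>Re (w (Suc n) - w n + \<i>)\<bar> \<le> cmod (w (Suc n) - w n + \<i>)" by (rule abs_Re_le_cmod)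
      then have "\<bar>Re (w (Suc n)) - Re (w n)\<bar> < c1" using elim(2) by (simp add: dist_norm)
      then have "Re b0 \<le> Re (w (Suc n))" "Re (w (Suc n)) < Re b1" using in1 by linarith+
      then have "of_int (j n) * Re \<omega> \<le> Re (w (Suc n)) - Re bL" "Re (w (Suc n)) - Re bL < (of_int (j n) + 1) * Re \<omega>"
        unfolding R by linarith+
      then have "of_int (j n) \<le> (Re (w (Suc n)) - Re bL) / Re \<omega>" "(Re (w (Suc n)) - Re bL) / Re \<omega> < of_int (j n) + 1"
        using \<theta> by (simp_all add: pos_le_divide_eq pos_divide_less_eq)
      then have "\<lfloor>(Re (w (Suc n)) - Re bL) / Re \<omega>\<rfloor> = j n" by (rule floor_unique)
      then have "j (Suc n) = j n" by (simp only: j_def)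
      then show ?case using in1(1) R(1) c1 by linarith
    qed
    then obtain N where N: "\<And>n. n \<ge> N \<Longrightarrow> Re bL + of_int (j n) * Re \<omega> < Re (w n)" "\<And>n. n \<ge> N \<Longrightarrow> j (Suc n) = j n"
      by (auto simp: eventually_sequentially)
    define J where "J = j N"
    have jJ: "j n = J" if "n \<ge> N" for n
      using that by (induction n rule: dec_induct) (auto simp: J_def N(2))
    \<comment> \<open>Another branch of the lift, for which the column of the sequence starts at
      \<open>bL\<close>.\<close>
    define l' where "l' = (\<lambda>z. l z + of_int (- J) * \<omega>)"
    define w' where "w' = (\<lambda>n. l' (of_real (1 - x n) * \<sigma>))"
    have w': "w' n = w n - of_int J * \<omega>" for n by (simp add: w'_def l'_def w_def)
    show ?thesis
    proof (rule repelling_fixed_point_unique_aux[OF \<sigma> cl \<delta> _ _ _ x c1 w'_def _ _ bL bR])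
      show "l' holomorphic_on (unit_disc \<inter> ball \<sigma> \<delta>)" unfolding l'_def by (intro holomorphic_intros l)
      show "l' z \<in> D" if "z \<in> unit_disc \<inter> ball \<sigma> \<delta>" for z unfolding l'_def by (rule period[OF lD[OF that]])
      show "k (l' z) = z" if "z \<in> unit_disc \<inter> ball \<sigma> \<delta>" for z
        unfolding l'_def using k_period[OF lD[OF that]] kl[OF that] by metis
      show "\<forall>\<^sub>F n in sequentially. \<forall>b. b \<notin> D \<longrightarrow> c1 \<le> cmod (w' n - b)"
        using far'
      proof eventually_elim
        case (elim n)
        show ?case
        proof (intro allI impI)
          fix b assume "b \<notin> D"
          from not_in_D_period[OF this, of J] elim have "c1 \<le> cmod (w n - (b + of_int J * \<omega>))" by blast
          then show "c1 \<le> cmod (w' n - b)" by (simp add: w' algebra_simps)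
        qed
      qed
      show "(\<lambda>n. w' (Suc n) - w' n) \<longlonglongrightarrow> - \<i>" using steps' by (simp add: w')
      have "Re bL < Re (w' n) \<and> Re (w' n) < Re (bL + \<omega>)" if n: "n \<ge> N" for n
      proof -
        have "(Re (w n) - Re bL) / Re \<omega> < of_int (j n) + 1" unfolding j_def by linarith
        then have "Re (w n) - Re bL < (of_int J + 1) * Re \<omega>" using \<theta> jJ[OF n] by (simp add: pos_divide_less_eq)
        moreover have "Re bL + of_int J * Re \<omega> < Re (w n)" using N(1)[OF n] jJ[OF n] by simp
        ultimately show ?thesis by (simp add: w' algebra_simps)
      qed
      then show "\<forall>\<^sub>F n in sequentially. Re bL < Re (w' n) \<and> Re (w' n) < Re (bL + \<omega>)"
        by (auto simp: eventually_sequentially)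
    qed
  qed
qed

end

section \<open>Maximal strips and sectors\<close>

context petal_chart
begin

lemma hyperbolic_petal_of_strip:
  "hyperbolic_petal \<phi> (k ` S)"
  "\<And>\<sigma>. \<sigma> \<in> frontier (k ` S) \<Longrightarrow> repelling_fixed_point \<phi> \<sigma> \<Longrightarrow> repelling_spectral_value \<phi> \<sigma> (- pi / \<rho>)"
  using hyperbolic_petal_image_S repelling_fixed_point_unique repelling_spectral_value_rep_pt by auto

end

section \<open>The Koenigs chart in the non-elliptic case\<close>

lemma univalent_inverse:
  assumes "h holomorphic_on unit_disc" "inj_on h unit_disc"
  obtains hi where "hi holomorphic_on (h ` unit_disc)" "\<And>z. cmod z < 1 \<Longrightarrow> hi (h z) = z"
    "\<And>w. w \<in> h ` unit_disc \<Longrightarrow> cmod (hi w) < 1" "\<And>w. w \<in> h ` unit_disc \<Longrightarrow> h (hi w) = w"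
    "open (h ` unit_disc)" "h ` unit_disc \<noteq> UNIV"
proof -
  obtain hi where hi: "hi holomorphic_on (h ` unit_disc)" "\<And>z. z \<in> unit_disc \<Longrightarrow> hi (h z) = z"
    using holomorphic_has_inverse[OF assms(1) open_ball assms(2)] by metis
  have "open (h ` unit_disc)" using assms by (intro open_mapping_thm3) auto
  moreover have "h ` unit_disc \<noteq> UNIV"
  proof
    assume U: "h ` unit_disc = UNIV"
    have "hi w \<in> unit_disc" for w
    proof -
      obtain z where "z \<in> unit_disc" "w = h z" using U by (metis UNIV_I imageE)
      then show ?thesis using hi(2) by simp
    qed
    then have "range hi \<subseteq> unit_disc" by blast
    then have "bounded (range hi)" by (rule bounded_subset[OF bounded_ball])
    then have "hi constant_on UNIV" using hi(1) unfolding U by (intro Liouville_theorem)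
    then have "hi (h 0) = hi (h (1 / 2))" by (auto simp: constant_on_def)
    then show False using hi(2)[of 0] hi(2)[of "1 / 2"] by simp
  qed
  ultimately show thesis using hi by (intro that[of hi]) auto
qed

lemma translated_strip_eq: "(+) z ` strip r = {w. Re z < Re w \<and> Re w < Re z + r}"
proof
  show "(+) z ` strip r \<subseteq> {w. Re z < Re w \<and> Re w < Re z + r}" by (auto simp: strip_def)
  show "{w. Re z < Re w \<and> Re w < Re z + r} \<subseteq> (+) z ` strip r"
  proof
    fix w assume "w \<in> {w. Re z < Re w \<and> Re w < Re z + r}"
    then show "w \<in> (+) z ` strip r" by (intro image_eqI[of _ _ "w - z"]) (auto simp: strip_def)
  qed
qed

text \<open>The chart is the inverse Koenigs function after centring the strip at the imaginary
  axis, without periods. Without a blocker within \<epsilon> of an edge the strip could be widened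
  by \<epsilon> on that side, against maximality.\<close>

lemma hyperbolic_petal_of_maximal_strip:
  assumes sem: "holomorphic_semigroup \<phi>"
    and h: "h holomorphic_on unit_disc" "inj_on h unit_disc"
    and conj: "\<And>t z. t \<ge> 0 \<Longrightarrow> cmod z < 1 \<Longrightarrow> h (\<phi> t z) = h z + \<i> * of_real t"
    and \<rho>: "\<rho> > 0" and max: "maximal_strip (h ` unit_disc) ((+) z\<^sub>0 ` strip \<rho>)"
  defines "\<Delta> \<equiv> {z \<in> unit_disc. h z \<in> (+) z\<^sub>0 ` strip \<rho>}"
  shows "hyperbolic_petal \<phi> \<Delta>"
    and "\<And>\<sigma>. \<sigma> \<in> frontier \<Delta> \<Longrightarrow> repelling_fixed_point \<phi> \<sigma> \<Longrightarrow> repelling_spectral_value \<phi> \<sigma> (- pi / \<rho>)"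
proof -
  obtain hi where hi: "hi holomorphic_on (h ` unit_disc)" "\<And>z. cmod z < 1 \<Longrightarrow> hi (h z) = z"
    "\<And>w. w \<in> h ` unit_disc \<Longrightarrow> cmod (hi w) < 1" "\<And>w. w \<in> h ` unit_disc \<Longrightarrow> h (hi w) = w"
    "open (h ` unit_disc)"
    using univalent_inverse[OF h] by metis
  define a where "a = z\<^sub>0 + of_real (\<rho> / 2)"
  define D where "D = {\<zeta>. \<zeta> + a \<in> h ` unit_disc}"
  define k where "k = (\<lambda>\<zeta>. hi (\<zeta> + a))"
  have strip_sub: "(+) z\<^sub>0 ` strip \<rho> \<subseteq> h ` unit_disc" using max by (simp add: maximal_strip_def)
  have not_larger: False
    if "r > \<rho>" "Re z\<^sub>1 \<le> Re z\<^sub>0" "Re z\<^sub>0 + \<rho> \<le> Re z\<^sub>1 + r" "{w. Re z\<^sub>1 < Re w \<and> Re w < Re z\<^sub>1 + r} \<subseteq> h ` unit_disc" for z\<^sub>1 r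
  proof -
    have "translated_strip ((+) z\<^sub>1 ` strip r)" unfolding translated_strip_def using that(1) \<rho> by (intro exI[of _ z\<^sub>1] exI[of _ r]) simp
    moreover have "(+) z\<^sub>1 ` strip r \<subseteq> h ` unit_disc" using that(4) by (simp add: translated_strip_eq)
    moreover have "(+) z\<^sub>0 ` strip \<rho> \<subset> (+) z\<^sub>1 ` strip r"
    proof
      show "(+) z\<^sub>0 ` strip \<rho> \<subseteq> (+) z\<^sub>1 ` strip r" unfolding translated_strip_eq using that(2,3) by auto
      have "(if Re z\<^sub>1 < Re z\<^sub>0 then z\<^sub>0 else z\<^sub>0 + of_real \<rho>) \<in> (+) z\<^sub>1 ` strip r - (+) z\<^sub>0 ` strip \<rho>"
        unfolding translated_strip_eq using that(1-3) \<rho> by auto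
      then show "(+) z\<^sub>0 ` strip \<rho> \<noteq> (+) z\<^sub>1 ` strip r" by blast
    qed
    ultimately show False using max unfolding maximal_strip_def by blast
  qed
  interpret petal_chart \<phi> D k 0 \<rho>
  proof
    show "holomorphic_semigroup \<phi>" by (rule sem)
    have "D = (\<lambda>\<zeta>. \<zeta> + a) -` (h ` unit_disc)" by (auto simp: D_def)
    then show "open D" using hi(5) by (auto intro!: open_vimage continuous_intros)
    have "(hi \<circ> (\<lambda>\<zeta>. \<zeta> + a)) holomorphic_on D"
      by (rule holomorphic_on_compose_gen[OF _ hi(1)]) (auto intro!: holomorphic_intros simp: D_def)
    then show "k holomorphic_on D" by (simp add: k_def o_def)
    show "cmod (k \<zeta>) < 1" if "\<zeta> \<in> D" for \<zeta> using hi(3) that by (simp add: k_def D_def)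
    have up: "\<zeta> + a + \<i> * of_real t = h (\<phi> t (k \<zeta>))" "cmod (\<phi> t (k \<zeta>)) < 1" if "\<zeta> \<in> D" "t \<ge> 0" for \<zeta> t
      using that conj[OF that(2), of "k \<zeta>"] hi(3,4)[of "\<zeta> + a"] semigroup_norm_less_one[OF sem that(2), of "k \<zeta>"]
      by (simp_all add: k_def D_def)
    show "\<zeta> + \<i> * of_real t \<in> D" if "\<zeta> \<in> D" "t \<ge> 0" for \<zeta> t
    proof -
      have "\<zeta> + \<i> * of_real t + a = h (\<phi> t (k \<zeta>))" using up(1)[OF that] by (simp add: algebra_simps)
      then show ?thesis using up(2)[OF that] by (simp add: D_def)
    qed
    show "k (\<zeta> + \<i> * of_real t) = \<phi> t (k \<zeta>)" if "\<zeta> \<in> D" "t \<ge> 0" for \<zeta> t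
    proof -
      have "\<zeta> + \<i> * of_real t + a = h (\<phi> t (k \<zeta>))" using up(1)[OF that] by (simp add: algebra_simps)
      then show ?thesis using hi(2)[OF up(2)[OF that]] by (simp add: k_def)
    qed
    show "\<exists>j. \<zeta>' = \<zeta> + of_int j * 0" if "\<zeta> \<in> D" "\<zeta>' \<in> D" "k \<zeta> = k \<zeta>'" for \<zeta> \<zeta>'
    proof -
      have "h (hi (\<zeta> + a)) = h (hi (\<zeta>' + a))" using that(3) by (simp add: k_def)
      then have "\<zeta> + a = \<zeta>' + a" using that(1,2) unfolding D_def mem_Collect_eq by (simp only: hi(4))
      then show ?thesis by simp
    qed
    show "\<zeta> \<in> D" if "\<bar>Re \<zeta>\<bar> < \<rho> / 2" for \<zeta>
    proof -
      have "\<zeta> + a \<in> (+) z\<^sub>0 ` strip \<rho>" unfolding translated_strip_eq a_def using that by (auto simp: abs_less_iff)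
      then show ?thesis using strip_sub by (auto simp: D_def)
    qed
    show "\<exists>b. b \<notin> D \<and> - \<rho> / 2 - \<epsilon> < Re b \<and> Re b \<le> - \<rho> / 2" if "\<epsilon> > 0" for \<epsilon>
    proof (rule ccontr)
      assume no: "\<not> ?thesis"
      show False
      proof (rule not_larger[of "\<rho> + \<epsilon>" "z\<^sub>0 - of_real \<epsilon>"])
        show "{w. Re (z\<^sub>0 - of_real \<epsilon>) < Re w \<and> Re w < Re (z\<^sub>0 - of_real \<epsilon>) + (\<rho> + \<epsilon>)} \<subseteq> h ` unit_disc"
        proof
          fix w assume w: "w \<in> {w. Re (z\<^sub>0 - of_real \<epsilon>) < Re w \<and> Re w < Re (z\<^sub>0 - of_real \<epsilon>) + (\<rho> + \<epsilon>)}"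
          show "w \<in> h ` unit_disc"
          proof (cases "Re w > Re z\<^sub>0")
            case True
            then show ?thesis using w strip_sub unfolding translated_strip_eq by auto
          next
            case False
            then have "- \<rho> / 2 - \<epsilon> < Re (w - a)" "Re (w - a) \<le> - \<rho> / 2" using w by (simp_all add: a_def)
            then have "w - a \<in> D" using no by blast
            then show ?thesis by (simp add: D_def)
          qed
        qed
      qed (use that in auto)
    qed
    show "\<exists>b. b \<notin> D \<and> \<rho> / 2 \<le> Re b \<and> Re b < \<rho> / 2 + \<epsilon>" if "\<epsilon> > 0" for \<epsilon>
    proof (rule ccontr)
      assume no: "\<not> ?thesis"
      show False
      proof (rule not_larger[of "\<rho> + \<epsilon>" "z\<^sub>0"])
        show "{w. Re z\<^sub>0 < Re w \<and> Re w < Re z\<^sub>0 + (\<rho> + \<epsilon>)} \<subseteq> h ` unit_disc"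
        proof
          fix w assume w: "w \<in> {w. Re z\<^sub>0 < Re w \<and> Re w < Re z\<^sub>0 + (\<rho> + \<epsilon>)}"
          show "w \<in> h ` unit_disc"
          proof (cases "Re w < Re z\<^sub>0 + \<rho>")
            case True
            then show ?thesis using w strip_sub unfolding translated_strip_eq by auto
          next
            case False
            then have "\<rho> / 2 \<le> Re (w - a)" "Re (w - a) < \<rho> / 2 + \<epsilon>" using w by (simp_all add: a_def)
            then have "w - a \<in> D" using no by blast
            then show ?thesis by (simp add: D_def)
          qed
        qed
      qed (use that in auto)
    qed
    show "\<exists>\<delta> l. \<delta> > 0 \<and> l holomorphic_on (unit_disc \<inter> ball \<sigma> \<delta>) \<and>
      (\<forall>z\<in>unit_disc \<inter> ball \<sigma> \<delta>. l z \<in> D \<and> k (l z) = z)" for \<sigma>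
    proof (intro exI conjI ballI)
      show "(0::real) < 1" by simp
      show "(\<lambda>z. h z - a) holomorphic_on (unit_disc \<inter> ball \<sigma> 1)"
        by (intro holomorphic_intros holomorphic_on_subset[OF h(1)]) auto
      show "h z - a \<in> D" "k (h z - a) = z" if "z \<in> unit_disc \<inter> ball \<sigma> 1" for z
        using that hi(2)[of z] by (auto simp: D_def k_def)
    qed
    have outside: "z \<in> k ` D" if "cmod z < 1" for z
      using that hi(2)[of z] by (intro image_eqI[of _ _ "h z - a"]) (auto simp: D_def k_def)
    show "\<phi> t z = z" if "cmod z < 1" "z \<notin> k ` D" for z t using outside that by blast
    show "\<exists>y. b + \<i> * of_real y \<in> D \<and> k (b + \<i> * of_real y) \<in> V" if "cmod z < 1" "z \<notin> k ` D" for z b V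
      using outside that by blast
  qed (use \<rho> in \<open>auto\<close>)
  have S_iff: "\<zeta> \<in> S \<longleftrightarrow> \<zeta> + a \<in> (+) z\<^sub>0 ` strip \<rho>" for \<zeta>
    unfolding S_def translated_strip_eq a_def by (auto simp: abs_less_iff)
  have "k ` S = \<Delta>"
  proof
    show "k ` S \<subseteq> \<Delta>"
    proof
      fix z assume "z \<in> k ` S"
      then obtain \<zeta> where \<zeta>: "\<zeta> \<in> S" "z = hi (\<zeta> + a)" by (auto simp: k_def)
      then have "\<zeta> + a \<in> h ` unit_disc" "\<zeta> + a \<in> (+) z\<^sub>0 ` strip \<rho>" using S_iff strip_sub by blast+
      then show "z \<in> \<Delta>" using hi(3,4)[of "\<zeta> + a"] \<zeta>(2) by (simp add: \<Delta>_def)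
    qed
    show "\<Delta> \<subseteq> k ` S"
    proof
      fix z assume "z \<in> \<Delta>"
      then have z: "cmod z < 1" "h z \<in> (+) z\<^sub>0 ` strip \<rho>" by (auto simp: \<Delta>_def)
      then have "h z - a \<in> S" using S_iff[of "h z - a"] by simp
      moreover have "k (h z - a) = z" using hi(2)[OF z(1)] by (simp add: k_def)
      ultimately show "z \<in> k ` S" by force
    qed
  qed
  then show "hyperbolic_petal \<phi> \<Delta>"
    and "\<And>\<sigma>. \<sigma> \<in> frontier \<Delta> \<Longrightarrow> repelling_fixed_point \<phi> \<sigma> \<Longrightarrow> repelling_spectral_value \<phi> \<sigma> (- pi / \<rho>)"
    using hyperbolic_petal_of_strip by simp_all
qed

text \<open>The map \<open>\<zeta> \<mapsto> exp (\<i> \<mu> \<zeta>)\<close> sends vertical strips to \<open>\<mu>\<close>-spirallike sectors, and \<open>\<zeta> + \<i> t\<close> to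
  multiplication by \<open>exp (- \<mu> t)\<close>; widths and amplitudes differ by the factor \<open>Re \<mu> / \<bar>\<mu>\<bar>\<^sup>2\<close>.\<close>

lemma spir_eq_exp_strip:
  assumes \<mu>: "Re \<mu> > 0"
  defines "m \<equiv> Re \<mu> / (cmod \<mu>)\<^sup>2"
  shows "spir \<mu> \<beta> \<theta> = (\<lambda>\<zeta>. exp (\<i> * \<mu> * \<zeta>)) ` {\<zeta>. \<bar>Re \<zeta> - \<theta> * m\<bar> < \<beta> / 2 * m}"
proof -
  have n: "(cmod \<mu>)\<^sup>2 = (Re \<mu>)\<^sup>2 + (Im \<mu>)\<^sup>2" by (rule cmod_power2)
  have npos: "(cmod \<mu>)\<^sup>2 > 0" using \<mu> by auto
  have m: "m > 0" using \<mu> npos by (simp add: m_def)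
  \<comment> \<open>The real part of \<i> \<mu> \<zeta> depends on both coordinates if \<mu> is not
    real; the shift in the imaginary part of \<zeta> absorbs this and leaves Re \<zeta> = \<eta>
    m.\<close>
  have key: "\<i> * \<mu> * Complex (\<eta> * m) (- t - \<eta> * m * (Im \<mu> / Re \<mu>)) = of_real t * \<mu> + \<i> * of_real \<eta>" for t \<eta>
  proof -
    have "\<eta> * m * Re \<mu> + \<eta> * m * (Im \<mu> / Re \<mu>) * Im \<mu> = \<eta> * (m * ((Re \<mu>)\<^sup>2 + (Im \<mu>)\<^sup>2) / Re \<mu>)"
      using \<mu> by (simp add: field_simps power2_eq_square)
    also have "m * ((Re \<mu>)\<^sup>2 + (Im \<mu>)\<^sup>2) / Re \<mu> = 1" unfolding m_def n[symmetric] using \<mu> npos by simp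
    finally show ?thesis using \<mu> by (simp add: complex_eq_iff algebra_simps)
  qed
  show ?thesis
  proof
    show "spir \<mu> \<beta> \<theta> \<subseteq> (\<lambda>\<zeta>. exp (\<i> * \<mu> * \<zeta>)) ` {\<zeta>. \<bar>Re \<zeta> - \<theta> * m\<bar> < \<beta> / 2 * m}"
    proof
      fix w assume "w \<in> spir \<mu> \<beta> \<theta>"
      then obtain t \<eta> where w: "w = exp (of_real t * \<mu> + \<i> * of_real \<eta>)" "\<theta> - \<beta> / 2 < \<eta>" "\<eta> < \<theta> + \<beta> / 2"
        by (auto simp: spir_def)
      have "\<bar>\<eta> - \<theta>\<bar> < \<beta> / 2" using w(2,3) by linarith
      then have "\<bar>\<eta> - \<theta>\<bar> * m < \<beta> / 2 * m" using m by (rule mult_strict_right_mono)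
      moreover have "\<bar>\<eta> - \<theta>\<bar> * m = \<bar>\<eta> * m - \<theta> * m\<bar>"
        unfolding left_diff_distrib[symmetric] using m by (simp add: abs_mult)
      ultimately show "w \<in> (\<lambda>\<zeta>. exp (\<i> * \<mu> * \<zeta>)) ` {\<zeta>. \<bar>Re \<zeta> - \<theta> * m\<bar> < \<beta> / 2 * m}"
        using w(1) key[of \<eta> t] by (intro image_eqI[of _ _ "Complex (\<eta> * m) (- t - \<eta> * m * (Im \<mu> / Re \<mu>))"]) auto
    qed
    show "(\<lambda>\<zeta>. exp (\<i> * \<mu> * \<zeta>)) ` {\<zeta>. \<bar>Re \<zeta> - \<theta> * m\<bar> < \<beta> / 2 * m} \<subseteq> spir \<mu> \<beta> \<theta>"
    proof
      fix w assume "w \<in> (\<lambda>\<zeta>. exp (\<i> * \<mu> * \<zeta>)) ` {\<zeta>. \<bar>Re \<zeta> - \<theta> * m\<bar> < \<beta> / 2 * m}"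
      then obtain \<zeta> where \<zeta>: "w = exp (\<i> * \<mu> * \<zeta>)" "\<bar>Re \<zeta> - \<theta> * m\<bar> < \<beta> / 2 * m" by blast
      define \<eta> where "\<eta> = Re \<zeta> / m"
      define t where "t = - Im \<zeta> - Re \<zeta> * (Im \<mu> / Re \<mu>)"
      have re: "\<eta> * m = Re \<zeta>" using m by (simp add: \<eta>_def)
      have "Complex (\<eta> * m) (- t - \<eta> * m * (Im \<mu> / Re \<mu>)) = \<zeta>" unfolding re by (simp add: complex_eq_iff t_def)
      then have w: "w = exp (of_real t * \<mu> + \<i> * of_real \<eta>)" using key[of \<eta> t] \<zeta>(1) by simp
      have "(\<theta> - \<beta> / 2) * m < \<eta> * m" "\<eta> * m < (\<theta> + \<beta> / 2) * m"
        unfolding re left_diff_distrib distrib_right using \<zeta>(2) by linarith+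
      then have "\<theta> - \<beta> / 2 < \<eta>" "\<eta> < \<theta> + \<beta> / 2" using m by (simp_all only: mult_less_cancel_right_pos)
      then show "w \<in> spir \<mu> \<beta> \<theta>" using w by (auto simp: spir_def)
    qed
  qed
qed

lemma spir_add_period: "spir \<mu> \<beta> (\<theta> + 2 * pi * of_int j) = spir \<mu> \<beta> \<theta>"
proof -
  have sub: "spir \<mu> \<beta> (\<theta> + 2 * pi * of_int j) \<subseteq> spir \<mu> \<beta> \<theta>" for \<theta> and j :: int
  proof
    fix w assume "w \<in> spir \<mu> \<beta> (\<theta> + 2 * pi * of_int j)"
    then obtain t \<eta> where w: "w = exp (of_real t * \<mu> + \<i> * of_real \<eta>)"
      "\<theta> + 2 * pi * of_int j - \<beta> / 2 < \<eta>" "\<eta> < \<theta> + 2 * pi * of_int j + \<beta> / 2"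
      by (auto simp: spir_def)
    have "of_real t * \<mu> + \<i> * of_real \<eta>
        = of_real t * \<mu> + \<i> * of_real (\<eta> - 2 * pi * of_int j) + of_int (2 * j) * (of_real pi * \<i>)"
      by (simp add: algebra_simps)
    then have "w = exp (of_real t * \<mu> + \<i> * of_real (\<eta> - 2 * pi * of_int j))"
      unfolding w(1) exp_eq by (intro exI[of _ j]) (simp add: algebra_simps)
    then show "w \<in> spir \<mu> \<beta> \<theta>" using w(2,3)
      unfolding spir_def by (intro CollectI exI[of _ t] exI[of _ "\<eta> - 2 * pi * of_int j"]) auto
  qed
  show ?thesis
  proof
    show "spir \<mu> \<beta> (\<theta> + 2 * pi * of_int j) \<subseteq> spir \<mu> \<beta> \<theta>" by (rule sub)
    show "spir \<mu> \<beta> \<theta> \<subseteq> spir \<mu> \<beta> (\<theta> + 2 * pi * of_int j)"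
      using sub[of "\<theta> + 2 * pi * of_int j" "- j"] by simp
  qed
qed

text \<open>Sectors constructed as enlargements have an arbitrary centre, which is reduced modulo 2
  pi to the prescribed interval.\<close>

lemma spirallike_sector_spir:
  assumes "0 < \<beta>" "\<beta> \<le> 2 * pi"
  shows "spirallike_sector \<mu> (spir \<mu> \<beta> \<theta>)"
proof -
  define j where "j = \<lfloor>(\<theta> + pi) / (2 * pi)\<rfloor>"
  define \<theta>' where "\<theta>' = \<theta> - 2 * pi * of_int j"
  have "of_int j \<le> (\<theta> + pi) / (2 * pi)" "(\<theta> + pi) / (2 * pi) < of_int j + 1" unfolding j_def by linarith+
  then have "of_int j * (2 * pi) \<le> \<theta> + pi" "\<theta> + pi < (of_int j + 1) * (2 * pi)"
    by (simp_all add: pos_le_divide_eq pos_divide_less_eq)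
  then have "\<theta>' \<in> {- pi..<pi}" by (simp add: \<theta>'_def algebra_simps)
  moreover have "spir \<mu> \<beta> \<theta> = spir \<mu> (2 * (\<beta> / 2)) \<theta>'"
    using spir_add_period[of \<mu> \<beta> \<theta>' j] by (simp add: \<theta>'_def)
  moreover have "\<beta> / 2 \<in> {0<..pi}" using assms by simp
  ultimately show ?thesis unfolding spirallike_sector_def by blast
qed

text \<open>The chart is the inverse Koenigs function after the exponential \<open>E\<close>, whose
  period has real part 2 pi m. The sector becomes a strip of width \<beta> m, and \<beta> <= 2 pi is
  the chart condition that the strip is not wider than the period.\<close>

lemma hyperbolic_petal_of_maximal_sector:
  assumes sem: "holomorphic_semigroup \<phi>" and \<mu>: "Re \<mu> > 0"
    and h: "h holomorphic_on unit_disc" "inj_on h unit_disc"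
    and conj: "\<And>t z. t \<ge> 0 \<Longrightarrow> cmod z < 1 \<Longrightarrow> h (\<phi> t z) = exp (- \<mu> * of_real t) * h z"
    and h0: "0 \<in> h ` unit_disc"
    and \<beta>: "0 < \<beta>" "\<beta> \<le> 2 * pi" and max: "maximal_spirallike_sector \<mu> (h ` unit_disc) (spir \<mu> \<beta> \<theta>\<^sub>0)"
  defines "\<Delta> \<equiv> {z \<in> unit_disc. h z \<in> spir \<mu> \<beta> \<theta>\<^sub>0}"
  shows "hyperbolic_petal \<phi> \<Delta>"
    and "\<And>\<sigma>. \<sigma> \<in> frontier \<Delta> \<Longrightarrow> repelling_fixed_point \<phi> \<sigma> \<Longrightarrow>
      repelling_spectral_value \<phi> \<sigma> (- ((cmod \<mu>)\<^sup>2 * pi) / (\<beta> * Re \<mu>))"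
proof -
  obtain hi where hi: "hi holomorphic_on (h ` unit_disc)" "\<And>z. cmod z < 1 \<Longrightarrow> hi (h z) = z"
    "\<And>w. w \<in> h ` unit_disc \<Longrightarrow> cmod (hi w) < 1" "\<And>w. w \<in> h ` unit_disc \<Longrightarrow> h (hi w) = w"
    "open (h ` unit_disc)" "h ` unit_disc \<noteq> UNIV"
    using univalent_inverse[OF h] by metis
  define m where "m = Re \<mu> / (cmod \<mu>)\<^sup>2"
  have npos: "(cmod \<mu>)\<^sup>2 > 0" and \<mu>0: "\<mu> \<noteq> 0" using \<mu> by auto
  have m: "m > 0" using \<mu> npos by (simp add: m_def)
  define \<rho> where "\<rho> = \<beta> * m"
  define \<omega> where "\<omega> = 2 * of_real pi / \<mu>"
  define E where "E = (\<lambda>\<zeta>. exp (\<i> * \<mu> * (\<zeta> + of_real (\<theta>\<^sub>0 * m))))"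
  define D where "D = {\<zeta>. E \<zeta> \<in> h ` unit_disc}"
  define k where "k = (\<lambda>\<zeta>. hi (E \<zeta>))"
  have \<rho>: "\<rho> > 0" using \<beta> m by (simp add: \<rho>_def)
  have Re_\<omega>: "Re \<omega> = 2 * pi * m"
    by (simp add: \<omega>_def m_def Re_divide cmod_power2)
  have \<rho>\<omega>: "\<rho> \<le> Re \<omega>" unfolding \<rho>_def Re_\<omega> using \<beta> m by (intro mult_right_mono) auto
  have E_image: "E ` {\<zeta>. \<bar>Re \<zeta> - x\<bar> < r / 2 * m} = spir \<mu> r (\<theta>\<^sub>0 + x / m)" for x r
  proof -
    have "(\<theta>\<^sub>0 + x / m) * m = \<theta>\<^sub>0 * m + x" using m by (simp add: field_simps)
    then have "spir \<mu> r (\<theta>\<^sub>0 + x / m) = (\<lambda>\<zeta>. exp (\<i> * \<mu> * \<zeta>)) ` {\<zeta>. \<bar>Re \<zeta> - (\<theta>\<^sub>0 * m + x)\<bar> < r / 2 * m}"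
      using spir_eq_exp_strip[OF \<mu>, of r "\<theta>\<^sub>0 + x / m"] by (simp add: m_def)
    also have "{\<zeta>. \<bar>Re \<zeta> - (\<theta>\<^sub>0 * m + x)\<bar> < r / 2 * m} = (\<lambda>\<zeta>. \<zeta> + of_real (\<theta>\<^sub>0 * m)) ` {\<zeta>. \<bar>Re \<zeta> - x\<bar> < r / 2 * m}"
    proof (intro equalityI subsetI)
      fix \<zeta> assume "\<zeta> \<in> {\<zeta>. \<bar>Re \<zeta> - (\<theta>\<^sub>0 * m + x)\<bar> < r / 2 * m}"
      then show "\<zeta> \<in> (\<lambda>\<zeta>. \<zeta> + of_real (\<theta>\<^sub>0 * m)) ` {\<zeta>. \<bar>Re \<zeta> - x\<bar> < r / 2 * m}"
        by (intro image_eqI[of _ _ "\<zeta> - of_real (\<theta>\<^sub>0 * m)"]) (auto simp: algebra_simps)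
    qed (auto simp: algebra_simps)
    finally show ?thesis by (simp add: image_image E_def)
  qed
  have E_S: "E ` {\<zeta>. \<bar>Re \<zeta>\<bar> < \<rho> / 2} = spir \<mu> \<beta> \<theta>\<^sub>0"
    using E_image[of 0 \<beta>] by (simp add: \<rho>_def)
  have spir_sub: "spir \<mu> \<beta> \<theta>\<^sub>0 \<subseteq> h ` unit_disc" using max by (simp add: maximal_spirallike_sector_def)
  have E_eq: "E \<zeta> = E \<zeta>' \<longleftrightarrow> (\<exists>j::int. \<zeta>' = \<zeta> + of_int j * \<omega>)" for \<zeta> \<zeta>'
  proof -
    have "E \<zeta>' = E \<zeta> \<longleftrightarrow> (\<exists>j::int. \<i> * \<mu> * (\<zeta>' + of_real (\<theta>\<^sub>0 * m)) = \<i> * \<mu> * (\<zeta> + of_real (\<theta>\<^sub>0 * m)) + of_int (2 * j) * of_real pi * \<i>)"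
      unfolding E_def exp_eq by simp
    also have "\<dots> \<longleftrightarrow> (\<exists>j::int. \<zeta>' = \<zeta> + of_int j * \<omega>)"
    proof -
      have "\<i> * \<mu> * (\<zeta>' + of_real (\<theta>\<^sub>0 * m)) = \<i> * \<mu> * (\<zeta> + of_real (\<theta>\<^sub>0 * m)) + of_int (2 * j) * of_real pi * \<i>
         \<longleftrightarrow> \<zeta>' = \<zeta> + of_int j * \<omega>" for j :: int
      proof -
        have "\<i> * \<mu> * (\<zeta> + of_real (\<theta>\<^sub>0 * m)) + of_int (2 * j) * of_real pi * \<i>
            = \<i> * \<mu> * (\<zeta> + of_int j * \<omega> + of_real (\<theta>\<^sub>0 * m))"
          using \<mu>0 by (simp add: \<omega>_def field_simps)
        then have "\<i> * \<mu> * (\<zeta>' + of_real (\<theta>\<^sub>0 * m)) = \<i> * \<mu> * (\<zeta> + of_real (\<theta>\<^sub>0 * m)) + of_int (2 * j) * of_real pi * \<i>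
          \<longleftrightarrow> \<i> * \<mu> * (\<zeta>' + of_real (\<theta>\<^sub>0 * m)) = \<i> * \<mu> * (\<zeta> + of_int j * \<omega> + of_real (\<theta>\<^sub>0 * m))" by (simp only:)
        also have "\<dots> \<longleftrightarrow> \<zeta>' = \<zeta> + of_int j * \<omega>" using \<mu>0 by simp
        finally show ?thesis .
      qed
      then show ?thesis by simp
    qed
    finally show ?thesis by (auto simp: eq_commute)
  qed
  have E_period: "E (\<zeta> + of_int j * \<omega>) = E \<zeta>" for \<zeta> and j :: int using E_eq by metis
  have E_up: "E (\<zeta> + \<i> * of_real t) = exp (- \<mu> * of_real t) * E \<zeta>" for \<zeta> t
    by (simp add: E_def exp_add[symmetric] algebra_simps)
  have E_onto: "\<exists>\<zeta>. E \<zeta> = w" if "w \<noteq> 0" for w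
    using that \<mu>0 by (intro exI[of _ "Ln w / (\<i> * \<mu>) - of_real (\<theta>\<^sub>0 * m)"]) (simp add: E_def)
  have hol_E: "E holomorphic_on A" for A unfolding E_def by (intro holomorphic_intros)
  \<comment> \<open>A wider strip in \<open>D\<close> contradicts maximality only if its image is
    again a sector, that is, if the width is at most one period; a still wider strip is excluded by
    the shape of the image of \<open>h\<close>.\<close>
  have not_larger: False
    if u: "u \<le> - \<rho> / 2" and v: "\<rho> / 2 \<le> v" and uv: "v - u > \<rho>" and sub: "\<And>\<zeta>. u < Re \<zeta> \<Longrightarrow> Re \<zeta> < v \<Longrightarrow> \<zeta> \<in> D" for u v
  proof (cases "v - u \<le> Re \<omega>")
    case True
    define r where "r = (v - u) / m"
    define T where "T = spir \<mu> r (\<theta>\<^sub>0 + (u + v) / 2 / m)"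
    have r: "0 < r" "r \<le> 2 * pi" using True uv \<rho> m by (simp_all add: r_def Re_\<omega> divide_le_eq)
    have "r / 2 * m = (v - u) / 2" using m by (simp add: r_def)
    then have "{\<zeta>. \<bar>Re \<zeta> - (u + v) / 2\<bar> < r / 2 * m} = {\<zeta>. u < Re \<zeta> \<and> Re \<zeta> < v}"
      by (auto simp: abs_less_iff field_simps)
    then have T: "T = E ` {\<zeta>. u < Re \<zeta> \<and> Re \<zeta> < v}" using E_image[of "(u + v) / 2" r] by (simp add: T_def)
    have "spirallike_sector \<mu> T" unfolding T_def by (rule spirallike_sector_spir[OF r])
    moreover have "T \<subseteq> h ` unit_disc" unfolding T using sub by (auto simp: D_def)
    moreover have "spir \<mu> \<beta> \<theta>\<^sub>0 \<subset> T"
    proof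
      show "spir \<mu> \<beta> \<theta>\<^sub>0 \<subseteq> T" unfolding E_S[symmetric] T using u v by (intro image_mono) (auto simp: abs_less_iff)
      \<comment> \<open>An edge of the old strip inside the new one. It is not equivalent to an
        interior point, since these are less than \<rho>, hence less than a nonzero period, away
        horizontally.\<close>
      define x where "x = (if u < - \<rho> / 2 then - \<rho> / 2 else \<rho> / 2)"
      have x: "u < x" "x < v" "\<bar>x\<bar> = \<rho> / 2" using u v uv \<rho> by (auto simp: x_def)
      have "E (of_real x) \<in> T" unfolding T using x by (intro imageI) simp
      moreover have "E (of_real x) \<notin> spir \<mu> \<beta> \<theta>\<^sub>0"
      proof
        assume "E (of_real x) \<in> spir \<mu> \<beta> \<theta>\<^sub>0"
        then obtain s where s: "E (of_real x) = E s" "\<bar>Re s\<bar> < \<rho> / 2" unfolding E_S[symmetric] by blast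
        then obtain j :: int where j: "s = of_real x + of_int j * \<omega>" using E_eq by blast
        have Rs: "Re s = x + of_int j * Re \<omega>" by (simp add: j)
        have "\<bar>of_int j * Re \<omega>\<bar> < \<rho>" using Rs s(2) x(3) by linarith
        moreover have "\<bar>of_int j * Re \<omega>\<bar> = \<bar>of_int j\<bar> * Re \<omega>" using \<rho>\<omega> \<rho> by (simp add: abs_mult)
        moreover have "1 * Re \<omega> \<le> \<bar>of_int j\<bar> * Re \<omega>" if "j \<noteq> 0"
          using that \<rho>\<omega> \<rho> by (intro mult_right_mono) linarith+
        ultimately have "j = 0" using \<rho>\<omega> by linarith
        then show False using Rs s(2) x(3) by simp
      qed
      ultimately show "spir \<mu> \<beta> \<theta>\<^sub>0 \<noteq> T" by blast
    qed
    ultimately show False using max unfolding maximal_spirallike_sector_def by blast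
  next
    \<comment> \<open>A strip wider than the period contains a representative of every point, so the
      image of \<open>h\<close> would be the plane without 0, and with 0 by \<open>h0\<close>; a
      univalent image of the disc is not the whole plane.\<close>
    case False
    have "w \<in> h ` unit_disc" for w
    proof (cases "w = 0")
      case False
      then obtain \<zeta> where \<zeta>: "E \<zeta> = w" using E_onto by blast
      have \<omega>pos: "Re \<omega> > 0" using \<rho>\<omega> \<rho> by linarith
      define j where "j = \<lfloor>(Re \<zeta> - u) / Re \<omega>\<rfloor>"
      \<comment> \<open>The floor moves the abscissa into the interval from \<open>u\<close>,
        included, to u + Re \<omega>. The value \<open>u\<close> itself is not in the open strip and
        is moved one period further instead.\<close>
      define i where "i = (if of_int j * Re \<omega> = Re \<zeta> - u then j - 1 else j)"
      have "of_int j \<le> (Re \<zeta> - u) / Re \<omega>" "(Re \<zeta> - u) / Re \<omega> < of_int j + 1" unfolding j_def by linarith+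
      then have "of_int j * Re \<omega> \<le> Re \<zeta> - u" "Re \<zeta> - u < (of_int j + 1) * Re \<omega>"
        using \<omega>pos by (simp_all add: pos_le_divide_eq pos_divide_less_eq)
      then have "u < Re \<zeta> - of_int i * Re \<omega>" "Re \<zeta> - of_int i * Re \<omega> < v"
        using \<omega>pos \<open>\<not> v - u \<le> Re \<omega>\<close> by (auto simp: i_def algebra_simps)
      then have "\<zeta> + of_int (- i) * \<omega> \<in> D" by (intro sub) auto
      then show ?thesis using E_period[of \<zeta> "- i"] \<zeta> by (simp add: D_def)
    qed (use h0 in simp)
    then show False using hi(6) by blast
  qed
  interpret petal_chart \<phi> D k \<omega> \<rho>
  proof
    show "holomorphic_semigroup \<phi>" by (rule sem)
    have "D = E -` (h ` unit_disc)" by (auto simp: D_def)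
    then show "open D" using hi(5) holomorphic_on_imp_continuous_on[OF hol_E] by (auto intro!: open_vimage)
    have "(hi \<circ> E) holomorphic_on D"
      by (rule holomorphic_on_compose_gen[OF hol_E hi(1)]) (auto simp: D_def)
    then show "k holomorphic_on D" by (simp add: k_def o_def)
    show "cmod (k \<zeta>) < 1" if "\<zeta> \<in> D" for \<zeta> using hi(3) that by (simp add: k_def D_def)
    have up: "E (\<zeta> + \<i> * of_real t) = h (\<phi> t (k \<zeta>))" "cmod (\<phi> t (k \<zeta>)) < 1" if "\<zeta> \<in> D" "t \<ge> 0" for \<zeta> t
      unfolding E_up using that conj[OF that(2), of "k \<zeta>"] hi(3,4)[of "E \<zeta>"] semigroup_norm_less_one[OF sem that(2), of "k \<zeta>"]
      by (simp_all add: k_def D_def)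
    show "\<zeta> + \<i> * of_real t \<in> D" if "\<zeta> \<in> D" "t \<ge> 0" for \<zeta> t using up[OF that] by (simp add: D_def)
    show "k (\<zeta> + \<i> * of_real t) = \<phi> t (k \<zeta>)" if "\<zeta> \<in> D" "t \<ge> 0" for \<zeta> t
      using hi(2)[OF up(2)[OF that]] up(1)[OF that] by (simp add: k_def)
    show "\<zeta> + of_int j * \<omega> \<in> D" "k (\<zeta> + of_int j * \<omega>) = k \<zeta>" if "\<zeta> \<in> D" for \<zeta> j
      using that by (simp_all add: D_def k_def E_period)
    show "\<exists>j. \<zeta>' = \<zeta> + of_int j * \<omega>" if "\<zeta> \<in> D" "\<zeta>' \<in> D" "k \<zeta> = k \<zeta>'" for \<zeta> \<zeta>'
    proof -
      have "h (hi (E \<zeta>)) = h (hi (E \<zeta>'))" using that(3) by (simp add: k_def)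
      then have "E \<zeta> = E \<zeta>'" using that(1,2) unfolding D_def mem_Collect_eq by (simp only: hi(4))
      then show ?thesis by (simp only: E_eq)
    qed
    show strip_D: "\<zeta> \<in> D" if "\<bar>Re \<zeta>\<bar> < \<rho> / 2" for \<zeta>
      using that spir_sub unfolding E_S[symmetric] by (auto simp: D_def)
    show "\<exists>b. b \<notin> D \<and> - \<rho> / 2 - \<epsilon> < Re b \<and> Re b \<le> - \<rho> / 2" if "\<epsilon> > 0" for \<epsilon>
    proof (rule ccontr)
      assume no: "\<not> ?thesis"
      have "\<zeta> \<in> D" if "- \<rho> / 2 - \<epsilon> < Re \<zeta>" "Re \<zeta> < \<rho> / 2" for \<zeta>
        using no strip_D[of \<zeta>] that by (cases "Re \<zeta> \<le> - \<rho> / 2") auto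
      then show False using \<open>\<epsilon> > 0\<close> by (intro not_larger[of "- \<rho> / 2 - \<epsilon>" "\<rho> / 2"]) auto
    qed
    show "\<exists>b. b \<notin> D \<and> \<rho> / 2 \<le> Re b \<and> Re b < \<rho> / 2 + \<epsilon>" if "\<epsilon> > 0" for \<epsilon>
    proof (rule ccontr)
      assume no: "\<not> ?thesis"
      have "\<zeta> \<in> D" if "- \<rho> / 2 < Re \<zeta>" "Re \<zeta> < \<rho> / 2 + \<epsilon>" for \<zeta>
        using no strip_D[of \<zeta>] that by (cases "\<rho> / 2 \<le> Re \<zeta>") auto
      then show False using \<open>\<epsilon> > 0\<close> by (intro not_larger[of "- \<rho> / 2" "\<rho> / 2 + \<epsilon>"]) auto
    qed
    show "\<exists>\<delta> l. \<delta> > 0 \<and> l holomorphic_on (unit_disc \<inter> ball \<sigma> \<delta>) \<and>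
      (\<forall>z\<in>unit_disc \<inter> ball \<sigma> \<delta>. l z \<in> D \<and> k (l z) = z)" if "cmod \<sigma> = 1" for \<sigma>
    proof -
      obtain z0 where z0: "cmod z0 < 1" "h z0 = 0" using h0 by auto
      \<comment> \<open>The ball around \<sigma> just misses the zero of \<open>h\<close>, so
        \<open>h\<close> has a holomorphic logarithm on the convex set \<open>N\<close>.\<close>
      define \<delta> where "\<delta> = dist \<sigma> z0"
      have "\<delta> > 0" using z0(1) that by (auto simp: \<delta>_def)
      define N where "N = unit_disc \<inter> ball \<sigma> \<delta>"
      have nz: "h z \<noteq> 0" if "z \<in> N" for z
      proof
        assume "h z = 0"
        then have "z = z0" using inj_onD[OF h(2), of z z0] z0 that by (simp add: N_def)
        then show False using that by (simp add: N_def \<delta>_def)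
      qed
      have "contractible N" unfolding N_def by (intro convex_imp_contractible convex_Int convex_ball)
      moreover have "h holomorphic_on N" unfolding N_def by (rule holomorphic_on_subset[OF h(1)]) auto
      ultimately obtain G where G: "G holomorphic_on N" "\<And>z. z \<in> N \<Longrightarrow> h z = exp (G z)"
        using contractible_imp_holomorphic_log[of h N] nz by blast
      define l where "l = (\<lambda>z. G z / (\<i> * \<mu>) - of_real (\<theta>\<^sub>0 * m))"
      have "l holomorphic_on N" unfolding l_def using \<mu>0 by (intro holomorphic_intros G) auto
      moreover have El: "E (l z) = h z" if "z \<in> N" for z using G(2)[OF that] \<mu>0 by (simp add: E_def l_def)
      have "l z \<in> D \<and> k (l z) = z" if "z \<in> N" for z
        using that El[OF that] hi(2)[of z] by (auto simp: D_def k_def N_def)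
      ultimately show ?thesis using \<open>\<delta> > 0\<close> unfolding N_def by blast
    qed
    have outside: "h z = 0" if "cmod z < 1" "z \<notin> k ` D" for z
    proof (rule ccontr)
      assume "h z \<noteq> 0"
      then obtain \<zeta> where "E \<zeta> = h z" using E_onto by blast
      then have "\<zeta> \<in> D" "k \<zeta> = z" using that hi(2)[of z] by (auto simp: D_def k_def)
      then show False using that(2) by blast
    qed
    show "\<phi> t z = z" if "cmod z < 1" "z \<notin> k ` D" "t \<ge> 0" for z t
    proof (rule inj_onD[OF h(2)])
      show "h (\<phi> t z) = h z" using conj[OF that(3,1)] outside[OF that(1,2)] by simp
    qed (use that semigroup_norm_less_one[OF sem] in auto)
    show "\<exists>y. b + \<i> * of_real y \<in> D \<and> k (b + \<i> * of_real y) \<in> V"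
      if z: "cmod z < 1" "z \<notin> k ` D" and V: "open V" "z \<in> V" for z b V
    proof -
      have "open (h ` unit_disc \<inter> hi -` V)"
        by (rule continuous_open_preimage[OF holomorphic_on_imp_continuous_on[OF hi(1)] hi(5) V(1)])
      moreover have "0 \<in> h ` unit_disc \<inter> hi -` V" using h0 hi(2)[OF z(1)] outside[OF z] V(2) by simp
      ultimately have ev: "\<forall>\<^sub>F w in nhds 0. w \<in> h ` unit_disc \<inter> hi -` V" by (rule eventually_nhds_in_open)
      \<comment> \<open>Upward columns are forward orbits, and in the Koenigs plane they all spiral
        into 0, the image of the only point outside the chart.\<close>
      have "((\<lambda>y. exp (- \<mu> * of_real y) * E b) \<longlongrightarrow> 0) at_top"
      proof (rule tendsto_mult_left_zero, rule tendsto_norm_zero_cancel)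
        have "filterlim (\<lambda>y. - Re \<mu> * y) at_bot at_top"
          using \<mu> by (simp add: filterlim_uminus_at_bot filterlim_tendsto_pos_mult_at_top[OF tendsto_const _ filterlim_ident])
        from filterlim_compose[OF exp_at_bot this] show "((\<lambda>y. cmod (exp (- \<mu> * of_real y))) \<longlongrightarrow> 0) at_top"
          by simp
      qed
      then have "\<forall>\<^sub>F y in at_top. E (b + \<i> * of_real y) \<in> h ` unit_disc \<inter> hi -` V"
        unfolding E_up using ev by (rule filterlim_iff[THEN iffD1, rule_format])
      then obtain y where "E (b + \<i> * of_real y) \<in> h ` unit_disc \<inter> hi -` V"
        using eventually_happens trivial_limit_at_top_linorder by blast
      then show ?thesis by (auto simp: D_def k_def)
    qed
  qed (use \<rho> \<rho>\<omega> in auto)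
  have "k ` S = \<Delta>"
  proof
    show "k ` S \<subseteq> \<Delta>"
    proof
      fix z assume "z \<in> k ` S"
      then obtain \<zeta> where \<zeta>: "\<zeta> \<in> S" "z = hi (E \<zeta>)" by (auto simp: k_def)
      then have "E \<zeta> \<in> spir \<mu> \<beta> \<theta>\<^sub>0" unfolding E_S[symmetric] S_def by blast
      then show "z \<in> \<Delta>" using hi(3,4)[of "E \<zeta>"] \<zeta>(2) spir_sub by (auto simp: \<Delta>_def)
    qed
    show "\<Delta> \<subseteq> k ` S"
    proof
      fix z assume "z \<in> \<Delta>"
      then have z: "cmod z < 1" "h z \<in> spir \<mu> \<beta> \<theta>\<^sub>0" by (auto simp: \<Delta>_def)
      then obtain \<zeta> where "\<zeta> \<in> S" "h z = E \<zeta>" unfolding E_S[symmetric] S_def by blast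
      moreover from this have "k \<zeta> = z" using hi(2)[OF z(1)] by (simp add: k_def)
      ultimately show "z \<in> k ` S" by force
    qed
  qed
  moreover have "- pi / \<rho> = - ((cmod \<mu>)\<^sup>2 * pi) / (\<beta> * Re \<mu>)"
    using \<beta> \<mu> npos by (simp add: \<rho>_def m_def field_simps)
  ultimately show "hyperbolic_petal \<phi> \<Delta>"
    and "\<And>\<sigma>. \<sigma> \<in> frontier \<Delta> \<Longrightarrow> repelling_fixed_point \<phi> \<sigma> \<Longrightarrow>
      repelling_spectral_value \<phi> \<sigma> (- ((cmod \<mu>)\<^sup>2 * pi) / (\<beta> * Re \<mu>))"
    using hyperbolic_petal_of_strip by simp_all
qed

theorem theorem5p7:
  fixes \<phi> :: "real \<Rightarrow> complex \<Rightarrow> complex" and \<tau> \<mu> :: complex and h :: "complex \<Rightarrow> complex"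
  assumes "holomorphic_semigroup \<phi>"
    and "\<not> semigroup_is_group \<phi>"
    and "denjoy_wolff_point \<phi> \<tau>"
    and "spectral_value \<phi> \<tau> \<mu>"
    and "koenigs_function \<phi> \<tau> \<mu> h"
  shows "(\<tau> \<in> unit_disc \<longrightarrow>
           (\<forall>\<theta>\<^sub>0\<in>{-pi..<pi}. \<forall>\<beta>\<in>{0<..2 * pi}.
              maximal_spirallike_sector \<mu> (h ` unit_disc) (spir \<mu> \<beta> \<theta>\<^sub>0) \<longrightarrow>
              (let \<Delta> = {z \<in> unit_disc. h z \<in> spir \<mu> \<beta> \<theta>\<^sub>0} in
                 hyperbolic_petal \<phi> \<Delta> \<and>
                 (\<forall>\<sigma>\<in>frontier \<Delta>. repelling_fixed_point \<phi> \<sigma> \<longrightarrow>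
                    repelling_spectral_value \<phi> \<sigma> (- ((cmod \<mu>)\<^sup>2 * pi) / (\<beta> * Re \<mu>)))))) \<and>
         (\<tau> \<in> unit_circle \<longrightarrow>
           (\<forall>z\<^sub>0. \<forall>\<rho>>0.
              maximal_strip (h ` unit_disc) ((+) z\<^sub>0 ` strip \<rho>) \<longrightarrow>
              (let \<Delta> = {z \<in> unit_disc. h z \<in> (+) z\<^sub>0 ` strip \<rho>} in
                 hyperbolic_petal \<phi> \<Delta> \<and>
                 (\<forall>\<sigma>\<in>frontier \<Delta>. repelling_fixed_point \<phi> \<sigma> \<longrightarrow>
                    repelling_spectral_value \<phi> \<sigma> (- pi / \<rho>)))))"
proof (intro conjI impI ballI allI)
  fix \<theta>\<^sub>0 \<beta> :: real
  assume \<tau>: "\<tau> \<in> unit_disc" and \<beta>: "\<beta> \<in> {0<..2 * pi}"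
    and max: "maximal_spirallike_sector \<mu> (h ` unit_disc) (spir \<mu> \<beta> \<theta>\<^sub>0)"
  have \<mu>: "Re \<mu> > 0" using assms(4) \<tau> by (simp add: spectral_value_def)
  have model: "semigroup_model \<phi> UNIV h (\<lambda>t z. exp (- \<mu> * of_real t) * z)"
    using assms(5) \<tau> by (simp add: koenigs_function_def)
  \<comment> \<open>The model exhausts the plane by preimages of the image of \<open>h\<close> under
    maps that fix 0, so 0 is itself in the image.\<close>
  have "(0::complex) \<in> (\<Union>t\<in>{0..}. {w \<in> UNIV. exp (- \<mu> * of_real t) * w \<in> h ` unit_disc})"
    using model unfolding semigroup_model_def by blast
  then have h0: "0 \<in> h ` unit_disc" by auto
  have h: "h holomorphic_on unit_disc" "inj_on h unit_disc"
    "\<And>t z. t \<ge> 0 \<Longrightarrow> cmod z < 1 \<Longrightarrow> h (\<phi> t z) = exp (- \<mu> * of_real t) * h z"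
    using model by (auto simp: semigroup_model_def)
  show "let \<Delta> = {z \<in> unit_disc. h z \<in> spir \<mu> \<beta> \<theta>\<^sub>0} in
      hyperbolic_petal \<phi> \<Delta> \<and>
      (\<forall>\<sigma>\<in>frontier \<Delta>. repelling_fixed_point \<phi> \<sigma> \<longrightarrow>
         repelling_spectral_value \<phi> \<sigma> (- ((cmod \<mu>)\<^sup>2 * pi) / (\<beta> * Re \<mu>)))"
    using hyperbolic_petal_of_maximal_sector[OF assms(1) \<mu> h h0 _ _ max] \<beta> unfolding Let_def by simp
next
  fix z\<^sub>0 :: complex and \<rho> :: real
  assume \<tau>: "\<tau> \<in> unit_circle" and \<rho>: "\<rho> > 0"
    and max: "maximal_strip (h ` unit_disc) ((+) z\<^sub>0 ` strip \<rho>)"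
  have "\<tau> \<notin> unit_disc" using \<tau> by simp
  then obtain \<Omega> where model: "semigroup_model \<phi> \<Omega> h (\<lambda>t z. z + \<i> * of_real t)"
    using assms(5) unfolding koenigs_function_def by (auto split: if_splits)
  have h: "h holomorphic_on unit_disc" "inj_on h unit_disc"
    "\<And>t z. t \<ge> 0 \<Longrightarrow> cmod z < 1 \<Longrightarrow> h (\<phi> t z) = h z + \<i> * of_real t"
    using model by (auto simp: semigroup_model_def)
  show "let \<Delta> = {z \<in> unit_disc. h z \<in> (+) z\<^sub>0 ` strip \<rho>} in
      hyperbolic_petal \<phi> \<Delta> \<and>
      (\<forall>\<sigma>\<in>frontier \<Delta>. repelling_fixed_point \<phi> \<sigma> \<longrightarrow> repelling_spectral_value \<phi> \<sigma> (- pi / \<rho>))"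
    using hyperbolic_petal_of_maximal_strip[OF assms(1) h \<rho> max] unfolding Let_def by blast
qed

end
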